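(* Let $[a,b]\subset\mathbb{R}$ be a finite interval, $n\in\mathbb{N}\cup\{0\}$, $m,r\in\mathbb{N}$, $1\leq p\leq\infty$, let $\mathcal{M}$ be a metric space and $\mu_0\in\mathcal{M}$ a limit point of $\mathcal{M}$. For every $\mu\in\mathcal{M}$ let $A_{r-\ell}(\cdot,\mu)\in(W_p^n)^{m\times m}$, $\ell\in\{1,\dots,r\}$, and a continuous linear operator $B(\mu)\colon(W_p^{n+r})^m\to\mathbb{C}^{rm}$ be given (with no a priori regularity in $\mu$), and consider the boundary-value problem $$(L(\mu)y(\mu))(t):=y^{(r)}(t,\mu)+\sum_{\ell=1}^{r}A_{r-\ell}(t,\mu)\,y^{(r-\ell)}(t,\mu)=f(t,\mu),\ t\in(a,b),\qquad B(\mu)y(\mu)=c(\mu),$$ with $f(\cdot,\mu)\in(W_p^n)^m$, $c(\mu)\in\mathbb{C}^{rm}$ and unknown $y(\cdot,\mu)\in(W_p^{n+r})^m$. The solution to this boundary-value problem depends continuously on the parameter $\mu$ at $\mu_0$ if and only if all of the following hold: (0) the homogeneous problem $L(\mu_0)y=0$ on $(a,b)$, $B(\mu_0)y=0$ has only the trivial solution $y=0$ in $(W_p^{n+r})^m$; (I) $A_{r-\ell}(\cdot,\mu)\to A_{r-\ell}(\cdot,\mu_0)$ in $(W_p^n)^{m\times m}$ as $\mu\to\mu_0$, for every $\ell\in\{1,\dots,r\}$; (II) $B(\mu)y\to B(\mu_0)y$ in $\mathbb{C}^{rm}$ as $\mu\to\mu_0$, for every $y\in(W_p^{n+r})^m$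.
   Context: For $l\in\mathbb{N}$, $W_p^{l}=W_p^l([a,b];\mathbb{C})$ is the space of $y\in C^{l-1}([a,b];\mathbb{C})$ with $y^{(l-1)}$ absolutely continuous and $y^{(l)}\in L_p[a,b]$, with norm $\|y\|_{l,p}=\sum_{s=0}^{l}\|y^{(s)}\|_p$; $W_p^0:=L_p$. $(W_p^{l})^m$ and $(W_p^l)^{m\times m}$ are the spaces of $\mathbb{C}^m$-valued (column) and $\mathbb{C}^{m\times m}$-valued functions with entries in $W_p^l$, normed by the sum of the norms of the entries. A solution is a function in $(W_p^{n+r})^m$ satisfying the differential equation (everywhere on $(a,b)$ if $n\ge1$, almost everywhere if $n=0$) and the boundary condition. $\mathcal{B}(\mu_0,\varepsilon)$ is the ball in $\mathcal{M}$ of centre $\mu_0$ and radius $\varepsilon$. Definition. The solution to the boundary-value problem depends continuously on the parameter $\mu$ at a limit point $\mu_0$ of $\mathcal{M}$ if the following two conditions are satisfied: $(\ast)$ there exists $\varepsilon>0$ such that for all $\mu\in\mathcal{B}(\mu_0,\varepsilon)$ and arbitrary right-hand sides $f(\cdot,\mu)\in(W_p^n)^m$ and $c(\mu)\in\mathbb{C}^{rm}$ the problem has a unique solution $y(\cdot,\mu)\in(W_p^{n+r})^m$; $(\ast\ast)$ for all families of right-hand sides, the convergence $f(\cdot,\mu)\to f(\cdot,\mu_0)$ in $(W_p^n)^m$ and $c(\mu)\to c(\mu_0)$ in $\mathbb{C}^{rm}$ as $\mu\to\mu_0$ implies $y(\cdot,\mu)\to y(\cdot,\mu_0)$ in $(W_p^{n+r})^m$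 as $\mu\to\mu_0$. *)

theory Defs
  imports "HOL-Analysis.Analysis" "HOL-Probability.Essential_Supremum"
begin

text \<open>Elements of the function spaces are represented by functions on the whole real line of
  which only the values on \<open>{a..b}\<close> matter: measures, derivatives and the epsilon-delta conditions
  below are all relative to \<open>{a..b}\<close>. Two such functions represent the same element iff they agree
  on \<open>{a..b}\<close> or, in the case of \<open>L\<^sub>p\<close>, almost everywhere on \<open>{a..b}\<close>.\<close>

definition Lp_on :: "real \<Rightarrow> real \<Rightarrow> ennreal \<Rightarrow> (real \<Rightarrow> complex) set" where
  "Lp_on a b p =
    {f. f \<in> borel_measurable (lebesgue_on {a..b}) \<and>
        (if p = \<infinity> then esssup (lebesgue_on {a..b}) (\<lambda>t. ereal (norm (f t))) < \<infinity>
         else integrable (lebesgue_on {a..b}) (\<lambda>t. norm (f t) powr enn2real p))}"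

definition Lp_norm :: "real \<Rightarrow> real \<Rightarrow> ennreal \<Rightarrow> (real \<Rightarrow> complex) \<Rightarrow> real" where
  "Lp_norm a b p f =
    (if p = \<infinity> then real_of_ereal (esssup (lebesgue_on {a..b}) (\<lambda>t. ereal (norm (f t))))
     else (LINT t|lebesgue_on {a..b}. norm (f t) powr enn2real p) powr (1 / enn2real p))"

text \<open>The \<open>k\<close>-th derivative on \<open>[a,b]\<close>, one-sided at the end points. At a point where the
  derivative does not exist the value is unspecified.\<close>

definition nth_deriv_on ::
    "real \<Rightarrow> real \<Rightarrow> nat \<Rightarrow> (real \<Rightarrow> 'e::real_normed_vector) \<Rightarrow> real \<Rightarrow> 'e" where
  "nth_deriv_on a b k f = ((\<lambda>g t. vector_derivative g (at t within {a..b})) ^^ k) f"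

definition abs_continuous_on :: "real \<Rightarrow> real \<Rightarrow> (real \<Rightarrow> complex) \<Rightarrow> bool" where
  "abs_continuous_on a b f \<longleftrightarrow>
    (\<forall>e>0. \<exists>d>0. \<forall>D.
       finite D \<and> (\<forall>(u, v)\<in>D. a \<le> u \<and> u \<le> v \<and> v \<le> b) \<and>
       disjoint_family_on (\<lambda>(u, v). {u<..<v}) D \<and> (\<Sum>(u, v)\<in>D. v - u) < d
       \<longrightarrow> (\<Sum>(u, v)\<in>D. norm (f v - f u)) < e)"

text \<open>For \<open>l \<ge> 1\<close> the last two conditions spell out that the \<open>l\<close>-th derivative, which exists
  almost everywhere because the previous one is absolutely continuous, belongs to \<open>L\<^sub>p\<close>.\<close>

definition sobolev :: "real \<Rightarrow> real \<Rightarrow> ennreal \<Rightarrow> nat \<Rightarrow> (real \<Rightarrow> complex) set" where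
  "sobolev a b p l =
    (if l = 0 then Lp_on a b p
     else {y. (\<forall>s<l - 1. nth_deriv_on a b s y differentiable_on {a..b}) \<and>
              (\<forall>s\<le>l - 1. continuous_on {a..b} (nth_deriv_on a b s y)) \<and>
              abs_continuous_on a b (nth_deriv_on a b (l - 1) y) \<and>
              (AE t in lebesgue_on {a..b}.
                 nth_deriv_on a b (l - 1) y differentiable (at t within {a..b})) \<and>
              nth_deriv_on a b l y \<in> Lp_on a b p})"

definition sobolev_norm :: "real \<Rightarrow> real \<Rightarrow> ennreal \<Rightarrow> nat \<Rightarrow> (real \<Rightarrow> complex) \<Rightarrow> real" where
  "sobolev_norm a b p l y = (\<Sum>s\<le>l. Lp_norm a b p (nth_deriv_on a b s y))"

definition sobolev_vec ::
    "real \<Rightarrow> real \<Rightarrow> ennreal \<Rightarrow> nat \<Rightarrow> (real \<Rightarrow> complex ^ 'm) set" where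
  "sobolev_vec a b p l = {y. \<forall>i. (\<lambda>t. y t $ i) \<in> sobolev a b p l}"

definition sobolev_vec_norm ::
    "real \<Rightarrow> real \<Rightarrow> ennreal \<Rightarrow> nat \<Rightarrow> (real \<Rightarrow> complex ^ 'm) \<Rightarrow> real" where
  "sobolev_vec_norm a b p l y = (\<Sum>i\<in>UNIV. sobolev_norm a b p l (\<lambda>t. y t $ i))"

definition sobolev_mat ::
    "real \<Rightarrow> real \<Rightarrow> ennreal \<Rightarrow> nat \<Rightarrow> (real \<Rightarrow> complex ^ 'm ^ 'm) set" where
  "sobolev_mat a b p l = {X. \<forall>i j. (\<lambda>t. X t $ i $ j) \<in> sobolev a b p l}"

definition sobolev_mat_norm ::
    "real \<Rightarrow> real \<Rightarrow> ennreal \<Rightarrow> nat \<Rightarrow> (real \<Rightarrow> complex ^ 'm ^ 'm) \<Rightarrow> real" where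
  "sobolev_mat_norm a b p l X =
    (\<Sum>i\<in>UNIV. \<Sum>j\<in>UNIV. sobolev_norm a b p l (\<lambda>t. X t $ i $ j))"

text \<open>Continuity with respect to the norm forces an operator to take the same value on two
  functions that agree on \<open>{a..b}\<close>, so it is an operator on the Sobolev space proper.\<close>

definition continuous_linear_operator ::
    "real \<Rightarrow> real \<Rightarrow> ennreal \<Rightarrow> nat \<Rightarrow> ((real \<Rightarrow> complex ^ 'm) \<Rightarrow> complex ^ 'k) \<Rightarrow> bool" where
  "continuous_linear_operator a b p l T \<longleftrightarrow>
    (\<forall>y\<in>sobolev_vec a b p l. \<forall>z\<in>sobolev_vec a b p l. T (\<lambda>t. y t + z t) = T y + T z) \<and>
    (\<forall>y\<in>sobolev_vec a b p l. \<forall>c. T (\<lambda>t. c *s y t) = c *s T y) \<and>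
    (\<forall>y\<in>sobolev_vec a b p l. \<forall>e>0. \<exists>d>0. \<forall>z\<in>sobolev_vec a b p l.
       sobolev_vec_norm a b p l (\<lambda>t. z t - y t) < d \<longrightarrow> dist (T z) (T y) < e)"

definition diff_expr ::
    "real \<Rightarrow> real \<Rightarrow> nat \<Rightarrow> (nat \<Rightarrow> real \<Rightarrow> complex ^ 'm ^ 'm) \<Rightarrow>
     (real \<Rightarrow> complex ^ 'm) \<Rightarrow> real \<Rightarrow> complex ^ 'm" where
  "diff_expr a b r A y t =
    nth_deriv_on a b r y t + (\<Sum>l=1..r. A (r - l) t *v nth_deriv_on a b (r - l) y t)"

definition bvp_solution ::
    "real \<Rightarrow> real \<Rightarrow> ennreal \<Rightarrow> nat \<Rightarrow> nat \<Rightarrow> (nat \<Rightarrow> real \<Rightarrow> complex ^ 'm ^ 'm) \<Rightarrow>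
     ((real \<Rightarrow> complex ^ 'm) \<Rightarrow> complex ^ 'k) \<Rightarrow>
     (real \<Rightarrow> complex ^ 'm) \<Rightarrow> complex ^ 'k \<Rightarrow> (real \<Rightarrow> complex ^ 'm) \<Rightarrow> bool" where
  "bvp_solution a b p n r A B f c y \<longleftrightarrow>
    y \<in> sobolev_vec a b p (n + r) \<and>
    (if n = 0 then AE t in lebesgue_on {a..b}. diff_expr a b r A y t = f t
     else \<forall>t\<in>{a<..<b}. diff_expr a b r A y t = f t) \<and>
    B y = c"

definition bvp_unique_solution ::
    "real \<Rightarrow> real \<Rightarrow> ennreal \<Rightarrow> nat \<Rightarrow> nat \<Rightarrow> (nat \<Rightarrow> real \<Rightarrow> complex ^ 'm ^ 'm) \<Rightarrow>
     ((real \<Rightarrow> complex ^ 'm) \<Rightarrow> complex ^ 'k) \<Rightarrow>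
     (real \<Rightarrow> complex ^ 'm) \<Rightarrow> complex ^ 'k \<Rightarrow> bool" where
  "bvp_unique_solution a b p n r A B f c \<longleftrightarrow>
    (\<exists>y. bvp_solution a b p n r A B f c y) \<and>
    (\<forall>y z. bvp_solution a b p n r A B f c y \<and> bvp_solution a b p n r A B f c z
       \<longrightarrow> (\<forall>t\<in>{a..b}. y t = z t))"

text \<open>In the second condition, \<open>y \<mu>\<close> is required to be the solution only for \<open>\<mu>\<close> in some
  neighbourhood of \<open>\<mu>\<^sub>0\<close> (\<open>\<mu>\<^sub>0\<close> included), since the first condition provides
  solutions only there.\<close>

definition solution_depends_continuously ::
    "real \<Rightarrow> real \<Rightarrow> ennreal \<Rightarrow> nat \<Rightarrow> nat \<Rightarrow>
     (nat \<Rightarrow> 'p::metric_space \<Rightarrow> real \<Rightarrow> complex ^ 'm ^ 'm) \<Rightarrow>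
     ('p \<Rightarrow> (real \<Rightarrow> complex ^ 'm) \<Rightarrow> complex ^ 'k) \<Rightarrow> 'p \<Rightarrow> bool" where
  "solution_depends_continuously a b p n r A B \<mu>\<^sub>0 \<longleftrightarrow>
    (\<exists>\<epsilon>>0. \<forall>\<mu>\<in>ball \<mu>\<^sub>0 \<epsilon>. \<forall>f\<in>sobolev_vec a b p n. \<forall>c.
       bvp_unique_solution a b p n r (\<lambda>j. A j \<mu>) (B \<mu>) f c) \<and>
    (\<forall>f c y.
       (\<forall>\<mu>. f \<mu> \<in> sobolev_vec a b p n) \<and>
       (\<forall>\<^sub>F \<mu> in nhds \<mu>\<^sub>0. bvp_solution a b p n r (\<lambda>j. A j \<mu>) (B \<mu>) (f \<mu>) (c \<mu>) (y \<mu>)) \<and>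
       ((\<lambda>\<mu>. sobolev_vec_norm a b p n (\<lambda>t. f \<mu> t - f \<mu>\<^sub>0 t)) \<longlongrightarrow> 0) (at \<mu>\<^sub>0) \<and>
       (c \<longlongrightarrow> c \<mu>\<^sub>0) (at \<mu>\<^sub>0)
       \<longrightarrow> ((\<lambda>\<mu>. sobolev_vec_norm a b p (n + r) (\<lambda>t. y \<mu> t - y \<mu>\<^sub>0 t)) \<longlongrightarrow> 0) (at \<mu>\<^sub>0))"

end

theory Submission
  imports Defs
begin

text \<open>The key to sufficiency is an a priori estimate
  \<open>\<parallel>y\<parallel> \<le> C (\<parallel>L(\<mu>) y\<parallel> + \<bar>B(\<mu>) y\<bar>)\<close> that is uniform for \<open>\<mu>\<close> near \<open>\<mu>\<^sub>0\<close>.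

  With zero Cauchy data at \<open>a\<close> the equation \<open>L y = f\<close> is a Volterra equation for \<open>y\<^sup>(\<^sup>r\<^sup>)\<close>; its
  Neumann series converges at a rate controlled by the norms of the coefficients, and bootstrapping lifts
  the resulting bound from \<open>L\<^sub>p\<close> to \<open>W\<^sub>p\<^sup>n\<close>. The Cauchy data of \<open>y\<close> are recovered from \<open>B(\<mu>) y\<close> because the
  square matrix of \<open>B(\<mu>\<^sub>0)\<close> on fundamental solutions is invertible by (0), while (II) and the uniform boundedness
  principle make \<open>B(\<mu>)\<close> bounded uniformly near \<open>\<mu>\<^sub>0\<close>.

  Necessity: solving \<open>L(\<mu>) y(\<mu>) = L(\<mu>\<^sub>0) y\<^sub>0\<close>, \<open>B(\<mu>) y(\<mu>) = B(\<mu>\<^sub>0) y\<^sub>0\<close> for polynomial \<open>y\<^sub>0\<close> yields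
  \<open>(L(\<mu>) - L(\<mu>\<^sub>0)) y\<^sub>0 = - L(\<mu>) (y(\<mu>) - y\<^sub>0)\<close>, which forces (I). For (II), the solution of
  \<open>L(\<mu>) u = L(\<mu>) y\<close>, \<open>B(\<mu>) u = B(\<mu>\<^sub>0) y\<close> converges to \<open>y\<close>, and \<open>y - u\<close> is a combination of fundamental
  solutions whose coefficients are the components of \<open>B(\<mu>) y - B(\<mu>\<^sub>0) y\<close>.\<close>

text \<open>The spaces are defined by pointwise derivatives and epsilon-delta absolute continuity,
  which compose badly. Almost everything therefore runs through one relation:
  \<open>prim f g\<close> makes f an indefinite integral of the integrable function g.
  \<open>W_SucD\<close> and \<open>prim_W\<close> express membership in W^(l+1) by
  \<open>prim\<close> and membership in W^l, so that sums, products, completeness and iterated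
  integrals become inductions on the order.

  What shapes the estimates is that for n = 0 the coefficients are merely in L_p, with any p from 1
  to \<infinity>. In general they have no sup bound, and a product of two L_p functions may leave
  L_p, so a product at order l pairs W^l with W^(l+1) unless the order is positive. In the Volterra
  iteration the coefficients enter the factorial terms only through an L_1 norm, and the constants
  of the problem with zero Cauchy data depend on the coefficients only through an upper bound R of
  their norms. One constant then serves all \<mu> near \<open>\<mu>\<^sub>0\<close>.\<close>

section \<open>Convexity of powers and one-sided differentiation of integrals\<close>

lemma powr_convex_nonneg:
  fixes u v c d P :: real
  assumes "P \<ge> 1" "u \<ge> 0" "v \<ge> 0" "c \<ge> 0" "d \<ge> 0" "c + d = 1"
  shows "(c * u + d * v) powr P \<le> c * u powr P + d * v powr P"
proof -
  \<comment> \<open>Covers a vanishing argument, where one term is left and e powr P \<le> e on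
    [0, 1] replaces convexity.\<close>
  have shrink: "(e * w) powr P \<le> e * w powr P" if "0 \<le> e" "e \<le> 1" "w \<ge> 0" for e w :: real
  proof -
    have "e powr P \<le> e"
      using powr_mono'[of 1 P e] that \<open>P \<ge> 1\<close> by (cases "e = 0") auto
    then show ?thesis
      using that by (simp add: powr_mult mult_right_mono)
  qed
  show ?thesis
  proof (cases "u = 0 \<or> v = 0")
    case True
    then show ?thesis
    proof
      assume "u = 0" then show ?thesis using shrink[of d v] assms by simp
    next
      assume "v = 0" then show ?thesis using shrink[of c u] assms by simp
    qed
  next
    case False
    have "c = 1 - d" using assms by simp
    with convex_onD[OF powr_convex[OF \<open>P \<ge> 1\<close>], of d u v] assms False show ?thesis
      by (simp only:) (simp add: less_le)
  qed
qed

text \<open>Lebesgue's differentiation theorem, with the difference quotient multiplied out. It sees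
  only increments to the right, because the averages are taken over intervals with left end point x;
  the left side is obtained later by reflection.\<close>

lemma integral_right_derivative_AE:
  fixes g :: "real \<Rightarrow> complex"
  assumes "\<And>u v. g integrable_on {u..v}"
  shows "\<exists>S. negligible S \<and> (\<forall>x e. x \<notin> S \<and> 0 < e \<longrightarrow>
    (\<exists>d>0. \<forall>y. x < y \<and> y < x + d \<longrightarrow> norm (integral {x..y} g - (y - x) *\<^sub>R g x) \<le> e * (y - x)))"
proof -
  obtain S where S: "negligible S" and der: "\<And>x e. \<lbrakk>x \<notin> S; 0 < e\<rbrakk> \<Longrightarrow>
     \<exists>d>0. \<forall>h. 0 < h \<and> h < d \<longrightarrow> norm (integral (cbox x (x + h *\<^sub>R One)) g /\<^sub>R h ^ DIM(real) - g x) < e"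
    using integrable_ccontinuous_explicit[of g] assms by (metis box_real(2))
  show ?thesis
  proof (intro exI[of _ S] conjI S allI impI; elim conjE)
    fix x e :: real assume "x \<notin> S" "0 < e"
    then obtain d where d: "d > 0" "\<And>h. 0 < h \<and> h < d \<Longrightarrow> norm (integral {x..x + h} g /\<^sub>R h - g x) < e"
      using der[of x e] by auto
    have "norm (integral {x..y} g - (y - x) *\<^sub>R g x) \<le> e * (y - x)" if "x < y" "y < x + d" for y
    proof -
      have "norm (integral {x..y} g /\<^sub>R (y - x) - g x) < e" using d(2)[of "y - x"] that by simp
      then have "(y - x) * norm (integral {x..y} g /\<^sub>R (y - x) - g x) \<le> (y - x) * e"
        using that by (intro mult_left_mono) auto
      also have "(y - x) * norm (integral {x..y} g /\<^sub>R (y - x) - g x)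
          = norm ((y - x) *\<^sub>R (integral {x..y} g /\<^sub>R (y - x) - g x))"
        using that by simp
      also have "(y - x) *\<^sub>R (integral {x..y} g /\<^sub>R (y - x) - g x) = integral {x..y} g - (y - x) *\<^sub>R g x"
        using that by (simp add: scaleR_diff_right)
      finally show ?thesis by (simp add: mult.commute)
    qed
    with d(1) show "\<exists>d>0. \<forall>y. x < y \<and> y < x + d \<longrightarrow> norm (integral {x..y} g - (y - x) *\<^sub>R g x) \<le> e * (y - x)"
      by blast
  qed
qed

lemma vector_derivative_vec:
  fixes f :: "real \<Rightarrow> complex ^ 'm"
  assumes "\<And>i. ((\<lambda>t. f t $ i) has_vector_derivative c $ i) (at t within S)"
  shows "(f has_vector_derivative c) (at t within S)"
  unfolding has_vector_derivative_def has_derivative_componentwise_within[of f]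
proof
  fix e :: "complex ^ 'm" assume "e \<in> Basis"
  then obtain i c' where e: "e = axis i c'" by (auto simp: Basis_vec_def)
  have "((\<lambda>t. f t $ i \<bullet> c') has_derivative (\<lambda>x. (x *\<^sub>R c $ i) \<bullet> c')) (at t within S)"
    using assms[of i] unfolding has_vector_derivative_def by (rule has_derivative_inner_left)
  then show "((\<lambda>t. f t \<bullet> e) has_derivative (\<lambda>x. (x *\<^sub>R c) \<bullet> e)) (at t within S)"
    by (simp add: e inner_axis)
qed

lemma of_real_smult: "complex_of_real c *s (v :: complex ^ 'k) = c *\<^sub>R v"
  by (simp add: vec_eq_iff scaleR_conv_of_real[where 'a = complex])

lemma norm_smult_le: "norm (c *s (v :: complex ^ 'd)) \<le> norm c * norm v"
  unfolding norm_vec_def vector_smult_component norm_mult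
  by (simp add: L2_set_right_distrib)

subsection \<open>Lebesgue spaces on an interval\<close>

locale interval_Lp =
  fixes a b :: real and p :: ennreal
  assumes ab: "a < b" and p_ge_1: "1 \<le> p"
begin

abbreviation "M \<equiv> lebesgue_on {a..b}"
abbreviation "Lp \<equiv> Lp_on a b p"
abbreviation "N \<equiv> Lp_norm a b p"

text \<open>A norm bound without a p-th root and without presupposed integrability: the nonnegative
  integral exists for every measurable f. Membership in L_p and the bound are thus established
  together, see \<open>Lp_le_iff\<close>.\<close>

definition Lp_le :: "real \<Rightarrow> (real \<Rightarrow> complex) \<Rightarrow> bool" where
  "Lp_le c f \<longleftrightarrow> f \<in> borel_measurable M \<and>
     (if p = \<infinity> then AE t in M. norm (f t) \<le> c
      else (\<integral>\<^sup>+t. ennreal (norm (f t) powr enn2real p) \<partial>M) \<le> ennreal (c powr enn2real p))"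

lemma emeasure_M: "emeasure M (space M) = ennreal (b - a)"
  using ab by (simp add: emeasure_restrict_space)

lemma exponent_ge_1: "p \<noteq> \<infinity> \<Longrightarrow> enn2real p \<ge> 1"
  using p_ge_1 by (metis enn2real_1 enn2real_mono infinity_ennreal_def less_top)

lemma Lp_le_infinity:
  "p = \<infinity> \<Longrightarrow> Lp_le c f \<longleftrightarrow> f \<in> borel_measurable M \<and> (AE t in M. norm (f t) \<le> c)"
  unfolding Lp_le_def by presburger

lemma Lp_le_iff:
  assumes "c \<ge> 0"
  shows "Lp_le c f \<longleftrightarrow> f \<in> Lp \<and> N f \<le> c"
proof (cases "f \<in> borel_measurable M")
  case meas: True
  show ?thesis
  proof (cases "p = \<infinity>")
    case True
    let ?e = "esssup M (\<lambda>t. ereal (norm (f t)))"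
    have m: "(\<lambda>t. ereal (norm (f t))) \<in> borel_measurable M"
      using meas by measurable
    have "esssup M (\<lambda>_. 0::ereal) \<le> ?e"
      by (rule esssup_AE_mono) auto
    \<comment> \<open>Positive total measure, that is a < b, keeps the essential supremum of a
      nonnegative function away from -\<infinity>.\<close>
    moreover have "esssup M (\<lambda>_. 0::ereal) = 0"
      using emeasure_M ab by (subst esssup_const) auto
    ultimately have "0 \<le> ?e" by simp
    then have "?e \<le> ereal c \<longleftrightarrow> ?e < \<infinity> \<and> real_of_ereal ?e \<le> c"
      by (cases ?e) auto
    moreover have "?e \<le> ereal c \<longleftrightarrow> (AE t in M. norm (f t) \<le> c)"
    proof
      assume "?e \<le> ereal c"
      with esssup_AE[of "\<lambda>t. ereal (norm (f t))" M] show "AE t in M. norm (f t) \<le> c"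
        by (auto elim!: eventually_mono dest: order_trans)
    next
      assume "AE t in M. norm (f t) \<le> c"
      then show "?e \<le> ereal c" by (intro esssup_I m) auto
    qed
    ultimately show ?thesis
      unfolding Lp_le_infinity[OF True] using meas by (simp add: True Lp_on_def Lp_norm_def)
  next
    case False
    define P where "P = enn2real p"
    have P: "P \<ge> 1" using exponent_ge_1[OF False] by (simp add: P_def)
    let ?I = "\<integral>\<^sup>+t. ennreal (norm (f t) powr P) \<partial>M"
    have int: "integrable M (\<lambda>t. norm (f t) powr P) \<longleftrightarrow> ?I < \<infinity>"
      using meas by (subst integrable_iff_bounded) auto
    have val: "integral\<^sup>L M (\<lambda>t. norm (f t) powr P) = enn2real ?I"
      using meas by (intro integral_eq_nn_integral) auto
    have pow: "x powr (1 / P) \<le> c \<longleftrightarrow> x \<le> c powr P" if "x \<ge> 0" for x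
    proof
      assume "x powr (1 / P) \<le> c"
      then have "(x powr (1 / P)) powr P \<le> c powr P"
        using P by (intro powr_mono2) auto
      then show "x \<le> c powr P" using P that by (simp add: powr_powr)
    next
      assume "x \<le> c powr P"
      then have "x powr (1 / P) \<le> (c powr P) powr (1 / P)"
        using P that by (intro powr_mono2) auto
      then show "x powr (1 / P) \<le> c" using P assms by (simp add: powr_powr)
    qed
    have "?I \<le> ennreal (c powr P) \<longleftrightarrow> ?I < \<infinity> \<and> enn2real ?I \<le> c powr P"
      by (cases ?I) (auto simp: top_unique)
    then show ?thesis
      using False meas int val pow[of "enn2real ?I"]
      unfolding Lp_le_def Lp_on_def Lp_norm_def P_def[symmetric] by auto
  qed
qed (auto simp: Lp_le_def Lp_on_def)

lemma Lp_measurable: "f \<in> Lp \<Longrightarrow> f \<in> borel_measurable M"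
  by (simp add: Lp_on_def)

lemma Lp_norm_nonneg [simp]: "N f \<ge> 0"
proof (cases "p = \<infinity>")
  case True
  have "esssup M (\<lambda>_. 0::ereal) \<le> esssup M (\<lambda>t. ereal (norm (f t)))"
    by (rule esssup_AE_mono) auto
  moreover have "esssup M (\<lambda>_. 0::ereal) = 0"
    using emeasure_M ab by (subst esssup_const) auto
  ultimately show ?thesis using True by (simp add: Lp_norm_def real_of_ereal_pos)
qed (simp add: Lp_norm_def)

lemma Lp_leI: "f \<in> Lp \<Longrightarrow> Lp_le (N f) f"
  by (simp add: Lp_le_iff)

lemma Lp_le_dominated:
  assumes "Lp_le c f" "g \<in> borel_measurable M" "AE t in M. norm (g t) \<le> norm (f t)"
  shows "Lp_le c g"
proof (cases "p = \<infinity>")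
  case True
  show ?thesis using assms unfolding Lp_le_infinity[OF True] by (auto elim!: eventually_elim2)
next
  case False
  have "(\<integral>\<^sup>+t. ennreal (norm (g t) powr enn2real p) \<partial>M)
      \<le> (\<integral>\<^sup>+t. ennreal (norm (f t) powr enn2real p) \<partial>M)"
    using assms(3) exponent_ge_1[OF False]
    by (intro nn_integral_mono_AE) (auto elim!: eventually_mono intro!: powr_mono2)
  then show ?thesis using assms False by (auto simp: Lp_le_def)
qed

lemma Lp_dominated:
  assumes "f \<in> Lp" "g \<in> borel_measurable M" "AE t in M. norm (g t) \<le> norm (f t)"
  shows "g \<in> Lp" "N g \<le> N f"
  using Lp_le_dominated[OF Lp_leI] assms by (auto simp: Lp_le_iff)

text \<open>Completeness of Lebesgue measure, transported to the restricted measure by extending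
  with zero.\<close>

lemma AE_cong_measurable:
  assumes "f \<in> borel_measurable M" "AE t in M. f t = (g t :: complex)"
  shows "g \<in> borel_measurable M"
proof -
  have "(\<lambda>t. if t \<in> {a..b} then f t else 0) \<in> borel_measurable lebesgue"
    using assms(1) borel_measurable_if[of "{a..b}" f] by simp
  moreover have "AE t in lebesgue. (if t \<in> {a..b} then f t else 0) = (if t \<in> {a..b} then g t else 0)"
    using assms(2) by (subst (asm) AE_restrict_space_iff) (auto elim!: eventually_mono)
  ultimately have "(\<lambda>t. if t \<in> {a..b} then g t else 0) \<in> borel_measurable lebesgue"
    by (rule borel_measurable_AE)
  then show ?thesis using borel_measurable_if[of "{a..b}" g] by simp
qed

lemma Lp_le_cmult:
  assumes "Lp_le c f" "c \<ge> 0"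
  shows "Lp_le (norm k * c) (\<lambda>t. k * f t)"
proof (cases "p = \<infinity>")
  case True
  show ?thesis using assms unfolding Lp_le_infinity[OF True]
    by (auto simp: norm_mult mult_left_mono elim!: eventually_mono)
next
  case False
  let ?P = "enn2real p"
  have [measurable]: "f \<in> borel_measurable M" using assms by (simp add: Lp_le_def)
  have "(\<integral>\<^sup>+t. ennreal (norm (k * f t) powr ?P) \<partial>M)
      = (\<integral>\<^sup>+t. ennreal (norm k powr ?P) * ennreal (norm (f t) powr ?P) \<partial>M)"
    by (intro nn_integral_cong) (simp add: norm_mult powr_mult ennreal_mult)
  also have "\<dots> = ennreal (norm k powr ?P) * (\<integral>\<^sup>+t. ennreal (norm (f t) powr ?P) \<partial>M)"
    by (intro nn_integral_cmult) auto
  also have "\<dots> \<le> ennreal (norm k powr ?P) * ennreal (c powr ?P)"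
    using assms False by (intro mult_left_mono) (auto simp: Lp_le_def)
  also have "\<dots> = ennreal ((norm k * c) powr ?P)"
    using assms by (simp add: powr_mult ennreal_mult)
  finally show ?thesis using False by (auto simp: Lp_le_def)
qed

lemma Lp_cmult:
  assumes "f \<in> Lp"
  shows "(\<lambda>t. k * f t) \<in> Lp" "N (\<lambda>t. k * f t) = norm k * N f"
proof -
  have le: "(\<lambda>t. k * g t) \<in> Lp \<and> N (\<lambda>t. k * g t) \<le> norm k * N g" if "g \<in> Lp" for g k
    using Lp_le_cmult[OF Lp_leI[OF that]] by (simp add: Lp_le_iff)
  then show *: "(\<lambda>t. k * f t) \<in> Lp" using assms by blast
  show "N (\<lambda>t. k * f t) = norm k * N f"
  proof (cases "k = 0")
    case True
    then show ?thesis using le[OF assms, of k] by (simp add: order_antisym)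
  next
    case False
    have "norm k * N f \<le> N (\<lambda>t. k * f t)"
      using le[OF *, of "inverse k"] False by (simp add: norm_divide norm_inverse field_simps)
    then show ?thesis using le[OF assms, of k] by simp
  qed
qed

text \<open>Minkowski by normalisation: |f| + |g| is c + d times the convex combination of |f| / c
  and |g| / d with weights c / (c + d) and d / (c + d), and each normalised function has p-integral
  at most 1. Division asks for positive c and d; \<open>Lp_add\<close> enlarges both norms by e/2 to
  get there.\<close>

lemma Lp_le_add:
  assumes "Lp_le c f" "Lp_le d g" "c > 0" "d > 0"
  shows "Lp_le (c + d) (\<lambda>t. f t + g t)"
proof (cases "p = \<infinity>")
  case True
  have "AE t in M. norm (f t + g t) \<le> c + d"
    using conjunct2[OF iffD1[OF Lp_le_infinity[OF True] assms(1)]]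
      conjunct2[OF iffD1[OF Lp_le_infinity[OF True] assms(2)]]
    by eventually_elim (rule norm_triangle_mono)
  then show ?thesis using assms(1,2) unfolding Lp_le_infinity[OF True]
    by (auto intro!: borel_measurable_add)
next
  case False
  define P where "P = enn2real p"
  have P: "P \<ge> 1" using exponent_ge_1[OF False] by (simp add: P_def)
  have [measurable]: "f \<in> borel_measurable M" "g \<in> borel_measurable M"
    using assms by (auto simp: Lp_le_def)
  have f: "(\<integral>\<^sup>+t. ennreal (norm (f t) powr P) \<partial>M) \<le> ennreal (c powr P)"
    and g: "(\<integral>\<^sup>+t. ennreal (norm (g t) powr P) \<partial>M) \<le> ennreal (d powr P)"
    using assms False by (auto simp: Lp_le_def P_def)
  define u v where "u = (c + d) powr P * (c / (c + d)) / c powr P"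
    and "v = (c + d) powr P * (d / (c + d)) / d powr P"
  have uv: "u \<ge> 0" "v \<ge> 0" using assms by (auto simp: u_def v_def)
  have "norm (f t + g t) powr P \<le> u * norm (f t) powr P + v * norm (g t) powr P" for t
  proof -
    have [simp]: "c + d \<noteq> 0" "c \<noteq> 0" "d \<noteq> 0" using assms by auto
    have "norm (f t + g t) powr P \<le> (norm (f t) + norm (g t)) powr P"
      using P by (intro powr_mono2 norm_triangle_ineq) auto
    also have "norm (f t) + norm (g t)
        = (c + d) * (c / (c + d) * (norm (f t) / c) + d / (c + d) * (norm (g t) / d))"
      by (simp add: distrib_left)
    also have "\<dots> powr P = (c + d) powr P * (c / (c + d) * (norm (f t) / c) + d / (c + d) * (norm (g t) / d)) powr P"
      using assms by (intro powr_mult)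
    also have "\<dots> \<le> (c + d) powr P * (c / (c + d) * (norm (f t) / c) powr P + d / (c + d) * (norm (g t) / d) powr P)"
      using assms P by (intro mult_left_mono powr_convex_nonneg) (auto simp: add_divide_distrib[symmetric])
    also have "\<dots> = u * norm (f t) powr P + v * norm (g t) powr P"
      using assms by (simp add: u_def v_def powr_divide distrib_left)
    finally show ?thesis .
  qed
  then have "(\<integral>\<^sup>+t. ennreal (norm (f t + g t) powr P) \<partial>M)
      \<le> (\<integral>\<^sup>+t. ennreal u * ennreal (norm (f t) powr P) + ennreal v * ennreal (norm (g t) powr P) \<partial>M)"
    using uv by (intro nn_integral_mono) (simp add: ennreal_mult[symmetric] ennreal_plus[symmetric] del: ennreal_plus)
  also have "\<dots> = ennreal u * (\<integral>\<^sup>+t. ennreal (norm (f t) powr P) \<partial>M) + ennreal v * (\<integral>\<^sup>+t. ennreal (norm (g t) powr P) \<partial>M)"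
    by (subst nn_integral_add) (auto simp: nn_integral_cmult)
  also have "\<dots> \<le> ennreal u * ennreal (c powr P) + ennreal v * ennreal (d powr P)"
    by (intro add_mono mult_left_mono f g) auto
  also have "\<dots> = ennreal (u * c powr P + v * d powr P)"
    using uv by (simp add: ennreal_mult[symmetric] ennreal_plus[symmetric] del: ennreal_plus)
  also have "u * c powr P + v * d powr P = (c + d) powr P * (c / (c + d) + d / (c + d))"
    using assms by (simp add: u_def v_def distrib_left)
  also have "c / (c + d) + d / (c + d) = 1"
    using assms by (simp add: add_divide_distrib[symmetric])
  finally show ?thesis using False by (auto simp: Lp_le_def P_def)
qed

lemma Lp_add:
  assumes "f \<in> Lp" "g \<in> Lp"
  shows "(\<lambda>t. f t + g t) \<in> Lp" "N (\<lambda>t. f t + g t) \<le> N f + N g"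
proof -
  have *: "(\<lambda>t. f t + g t) \<in> Lp \<and> N (\<lambda>t. f t + g t) \<le> N f + N g + e" if "e > 0" for e
  proof -
    have "Lp_le (N f + e/2) f" "Lp_le (N g + e/2) g"
      using assms that by (auto simp: Lp_le_iff add_nonneg_nonneg)
    then have "Lp_le ((N f + e/2) + (N g + e/2)) (\<lambda>t. f t + g t)"
      using that by (intro Lp_le_add) (auto intro: add_nonneg_pos)
    moreover have "(N f + e/2) + (N g + e/2) = N f + N g + e" "0 \<le> N f + N g + e"
      using that by (auto simp: add_nonneg_nonneg)
    ultimately show ?thesis by (simp only: Lp_le_iff)
  qed
  show "(\<lambda>t. f t + g t) \<in> Lp" using *[of 1] by simp
  show "N (\<lambda>t. f t + g t) \<le> N f + N g"
    by (rule field_le_epsilon) (rule conjunct2[OF *])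
qed

lemma Lp_bounded:
  assumes "f \<in> borel_measurable M" "AE t in M. norm (f t) \<le> C"
  shows "f \<in> Lp" "C \<ge> 0 \<Longrightarrow> N f \<le> C * N (\<lambda>_. 1)"
proof -
  have one: "(\<lambda>_. 1) \<in> Lp"
  proof (cases "p = \<infinity>")
    case True
    then show ?thesis
      using emeasure_M ab by (auto simp: Lp_on_def esssup_const)
  next
    case False
    then show ?thesis using emeasure_M by (simp add: Lp_on_def)
  qed
  have le: "AE t in M. norm (f t) \<le> norm (of_real \<bar>C\<bar> * 1 :: complex)"
    using assms(2) by (auto elim!: eventually_mono)
  show "f \<in> Lp"
    using Lp_dominated(1)[OF Lp_cmult(1)[OF one] assms(1) le] .
  show "N f \<le> C * N (\<lambda>_. 1)" if "C \<ge> 0"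
    using Lp_dominated(2)[OF Lp_cmult(1)[OF one] assms(1) le] Lp_cmult(2)[OF one, of "of_real \<bar>C\<bar>"] that by simp
qed

text \<open>Fatou's lemma bounds a pointwise limit that is not yet known to lie in L_p.\<close>

lemma Lp_le_Fatou:
  assumes "\<And>k. Lp_le c (f k)" "AE t in M. (\<lambda>k. f k t) \<longlonglongrightarrow> g t" "g \<in> borel_measurable M"
  shows "Lp_le c g"
proof (cases "p = \<infinity>")
  case True
  have "AE t in M. \<forall>k. norm (f k t) \<le> c"
    using assms(1) unfolding Lp_le_infinity[OF True] by (simp add: AE_all_countable)
  with assms(2) have "AE t in M. norm (g t) \<le> c"
  proof eventually_elim
    case (elim t)
    then show ?case by (intro LIMSEQ_le_const2[OF tendsto_norm]) auto
  qed
  then show ?thesis using assms(3) unfolding Lp_le_infinity[OF True] by simp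
next
  case False
  define P where "P = enn2real p"
  have P: "P \<ge> 1" using exponent_ge_1[OF False] by (simp add: P_def)
  have [measurable]: "f k \<in> borel_measurable M" for k using assms by (simp add: Lp_le_def)
  have "(\<integral>\<^sup>+t. ennreal (norm (g t) powr P) \<partial>M) \<le> (\<integral>\<^sup>+t. liminf (\<lambda>k. ennreal (norm (f k t) powr P)) \<partial>M)"
    using assms(2)
  proof (intro nn_integral_mono_AE, eventually_elim)
    case (elim t)
    then have "(\<lambda>k. ennreal (norm (f k t) powr P)) \<longlonglongrightarrow> ennreal (norm (g t) powr P)"
      using P by (intro tendsto_intros) auto
    then show ?case using lim_imp_Liminf[of sequentially] by fastforce
  qed
  also have "\<dots> \<le> liminf (\<lambda>k. \<integral>\<^sup>+t. ennreal (norm (f k t) powr P) \<partial>M)"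
    by (intro nn_integral_liminf) auto
  also have "\<dots> \<le> ennreal (c powr P)"
    using assms(1) False by (intro Liminf_le) (auto simp: Lp_le_def P_def)
  finally show ?thesis using False assms(3) by (simp add: Lp_le_def P_def)
qed

text \<open>Instead of Hoelder's inequality, the pointwise bound x \<le> c + c (x / c)^p is
  integrated: the first term gives (b - a) c, the second at most c. The resulting constant b - a + 1
  also serves p = \<infinity>.\<close>

lemma Lp_integrable:
  assumes "f \<in> Lp"
  shows "integrable M f" "(LINT t|M. norm (f t)) \<le> (b - a + 1) * N f"
proof -
  have [measurable]: "f \<in> borel_measurable M" using assms by (rule Lp_measurable)
  have key: "(\<integral>\<^sup>+t. ennreal (norm (f t)) \<partial>M) \<le> ennreal ((b - a + 1) * c)" if "c > 0" "N f \<le> c" for c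
  proof -
    have le: "Lp_le c f" using that assms by (simp add: Lp_le_iff)
    show ?thesis
    proof (cases "p = \<infinity>")
      case True
      have "(\<integral>\<^sup>+t. ennreal (norm (f t)) \<partial>M) \<le> (\<integral>\<^sup>+t. ennreal c \<partial>M)"
        using le unfolding Lp_le_infinity[OF True] by (intro nn_integral_mono_AE) (auto elim!: eventually_mono intro: ennreal_leI)
      also have "\<dots> = ennreal (c * (b - a))"
        using emeasure_M that ab by (simp add: ennreal_mult)
      also have "\<dots> \<le> ennreal ((b - a + 1) * c)"
        using that ab by (intro ennreal_leI) (simp add: algebra_simps)
      finally show ?thesis .
    next
      case False
      define P where "P = enn2real p"
      have P: "P \<ge> 1" using exponent_ge_1[OF False] by (simp add: P_def)
      have "norm (f t) \<le> c + c / c powr P * norm (f t) powr P" for t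
      proof (cases "norm (f t) \<le> c")
        case True
        then show ?thesis using that by (intro order_trans[OF True]) simp
      next
        case False
        then have "norm (f t) / c \<ge> 1" using that by (simp add: field_simps)
        then have "(norm (f t) / c) powr 1 \<le> (norm (f t) / c) powr P"
          using P by (intro powr_mono) auto
        also have "\<dots> = norm (f t) powr P / c powr P"
          using that by (simp add: powr_divide)
        finally have "norm (f t) / c \<le> norm (f t) powr P / c powr P"
          using \<open>norm (f t) / c \<ge> 1\<close> that by simp
        then have "norm (f t) \<le> c * (norm (f t) powr P / c powr P)"
          using that by (simp add: field_simps)
        then show ?thesis using that by (simp add: )
      qed
      then have "(\<integral>\<^sup>+t. ennreal (norm (f t)) \<partial>M)
          \<le> (\<integral>\<^sup>+t. ennreal c + ennreal (c / c powr P) * ennreal (norm (f t) powr P) \<partial>M)"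
        using that by (intro nn_integral_mono)
          (simp add: ennreal_mult[symmetric] ennreal_plus[symmetric] ennreal_leI del: ennreal_plus)
      also have "\<dots> = ennreal c * ennreal (b - a) + ennreal (c / c powr P) * (\<integral>\<^sup>+t. ennreal (norm (f t) powr P) \<partial>M)"
        using emeasure_M by (subst nn_integral_add) (auto simp: nn_integral_cmult)
      also have "\<dots> \<le> ennreal c * ennreal (b - a) + ennreal (c / c powr P) * ennreal (c powr P)"
        using le False by (intro add_mono mult_left_mono) (auto simp: Lp_le_def P_def)
      also have "\<dots> = ennreal ((b - a + 1) * c)"
        using that ab by (simp add: ennreal_mult[symmetric] ennreal_plus[symmetric] algebra_simps del: ennreal_plus)
      finally show ?thesis .
    qed
  qed
  have "(\<integral>\<^sup>+t. ennreal (norm (f t)) \<partial>M) < \<infinity>"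
    by (rule le_less_trans[OF key[of "N f + 1"]]) (auto simp: add_nonneg_pos)
  then show int: "integrable M f"
    by (simp add: integrable_iff_bounded)
  have *: "(LINT t|M. norm (f t)) \<le> (b - a + 1) * c" if "c > 0" "N f \<le> c" for c
  proof -
    have "ennreal (LINT t|M. norm (f t)) \<le> ennreal ((b - a + 1) * c)"
      using key[OF that] int by (subst nn_integral_eq_integral[symmetric]) auto
    then show ?thesis using that ab by (subst (asm) ennreal_le_iff) auto
  qed
  show "(LINT t|M. norm (f t)) \<le> (b - a + 1) * N f"
  proof (rule field_le_epsilon)
    fix e :: real assume "e > 0"
    then have "e / (b - a + 1) > 0" using ab by simp
    then have "(LINT t|M. norm (f t)) \<le> (b - a + 1) * (N f + e / (b - a + 1))"
      by (intro *) (auto simp: add_nonneg_pos)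
    also have "\<dots> = (b - a + 1) * N f + e"
      using ab by (simp add: distrib_left)
    finally show "(LINT t|M. norm (f t)) \<le> (b - a + 1) * N f + e" .
  qed
qed

lemma Lp_sum:
  assumes "finite I" "\<And>i. i \<in> I \<Longrightarrow> f i \<in> Lp"
  shows "(\<lambda>t. \<Sum>i\<in>I. f i t) \<in> Lp \<and> N (\<lambda>t. \<Sum>i\<in>I. f i t) \<le> (\<Sum>i\<in>I. N (f i))"
  using assms
proof (induction I)
  case empty
  then show ?case using Lp_bounded[of "\<lambda>_. 0" 0] by simp
next
  case (insert i I)
  then show ?case using Lp_add[of "f i" "\<lambda>t. \<Sum>i\<in>I. f i t"] by simp
qed

text \<open>Riesz-Fischer for absolutely convergent series. Since L_p embeds in L_1, the series of
  norms is integrable, so the series converges pointwise almost everywhere; its sum is the limit.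
  \<open>Lp_le_Fatou\<close>, applied to the partial sums of each tail, makes the convergence one in
  norm.\<close>

lemma Lp_complete:
  assumes f: "\<And>k. f k \<in> Lp" and s: "summable (\<lambda>k. N (f k))"
  shows "\<exists>g\<in>Lp. (\<lambda>k. N (\<lambda>t. g t - (\<Sum>j<k. f j t))) \<longlonglongrightarrow> 0"
proof -
  have [measurable]: "f k \<in> borel_measurable M" for k using f by (rule Lp_measurable)
  have "summable (\<lambda>k. LINT t|M. norm (f k t))"
    using Lp_integrable(2)[OF f] by (intro summable_comparison_test'[OF summable_mult[OF s, of "b - a + 1"], of 0]) auto
  then have "(\<integral>\<^sup>+t. (\<Sum>k. ennreal (norm (f k t))) \<partial>M) = ennreal (\<Sum>k. LINT t|M. norm (f k t))"
    by (subst nn_integral_suminf)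
      (auto simp: nn_integral_eq_integral Lp_integrable(1)[OF f] suminf_ennreal2)
  then have "AE t in M. (\<Sum>k. ennreal (norm (f k t))) \<noteq> \<infinity>"
    by (intro nn_integral_PInf_AE) auto
  then have AE: "AE t in M. summable (\<lambda>k. f k t)"
  proof (rule eventually_mono)
    fix t assume "(\<Sum>k. ennreal (norm (f k t))) \<noteq> \<infinity>"
    then have "summable (\<lambda>k. norm (f k t))" by (intro summable_suminf_not_top) auto
    then show "summable (\<lambda>k. f k t)" by (rule summable_norm_cancel)
  qed
  note shift = summable_ignore_initial_segment[OF s]
  define g where "g t = (\<Sum>k. f k t)" for t
  have [measurable]: "g \<in> borel_measurable M" unfolding g_def by measurable
  have le: "Lp_le (\<Sum>k. N (f (k + m))) (\<lambda>t. g t - (\<Sum>j<m. f j t))" for m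
  proof (rule Lp_le_Fatou)
    fix k
    have "N (\<lambda>t. \<Sum>j<k. f (j + m) t) \<le> (\<Sum>j<k. N (f (j + m)))"
      using Lp_sum[of "{..<k}" "\<lambda>j. f (j + m)"] f by auto
    also have "\<dots> \<le> (\<Sum>k. N (f (k + m)))"
      using shift by (intro sum_le_suminf) auto
    finally show "Lp_le (\<Sum>k. N (f (k + m))) (\<lambda>t. \<Sum>j<k. f (j + m) t)"
      using Lp_sum[of "{..<k}" "\<lambda>j. f (j + m)"] f shift[of m]
      by (subst Lp_le_iff) (auto intro!: suminf_nonneg)
  next
    show "AE t in M. (\<lambda>k. \<Sum>j<k. f (j + m) t) \<longlonglongrightarrow> g t - (\<Sum>j<m. f j t)"
      using AE
    proof eventually_elim
      case (elim t)
      then show ?case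
        using sums_split_initial_segment[OF summable_sums, of "\<lambda>k. f k t" m]
        by (simp add: sums_def g_def)
    qed
  next
    show "(\<lambda>t. g t - (\<Sum>j<m. f j t)) \<in> borel_measurable M" by measurable
  qed
  have nn: "(\<Sum>k. N (f (k + m))) \<ge> 0" for m
    using shift by (intro suminf_nonneg) auto
  have g: "g \<in> Lp" using iffD1[OF Lp_le_iff[OF nn] le[of 0]] by simp
  have lim: "(\<lambda>m. \<Sum>k. N (f (k + m))) \<longlonglongrightarrow> 0"
    by (rule suminf_exist_split2[OF s])
  have "N (\<lambda>t. g t - (\<Sum>j<m. f j t)) \<le> (\<Sum>k. N (f (k + m)))" for m
    by (rule conjunct2[OF iffD1[OF Lp_le_iff[OF nn] le]])
  then have "\<forall>m. norm (N (\<lambda>t. g t - (\<Sum>j<m. f j t))) \<le> (\<Sum>k. N (f (k + m)))"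
    by simp
  from Lim_null_comparison[OF always_eventually[OF this] lim] g show ?thesis
    by (rule bexI)
qed

end

subsection \<open>Absolutely continuous functions\<close>

text \<open>On the null set \<open>S\<close> the gauge is an open cover of small measure, so that absolute continuity bounds the
  contribution of the tags in \<open>S\<close>; elsewhere it comes from differentiability, as for \<open>C\<^sup>1\<close> functions.\<close>

lemma absolutely_continuous_has_integral:
  assumes ab: "a \<le> b" and ac: "abs_continuous_on a b f" and S: "negligible S"
    and der: "\<And>x. x \<in> {a..b} - S \<Longrightarrow> (f has_vector_derivative g x) (at x within {a..b})"
  shows "(g has_integral (f b - f a)) {a..b}"
proof (cases "a = b")
  case True
  then show ?thesis using has_integral_refl(2)[of g b] by simp
next
  case False
  then have "a < b" using ab by simp
  \<comment> \<open>Values of g on the null set are arbitrary. Setting them to zero leaves only the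
    increments of f over intervals tagged in S to be bounded.\<close>
  define h where "h x = (if x \<in> S then 0 else g x)" for x
  have "(h has_integral (f b - f a)) {a..b}"
    unfolding has_integral_factor_content_real
  proof (intro allI impI)
    fix e :: real assume "e > 0"
    \<comment> \<open>Half of the error e (b - a) is reserved for tags in S; the tags outside S use
      e/2 per unit length.\<close>
    then have e2: "e * (b - a) / 2 > 0" using \<open>a < b\<close> by simp
    obtain \<delta> where "\<delta> > 0" and \<delta>: "\<And>D. \<lbrakk>finite D; \<forall>(u, v)\<in>D. a \<le> u \<and> u \<le> v \<and> v \<le> b;
        disjoint_family_on (\<lambda>(u, v). {u<..<v}) D; (\<Sum>(u, v)\<in>D. v - u) < \<delta>\<rbrakk>
        \<Longrightarrow> (\<Sum>(u, v)\<in>D. norm (f v - f u)) < e * (b - a) / 2"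
      using ac e2 unfolding abs_continuous_on_def by meson
    have "S \<in> sets lebesgue" using S negligible_imp_sets by blast
    then obtain T where T: "open T" "S \<subseteq> T" "T - S \<in> lmeasurable" "emeasure lebesgue (T - S) < ennreal \<delta>"
      using sets_lebesgue_outer_open \<open>\<delta> > 0\<close> by metis
    have Tm: "T \<in> lmeasurable" "measure lebesgue T < \<delta>"
    proof -
      have "T = (T - S) \<union> S" using T by auto
      moreover have "(T - S) \<union> S \<in> lmeasurable"
        using T(3) S negligible_imp_measurable by blast
      moreover have "measure lebesgue ((T - S) \<union> S) = measure lebesgue (T - S)"
        by (intro measure_Un_null_set) (use T(3) S negligible_iff_null_sets fmeasurableD in auto)
      moreover have "measure lebesgue (T - S) < \<delta>"
        using T(3,4) \<open>\<delta> > 0\<close> by (simp add: emeasure_eq_measure2 ennreal_less_iff)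
      ultimately show "T \<in> lmeasurable" "measure lebesgue T < \<delta>" by simp_all
    qed
    have "\<forall>x. \<exists>d>0. x \<in> {a..b} - S \<longrightarrow>
         (\<forall>y\<in>{a..b}. norm (y-x) < d \<longrightarrow> norm (f y - f x - (y-x) *\<^sub>R g x) \<le> e/2 * norm (y-x))"
    proof
      fix x
      show "\<exists>d>0. x \<in> {a..b} - S \<longrightarrow>
         (\<forall>y\<in>{a..b}. norm (y-x) < d \<longrightarrow> norm (f y - f x - (y-x) *\<^sub>R g x) \<le> e/2 * norm (y-x))"
      proof (cases "x \<in> {a..b} - S")
        case True
        then show ?thesis
          using der[OF True] \<open>e > 0\<close> unfolding has_vector_derivative_def has_derivative_within_alt
          by (meson half_gt_zero)
      qed (auto intro: exI[of _ 1])
    qed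
    then obtain d where d: "\<And>x. 0 < d x"
      "\<And>x y. \<lbrakk>x \<in> {a..b} - S; y \<in> {a..b}; norm (y-x) < d x\<rbrakk>
         \<Longrightarrow> norm (f y - f x - (y-x) *\<^sub>R g x) \<le> e/2 * norm (y-x)"
      by metis
    define \<gamma> where "\<gamma> x = (if x \<in> S then T else ball x (d x))" for x
    have gauge: "gauge \<gamma>" using T d(1) by (auto simp: gauge_def \<gamma>_def)
    have "norm ((\<Sum>(x,K)\<in>q. measure lborel K *\<^sub>R h x) - (f b - f a)) \<le> e * measure lborel {a..b}"
      if q: "q tagged_division_of {a..b}" and fine: "\<gamma> fine q" for q
    proof -
      have qf: "finite q" using q by blast
      have K: "\<exists>u v. K = {u..v} \<and> u \<le> v \<and> x \<in> {u..v} \<and> a \<le> u \<and> v \<le> b \<and> {u..v} \<subseteq> \<gamma> x" if "(x, K) \<in> q" for x K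
      proof -
        have "x \<in> K" "K \<subseteq> {a..b}" "\<exists>u v. K = cbox u v" "K \<subseteq> \<gamma> x"
          using tagged_division_ofD(2,3,4)[OF q that] fine that unfolding fine_def by auto
        then show ?thesis by (metis atLeastAtMost_iff atLeastatMost_subset_iff cbox_interval order_trans)
      qed
      have ba: "b - a = (\<Sum>(x,K)\<in>q. Sup K - Inf K)" "f b - f a = (\<Sum>(x,K)\<in>q. f(Sup K) - f(Inf K))"
        using additive_tagged_division_1[where f= "\<lambda>x. x"] additive_tagged_division_1[where f= f]
            \<open>a \<le> b\<close> q by auto
      \<comment> \<open>Nondegenerate intervals make \<open>c\<close> injective by disjointness
        alone: two pairs with the same end points would share a nonempty open interval. A degenerate
        interval contributes nothing to either sum.\<close>
      define q1 where "q1 = {(x, K) \<in> q. x \<in> S \<and> Inf K < Sup K}"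
      have q1: "q1 \<subseteq> q" "finite q1" using qf by (auto simp: q1_def intro: finite_subset)
      have K1: "a \<le> Inf L" "Inf L \<le> Sup L" "Sup L \<le> b" if xL: "(x, L) \<in> q1" for x L
      proof -
        obtain u v where "L = {u..v}" "u \<le> v" "a \<le> u" "v \<le> b" using K[of x L] q1 xL by blast
        then show "a \<le> Inf L" "Inf L \<le> Sup L" "Sup L \<le> b" by simp_all
      qed
      define c where "c = (\<lambda>(x::real, K::real set). (Inf K, Sup K))"
      have disj: "{Inf K<..<Sup K} \<inter> {Inf L<..<Sup L} = {}"
        if "(x, K) \<in> q1" "(y, L) \<in> q1" "(x, K) \<noteq> (y, L)" for x K y L
      proof -
        have "(x, K) \<in> q" "(y, L) \<in> q" using that q1 by auto
        moreover obtain u v u' v' where "K = {u..v}" "L = {u'..v'}" "u \<le> v" "u' \<le> v'"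
          using K calculation by meson
        moreover have "interior K \<inter> interior L = {}"
          using tagged_division_ofD(5)[OF q calculation(1,2)] that by auto
        ultimately show ?thesis by simp
      qed
      have inj: "inj_on c q1"
      proof (rule inj_onI, clarify)
        fix x K y L assume *: "(x, K) \<in> q1" "(y, L) \<in> q1" and eq: "c (x, K) = c (y, L)"
        show "x = y \<and> K = L"
        proof (rule ccontr)
          assume "\<not> (x = y \<and> K = L)"
          then have "{Inf K<..<Sup K} \<inter> {Inf L<..<Sup L} = {}" using disj[OF *] by auto
          moreover have "Inf K < Sup K" using * by (auto simp: q1_def)
          ultimately show False using eq by (auto simp: c_def)
        qed
      qed
      have "(\<Sum>(u, v)\<in>c ` q1. norm (f v - f u)) < e * (b - a) / 2"
      proof (rule \<delta>)
        show "finite (c ` q1)" using q1 by simp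
        show "\<forall>(u, v)\<in>c ` q1. a \<le> u \<and> u \<le> v \<and> v \<le> b"
        proof clarify
          fix u v x L assume "(x, L) \<in> q1" "(u, v) = c (x, L)"
          then show "a \<le> u \<and> u \<le> v \<and> v \<le> b" using K1[of x L] by (auto simp: c_def)
        qed
        show df: "disjoint_family_on (\<lambda>(u, v). {u<..<v}) (c ` q1)"
          unfolding disjoint_family_on_def
        proof (intro ballI impI)
          fix z z' assume "z \<in> c ` q1" "z' \<in> c ` q1" "z \<noteq> z'"
          then obtain w w' where w: "w \<in> q1" "z = c w" "w' \<in> q1" "z' = c w'" "w \<noteq> w'" by blast
          then show "(case z of (u, v) \<Rightarrow> {u<..<v}) \<inter> (case z' of (u, v) \<Rightarrow> {u<..<v}) = {}"
            using disj[of "fst w" "snd w" "fst w'" "snd w'"] by (simp add: c_def split_def)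
        qed
        have sub: "(case z of (u, v) \<Rightarrow> {u<..<v}) \<subseteq> T" if zq: "z \<in> c ` q1" for z
        proof -
          obtain w where w: "w \<in> q1" "z = c w" using zq by blast
          obtain x L where xL: "(x, L) \<in> q1" "z = c (x, L)" using w by (cases w) blast
          then have "x \<in> S" by (auto simp: q1_def)
          moreover obtain u v where "L = {u..v}" "u \<le> v" "{u..v} \<subseteq> \<gamma> x" using K[of x L] q1 xL by blast
          ultimately show ?thesis using xL by (auto simp: c_def \<gamma>_def)
        qed
        have "(\<Sum>(u, v)\<in>c ` q1. v - u) = (\<Sum>z\<in>c ` q1. measure lebesgue (case z of (u, v) \<Rightarrow> {u<..<v}))"
        proof (rule sum.cong[OF refl], clarify)
          fix u v x L assume "(x, L) \<in> q1" "(u, v) = c (x, L)"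
          then have "u \<le> v" using K1[of x L] by (auto simp: c_def)
          then show "v - u = measure lebesgue {u<..<v}" by simp
        qed
        also have "\<dots> = measure lebesgue (\<Union>z\<in>c ` q1. case z of (u, v) \<Rightarrow> {u<..<v})"
        proof (rule measure_finite_Union[symmetric, OF _ _ df])
          show "emeasure lebesgue (case z of (u, v) \<Rightarrow> {u<..<v}) \<noteq> \<infinity>" for z :: "real \<times> real"
            by (cases "fst z \<le> snd z") (auto simp: split_def)
        qed (use q1 in auto)
        also have "\<dots> \<le> measure lebesgue T"
        proof (rule measure_mono_fmeasurable[OF _ _ Tm(1)])
          show "(\<Union>z\<in>c ` q1. case z of (u, v) \<Rightarrow> {u<..<v}) \<subseteq> T" by (rule UN_least) (rule sub)
          show "(\<Union>z\<in>c ` q1. case z of (u, v) \<Rightarrow> {u<..<v}) \<in> sets lebesgue"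
            using q1 by (intro sets.finite_UN) (auto simp: split_def)
        qed
        finally show "(\<Sum>(u, v)\<in>c ` q1. v - u) < \<delta>" using Tm by simp
      qed
      then have small: "(\<Sum>(x, K)\<in>q1. norm (f (Sup K) - f (Inf K))) < e * (b - a) / 2"
        by (subst (asm) sum.reindex[OF inj]) (simp add: c_def split_def o_def)
      have bound: "norm (measure lborel K *\<^sub>R h x - (f (Sup K) - f (Inf K)))
          \<le> e/2 * (Sup K - Inf K) + (if (x, K) \<in> q1 then norm (f (Sup K) - f (Inf K)) else 0)"
        if xK: "(x, K) \<in> q" for x K
      proof -
        obtain u v where uv: "K = {u..v}" "u \<le> v" "x \<in> {u..v}" "a \<le> u" "v \<le> b" "{u..v} \<subseteq> \<gamma> x"
          using K[OF xK] by blast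
        consider "x \<in> S" "u = v" | "x \<in> S" "u < v" | "x \<notin> S" using uv by fastforce
        then show ?thesis
        proof cases
          case 1 then show ?thesis using uv by simp
        next
          case 2
          then have "(x, K) \<in> q1" using xK uv by (auto simp: q1_def)
          moreover have "h x = 0" using 2 by (simp add: h_def)
          ultimately show ?thesis using uv \<open>e > 0\<close> by (simp add: norm_minus_commute)
        next
          case 3
          then have x: "x \<in> {a..b} - S" using uv by auto
          have b: "norm (u - x) < d x" "norm (v - x) < d x"
            using uv 3 subsetD[OF uv(6), of u] subsetD[OF uv(6), of v] by (auto simp: \<gamma>_def dist_norm)
          have "norm ((v - u) *\<^sub>R g x - (f v - f u))
             = norm ((f u - f x - (u - x) *\<^sub>R g x) - (f v - f x - (v - x) *\<^sub>R g x))"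
            by (simp add: algebra_simps)
          also have "\<dots> \<le> norm (f u - f x - (u - x) *\<^sub>R g x) + norm (f v - f x - (v - x) *\<^sub>R g x)"
            by (rule norm_triangle_ineq4)
          also have "\<dots> \<le> e/2 * norm (u - x) + e/2 * norm (v - x)"
            using uv by (intro add_mono d(2)[OF x _ b(1)] d(2)[OF x _ b(2)]) auto
          also have "\<dots> = e/2 * (x - u) + e/2 * (v - x)" using uv by simp
          also have "\<dots> = e/2 * (v - u)" by (simp add: field_simps)
          finally have "norm ((v - u) *\<^sub>R g x - (f v - f u)) \<le> e/2 * (v - u)" .
          then show ?thesis using uv 3 by (simp add: h_def q1_def)
        qed
      qed
      have "norm ((\<Sum>(x,K)\<in>q. measure lborel K *\<^sub>R h x) - (f b - f a))
          = norm (\<Sum>(x,K)\<in>q. measure lborel K *\<^sub>R h x - (f (Sup K) - f (Inf K)))"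
        by (simp add: ba(2) sum_subtractf split_def)
      also have "\<dots> \<le> (\<Sum>(x,K)\<in>q. e/2 * (Sup K - Inf K) + (if (x, K) \<in> q1 then norm (f (Sup K) - f (Inf K)) else 0))"
        by (rule sum_norm_le) (use bound in auto)
      also have "\<dots> = e/2 * (b - a) + (\<Sum>z\<in>q. if z \<in> q1 then (case z of (x, K) \<Rightarrow> norm (f (Sup K) - f (Inf K))) else 0)"
        unfolding ba(1) sum.distrib sum_distrib_left split_def by simp
      also have "(\<Sum>z\<in>q. if z \<in> q1 then (case z of (x, K) \<Rightarrow> norm (f (Sup K) - f (Inf K))) else 0)
          = (\<Sum>z\<in>q1. case z of (x, K) \<Rightarrow> norm (f (Sup K) - f (Inf K)))"
        using qf q1 by (simp add: sum.inter_restrict[symmetric] Int_absorb1)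
      also have "e/2 * (b - a) + \<dots> \<le> e * measure lborel {a..b}"
        using small \<open>a < b\<close> by simp
      finally show ?thesis .
    qed
    with gauge show "\<exists>d. gauge d \<and> (\<forall>p. p tagged_division_of {a..b} \<and> d fine p \<longrightarrow>
        norm ((\<Sum>(x, k)\<in>p. measure lborel k *\<^sub>R h x) - (f b - f a)) \<le> e * measure lborel {a..b})"
      by (intro exI[of _ \<gamma>]) simp
  qed
  then show ?thesis
    by (rule has_integral_spike[OF S, rotated]) (simp add: h_def)
qed

section \<open>Indefinite integrals and their derivatives\<close>

context interval_Lp
begin

lemma integrable_M_on:
  fixes g :: "real \<Rightarrow> 'e::euclidean_space"
  assumes "integrable M g" "a \<le> u" "v \<le> b"
  shows "g integrable_on {u..v}"
  using integrable_on_subinterval[OF integrable_on_lebesgue_on[OF assms(1)], of u v] assms(2,3) by simp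

lemma LINT_eq_integral:
  fixes g :: "real \<Rightarrow> 'e::euclidean_space"
  assumes "integrable M g"
  shows "(LINT t|M. g t) = integral {a..b} g"
  using has_integral_integral_lebesgue_on[OF assms] by (simp add: integral_unique)

text \<open>The integral form of being absolutely continuous with derivative g. It constrains f only
  on [a, b] and tolerates a change of g on a null set, so it matches the representation of Sobolev
  functions.\<close>

definition prim :: "(real \<Rightarrow> complex) \<Rightarrow> (real \<Rightarrow> complex) \<Rightarrow> bool" where
  "prim f g \<longleftrightarrow> integrable M g \<and> (\<forall>t\<in>{a..b}. f t = f a + integral {a..t} g)"

lemma prim_integrable: "prim f g \<Longrightarrow> integrable M g"
  by (simp add: prim_def)

lemma prim_eq: "prim f g \<Longrightarrow> t \<in> {a..b} \<Longrightarrow> f t = f a + integral {a..t} g"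
  unfolding prim_def by blast

lemma prim_diff:
  assumes "prim f g" "a \<le> u" "u \<le> v" "v \<le> b"
  shows "f v - f u = integral {u..v} g"
proof -
  have "integral {a..v} g = integral {a..u} g + integral {u..v} g"
    using assms
    by (intro sym[OF Henstock_Kurzweil_Integration.integral_combine] integrable_M_on prim_integrable[OF assms(1)]) auto
  moreover have "f u = f a + integral {a..u} g" "f v = f a + integral {a..v} g"
    using assms by (intro prim_eq; simp)+
  ultimately show ?thesis by (simp only:) simp
qed

lemma prim_continuous:
  assumes "prim f g"
  shows "continuous_on {a..b} f"
proof -
  have "continuous_on {a..b} (\<lambda>t. f a + integral {a..t} g)"
    by (intro continuous_intros indefinite_integral_continuous_1 integrable_M_on prim_integrable[OF assms]) auto
  then show ?thesis
    by (rule continuous_on_eq) (rule prim_eq[OF assms, symmetric])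
qed

text \<open>Disjointness makes the indicators of the open intervals add up to at most 1.\<close>

lemma sum_integral_disjoint_le:
  fixes h :: "real \<Rightarrow> real"
  assumes h: "integrable M h" "\<And>t. h t \<ge> 0" and D: "finite D" "\<forall>(u, v)\<in>D. a \<le> u \<and> u \<le> v \<and> v \<le> b"
    "disjoint_family_on (\<lambda>(u, v). {u<..<v}) D"
  shows "(\<Sum>(u, v)\<in>D. integral {u..v} h) \<le> integral {a..b} h"
proof -
  have "((\<lambda>t. \<Sum>z\<in>D. if t \<in> {fst z<..<snd z} then h t else 0) has_integral (\<Sum>z\<in>D. integral {fst z..snd z} h)) {a..b}"
  proof (rule has_integral_sum[OF D(1)])
    fix z assume "z \<in> D"
    then have z: "a \<le> fst z" "snd z \<le> b" using D(2) by auto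
    have "(h has_integral (integral {fst z..snd z} h)) (cbox (fst z) (snd z))"
      using integrable_M_on[OF h(1) z] by (simp add: integrable_integral)
    from has_integral_restrict_open_subinterval[OF this, of a b]
    show "((\<lambda>t. if t \<in> {fst z<..<snd z} then h t else 0) has_integral integral {fst z..snd z} h) {a..b}"
      using z by (simp add: box_real)
  qed
  moreover have "(h has_integral (integral {a..b} h)) {a..b}"
    using integrable_M_on[OF h(1), of a b] by (simp add: integrable_integral)
  moreover have "(\<Sum>z\<in>D. if t \<in> {fst z<..<snd z} then h t else 0) \<le> h t" for t
  proof -
    have "(\<Sum>z\<in>D. if t \<in> {fst z<..<snd z} then h t else 0) = h t * (\<Sum>z\<in>D. indicator ((\<lambda>(u, v). {u<..<v}) z) t)"
      by (auto simp: sum_distrib_left split_def indicator_def intro!: sum.cong)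
    also have "\<dots> = h t * indicator (\<Union>((\<lambda>(u, v). {u<..<v}) ` D)) t"
      by (simp only: indicator_UN_disjoint[OF D(1,3)])
    also have "\<dots> \<le> h t" using h(2)[of t] by (simp add: indicator_def)
    finally show ?thesis .
  qed
  ultimately have "(\<Sum>z\<in>D. integral {fst z..snd z} h) \<le> integral {a..b} h"
    by (rule has_integral_le)
  then show ?thesis by (simp add: split_def)
qed

text \<open>Truncation: the part of |g| above the level k has small integral for large k by
  dominated convergence, and the rest contributes at most k times the total length of the
  intervals.\<close>

lemma prim_abs_continuous:
  assumes "prim f g"
  shows "abs_continuous_on a b f"
  unfolding abs_continuous_on_def
proof (intro allI impI)
  fix e :: real assume "e > 0"
  have g: "integrable M g" using assms by (rule prim_integrable)
  then have [measurable]: "g \<in> borel_measurable M" by (rule borel_measurable_integrable)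
  define h where "h k t = norm (g t) - min (norm (g t)) (real k)" for k t
  have lim: "(\<lambda>k. LINT t|M. h k t) \<longlonglongrightarrow> (LINT t|M. 0)"
  proof (rule integral_dominated_convergence[where w = "\<lambda>t. norm (g t)"])
    show "AE t in M. (\<lambda>k. h k t) \<longlonglongrightarrow> 0"
    proof (rule AE_I2)
      fix t
      have *: "h k t = 0" if "k \<ge> nat \<lceil>norm (g t)\<rceil>" for k
        using that unfolding h_def by linarith
      then show "(\<lambda>k. h k t) \<longlonglongrightarrow> 0"
        by (intro tendsto_eventually) (use * in \<open>auto simp: eventually_sequentially intro!: exI[of _ "nat \<lceil>norm (g t)\<rceil>"]\<close>)
    qed
  qed (use g in \<open>auto simp: h_def\<close>)
  have hi: "integrable M (h k)" for k
    by (rule Bochner_Integration.integrable_bound[OF g]) (auto simp: h_def[abs_def])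
  from lim have "\<forall>\<^sub>F k in sequentially. (LINT t|M. h k t) < e / 2"
    using \<open>e > 0\<close> by (intro order_tendstoD) auto
  then obtain k where k: "integral {a..b} (h k) < e / 2"
    unfolding LINT_eq_integral[OF hi] using eventually_happens' sequentially_bot by blast
  show "\<exists>d>0. \<forall>D. finite D \<and> (\<forall>(u, v)\<in>D. a \<le> u \<and> u \<le> v \<and> v \<le> b) \<and>
       disjoint_family_on (\<lambda>(u, v). {u<..<v}) D \<and> (\<Sum>(u, v)\<in>D. v - u) < d
       \<longrightarrow> (\<Sum>(u, v)\<in>D. norm (f v - f u)) < e"
  \<comment> \<open>The bounded part then contributes at most e/2; k + 1 instead of k keeps the
    denominator positive for k = 0.\<close>
  proof (intro exI[of _ "e / (2 * (real k + 1))"] conjI allI impI; (elim conjE)?)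
    show "0 < e / (2 * (real k + 1))" using \<open>e > 0\<close> by simp
    fix D assume D: "finite D" "\<forall>(u, v)\<in>D. a \<le> u \<and> u \<le> v \<and> v \<le> b"
      "disjoint_family_on (\<lambda>(u, v). {u<..<v}) D" "(\<Sum>(u, v)\<in>D. v - u) < e / (2 * (real k + 1))"
    have "norm (f v - f u) \<le> integral {u..v} (h k) + real k * (v - u)" if "(u, v) \<in> D" for u v
    proof -
      have uv: "a \<le> u" "u \<le> v" "v \<le> b" using D(2) that by auto
      have i: "(\<lambda>t. h k t + real k) integrable_on {u..v}"
        using uv by (intro integrable_add integrable_M_on[OF hi]) auto
      have "norm (f v - f u) = norm (integral {u..v} g)"
        using prim_diff[OF assms uv] by simp
      also have "\<dots> \<le> integral {u..v} (\<lambda>t. h k t + real k)"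
        using uv by (intro integral_norm_bound_integral integrable_M_on[OF g] i) (auto simp: h_def)
      also have "\<dots> = integral {u..v} (h k) + real k * (v - u)"
        using uv by (subst Henstock_Kurzweil_Integration.integral_add) (auto intro: integrable_M_on[OF hi])
      finally show ?thesis .
    qed
    then have "(\<Sum>(u, v)\<in>D. norm (f v - f u)) \<le> (\<Sum>(u, v)\<in>D. integral {u..v} (h k) + real k * (v - u))"
      by (intro sum_mono) auto
    also have "\<dots> = (\<Sum>(u, v)\<in>D. integral {u..v} (h k)) + real k * (\<Sum>(u, v)\<in>D. v - u)"
      by (simp add: sum.distrib sum_distrib_left split_def)
    also have "\<dots> \<le> integral {a..b} (h k) + real k * (e / (2 * (real k + 1)))"
      using D by (intro add_mono sum_integral_disjoint_le hi mult_left_mono) (auto simp: h_def)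
    also have "real k * (e / (2 * (real k + 1))) \<le> e / 2"
      using \<open>e > 0\<close> by (simp add: field_simps)
    finally show "(\<Sum>(u, v)\<in>D. norm (f v - f u)) < e" using k by simp
  qed
qed

text \<open>Bridge between almost-everywhere statements and the negligible exceptional sets of the
  gauge integral.\<close>

lemma AE_M_negligible:
  "(AE t in M. P t) \<longleftrightarrow> (\<exists>S. negligible S \<and> (\<forall>t\<in>{a..b} - S. P t))"
proof -
  have "(AE t in M. P t) \<longleftrightarrow> (AE t in lebesgue. t \<in> {a..b} \<longrightarrow> P t)"
    by (rule AE_restrict_space_iff) simp
  also have "\<dots> \<longleftrightarrow> (\<exists>S. negligible S \<and> {t. \<not> (t \<in> {a..b} \<longrightarrow> P t)} \<subseteq> S)"
    by (rule eventually_ae_filter_negligible)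
  also have "\<dots> \<longleftrightarrow> (\<exists>S. negligible S \<and> (\<forall>t\<in>{a..b} - S. P t))"
    by (intro arg_cong[where f = Ex] ext conj_cong refl) blast
  finally show ?thesis .
qed

text \<open>Right increments come from \<open>integral_right_derivative_AE\<close> for g, left
  increments from the same fact for the reflected function t \<mapsto> G (- t). Extension by zero
  makes G integrable on every interval, as that fact demands, and the reflected exceptional set
  stays negligible.\<close>

lemma prim_has_derivative_AE:
  assumes "prim f g"
  shows "AE t in M. (f has_vector_derivative g t) (at t within {a..b})"
proof -
  define G where "G t = (if t \<in> {a..b} then g t else 0)" for t
  have g: "g integrable_on {a..b}" using integrable_M_on[OF prim_integrable[OF assms]] by simp
  have G: "G integrable_on {u..v}" for u v
  proof -
    have "G integrable_on UNIV" using g integrable_restrict_UNIV[of "{a..b}" g] unfolding G_def by blast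
    then show ?thesis by (rule integrable_on_subinterval) auto
  qed
  have G': "(\<lambda>t. G (- t)) integrable_on {u..v}" for u v
    using G[of "- v" "- u"] Henstock_Kurzweil_Integration.integrable_reflect_real[of G "- u" "- v"]
    by (simp only: minus_minus)
  obtain S where S: "negligible S" and der: "\<And>x e. x \<notin> S \<and> 0 < e \<Longrightarrow>
    (\<exists>d>0. \<forall>y. x < y \<and> y < x + d \<longrightarrow> norm (integral {x..y} G - (y - x) *\<^sub>R G x) \<le> e * (y - x))"
    using integral_right_derivative_AE[OF G] by blast
  obtain S' where S': "negligible S'" and der': "\<And>x e. x \<notin> S' \<and> 0 < e \<Longrightarrow>
    (\<exists>d>0. \<forall>y. x < y \<and> y < x + d \<longrightarrow> norm (integral {x..y} (\<lambda>t. G (- t)) - (y - x) *\<^sub>R G (- x)) \<le> e * (y - x))"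
    using integral_right_derivative_AE[OF G'] by blast
  have "negligible (uminus ` S')"
    by (rule negligible_differentiable_image_negligible[OF _ S'])
      (auto intro!: derivative_intros simp: differentiable_on_def)
  with S have neg: "negligible (S \<union> uminus ` S')" by (rule negligible_Un)
  show ?thesis
    unfolding AE_M_negligible
  proof (intro exI[of _ "S \<union> uminus ` S'"] conjI neg ballI)
    fix x assume x: "x \<in> {a..b} - (S \<union> uminus ` S')"
    then have "x \<notin> S" "- x \<notin> S'" by force+
    show "(f has_vector_derivative g x) (at x within {a..b})"
      unfolding has_vector_derivative_def has_derivative_within_alt
    proof (intro conjI allI impI)
      show "bounded_linear (\<lambda>h. h *\<^sub>R g x)" by (rule bounded_linear_scaleR_left)
      fix e :: real assume "e > 0"
      obtain d where d: "d > 0" "\<And>y. x < y \<and> y < x + d \<Longrightarrow> norm (integral {x..y} G - (y - x) *\<^sub>R G x) \<le> e * (y - x)"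
        using der[of x e] \<open>x \<notin> S\<close> \<open>e > 0\<close> by blast
      obtain d' where d': "d' > 0" "\<And>y. - x < y \<and> y < - x + d' \<Longrightarrow>
          norm (integral {- x..y} (\<lambda>t. G (- t)) - (y + x) *\<^sub>R G x) \<le> e * (y + x)"
        using der'[of "- x" e] \<open>- x \<notin> S'\<close> \<open>e > 0\<close> by auto
      have Gg: "integral {u..v} G = integral {u..v} g" if "a \<le> u" "v \<le> b" for u v
        using that by (intro integral_cong) (auto simp: G_def)
      have gx: "G x = g x" using x by (simp add: G_def)
      show "\<exists>d>0. \<forall>y\<in>{a..b}. norm (y - x) < d \<longrightarrow> norm (f y - f x - (y - x) *\<^sub>R g x) \<le> e * norm (y - x)"
      proof (intro exI[of _ "min d d'"] conjI ballI impI)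
        show "0 < min d d'" using d d' by simp
        fix y assume y: "y \<in> {a..b}" "norm (y - x) < min d d'"
        consider "y = x" | "x < y" | "y < x" by linarith
        then show "norm (f y - f x - (y - x) *\<^sub>R g x) \<le> e * norm (y - x)"
        proof cases
          case 1 then show ?thesis by simp
        next
          case 2
          then have "f y - f x = integral {x..y} G"
            using x y prim_diff[OF assms, of x y] Gg[of x y] by simp
          then show ?thesis using d(2)[of y] 2 y gx by simp
        next
          case 3
          then have "f x - f y = integral {y..x} G"
            using x y prim_diff[OF assms, of y x] Gg[of y x] by simp
          also have "\<dots> = integral {- x..- y} (\<lambda>t. G (- t))"
            by (rule Henstock_Kurzweil_Integration.integral_reflect_real[symmetric])
          finally have *: "f x - f y = integral {- x..- y} (\<lambda>t. G (- t))" .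
          have "norm (f y - f x - (y - x) *\<^sub>R g x) = norm (f x - f y - (- y + x) *\<^sub>R g x)"
            by (subst norm_minus_cancel[symmetric]) (simp add: algebra_simps)
          also have "\<dots> \<le> e * (- y + x)"
            unfolding * using d'(2)[of "- y"] 3 y gx by simp
          finally show ?thesis using 3 by simp
        qed
      qed
    qed
  qed
qed

text \<open>Converse to \<open>prim_abs_continuous\<close> and
  \<open>prim_has_derivative_AE\<close>. Absolute continuity is inherited by [a, t], where the
  fundamental theorem for absolutely continuous functions applies.\<close>

lemma prim_if_derivative_AE:
  assumes ac: "abs_continuous_on a b f" and g: "integrable M g"
    and der: "AE t in M. (f has_vector_derivative g t) (at t within {a..b})"
  shows "prim f g"
  unfolding prim_def
proof (intro conjI g ballI)
  fix t assume t: "t \<in> {a..b}"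
  obtain S where S: "negligible S"
    and S': "\<And>x. x \<in> {a..b} - S \<Longrightarrow> (f has_vector_derivative g x) (at x within {a..b})"
    using der unfolding AE_M_negligible by blast
  have "abs_continuous_on a t f"
    unfolding abs_continuous_on_def
  proof (intro allI impI)
    fix e :: real assume "e > 0"
    then obtain d where d: "d > 0" "\<And>D. finite D \<and> (\<forall>(u, v)\<in>D. a \<le> u \<and> u \<le> v \<and> v \<le> b) \<and>
       disjoint_family_on (\<lambda>(u, v). {u<..<v}) D \<and> (\<Sum>(u, v)\<in>D. v - u) < d
       \<Longrightarrow> (\<Sum>(u, v)\<in>D. norm (f v - f u)) < e"
      using ac unfolding abs_continuous_on_def by meson
    show "\<exists>d>0. \<forall>D. finite D \<and> (\<forall>(u, v)\<in>D. a \<le> u \<and> u \<le> v \<and> v \<le> t) \<and>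
       disjoint_family_on (\<lambda>(u, v). {u<..<v}) D \<and> (\<Sum>(u, v)\<in>D. v - u) < d
       \<longrightarrow> (\<Sum>(u, v)\<in>D. norm (f v - f u)) < e"
    proof (intro exI[of _ d] conjI allI impI d)
      fix D assume D: "finite D \<and> (\<forall>(u, v)\<in>D. a \<le> u \<and> u \<le> v \<and> v \<le> t) \<and>
         disjoint_family_on (\<lambda>(u, v). {u<..<v}) D \<and> (\<Sum>(u, v)\<in>D. v - u) < d"
      show "finite D" "disjoint_family_on (\<lambda>(u, v). {u<..<v}) D" "(\<Sum>(u, v)\<in>D. v - u) < d"
        using D by simp_all
      show "\<forall>(u, v)\<in>D. a \<le> u \<and> u \<le> v \<and> v \<le> b" using D t by fastforce
    qed
  qed
  moreover have "(f has_vector_derivative g x) (at x within {a..t})" if "x \<in> {a..t} - S" for x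
    using has_vector_derivative_within_subset[OF S', of x "{a..t}"] that t by auto
  ultimately have "(g has_integral (f t - f a)) {a..t}"
    using t S by (intro absolutely_continuous_has_integral) auto
  then show "f t = f a + integral {a..t} g" by (simp add: integral_unique)
qed

abbreviation D :: "(real \<Rightarrow> complex) \<Rightarrow> real \<Rightarrow> complex" where
  "D f \<equiv> (\<lambda>t. vector_derivative f (at t within {a..b}))"

lemma D_eqI: "t \<in> {a..b} \<Longrightarrow> (f has_vector_derivative c) (at t within {a..b}) \<Longrightarrow> D f t = c"
  using vector_derivative_within_closed_interval[OF ab] by blast

text \<open>\<open>vector_derivative\<close> chooses among the candidates c; u and v have the same
  candidates, so the chosen values agree even where no derivative exists.\<close>

lemma D_cong:
  assumes "\<And>t. t \<in> {a..b} \<Longrightarrow> u t = v t" "t \<in> {a..b}"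
  shows "D u t = D v t"
proof -
  have "(u has_vector_derivative c) (at t within {a..b}) \<longleftrightarrow> (v has_vector_derivative c) (at t within {a..b})" for c
    using has_vector_derivative_transform[OF assms(2), of v u] has_vector_derivative_transform[OF assms(2), of u v] assms(1)
    by (metis (full_types))
  then show ?thesis by (simp add: vector_derivative_def)
qed

lemma prim_D_AE:
  assumes "prim f g"
  shows "AE t in M. D f t = g t"
  using prim_has_derivative_AE[OF assms] AE_space[of M]
  by eventually_elim (auto intro: D_eqI)

lemma prim_has_derivative:
  assumes "prim f g" "continuous_on {a..b} g" "t \<in> {a..b}"
  shows "(f has_vector_derivative g t) (at t within {a..b})"
proof -
  have "((\<lambda>t. f a + integral {a..t} g) has_vector_derivative 0 + g t) (at t within {a..b})"
    by (intro has_vector_derivative_add has_vector_derivative_const integral_has_vector_derivative assms)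
  from has_vector_derivative_transform[OF assms(3) prim_eq[OF assms(1)] this]
  show ?thesis by simp
qed

lemma integrable_M_continuous: "continuous_on {a..b} g \<Longrightarrow> integrable M (g :: real \<Rightarrow> complex)"
  using absolutely_integrable_continuous_real[of a b g]
  by (simp add: set_integrable_def integrable_restrict_space)

lemma prim_if_derivative:
  assumes "continuous_on {a..b} g"
    "\<And>t. t \<in> {a..b} \<Longrightarrow> (f has_vector_derivative g t) (at t within {a..b})"
  shows "prim f g"
  unfolding prim_def
proof (intro conjI ballI)
  show "integrable M g" using assms(1) by (rule integrable_M_continuous)
  fix t assume t: "t \<in> {a..b}"
  have "(g has_integral (f t - f a)) {a..t}"
    using t by (intro fundamental_theorem_of_calculus)
      (auto intro!: has_vector_derivative_within_subset[OF assms(2), of _ "{a..t}"])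
  then show "f t = f a + integral {a..t} g" by (simp add: integral_unique)
qed

text \<open>Integration by parts without Fubini: the product of bounded absolutely continuous
  functions is absolutely continuous, it satisfies the product rule almost everywhere, and
  \<open>prim_if_derivative_AE\<close> turns this back into an integral identity.\<close>

lemma prim_mult:
  assumes "prim f f'" "prim g g'"
  shows "prim (\<lambda>t. f t * g t) (\<lambda>t. f' t * g t + f t * g' t)"
proof (rule prim_if_derivative_AE)
  have cont: "continuous_on {a..b} f" "continuous_on {a..b} g"
    using assms by (auto intro: prim_continuous)
  obtain K where K: "K > 0" "\<And>t. t \<in> {a..b} \<Longrightarrow> norm (f t) \<le> K" "\<And>t. t \<in> {a..b} \<Longrightarrow> norm (g t) \<le> K"
  proof -
    have "bounded (f ` {a..b} \<union> g ` {a..b})"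
      using cont by (auto intro!: compact_imp_bounded compact_continuous_image)
    then obtain K where "\<forall>x\<in>f ` {a..b} \<union> g ` {a..b}. norm x \<le> K" by (auto simp: bounded_iff)
    then show ?thesis by (intro that[of "\<bar>K\<bar> + 1"]) force+
  qed
  have cm: "h \<in> borel_measurable M" if "continuous_on {a..b} h" for h :: "real \<Rightarrow> complex"
    using integrable_M_continuous[OF that] by simp
  have prod: "integrable M (\<lambda>t. u t * v t)"
    if "integrable M u" "continuous_on {a..b} v" "\<And>t. t \<in> {a..b} \<Longrightarrow> norm (v t) \<le> K" for u v :: "real \<Rightarrow> complex"
  proof (rule Bochner_Integration.integrable_bound[where f = "\<lambda>t. of_real K * u t"])
    show "integrable M (\<lambda>t. of_real K * u t)" using that by simp
    show "(\<lambda>t. u t * v t) \<in> borel_measurable M"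
      using that cm by (intro borel_measurable_times) auto
    show "AE t in M. norm (u t * v t) \<le> norm (of_real K * u t)"
    proof (rule AE_I2)
      fix t assume "t \<in> space M"
      then have "norm (u t) * norm (v t) \<le> norm (u t) * K"
        using that(3) by (intro mult_left_mono) auto
      then show "norm (u t * v t) \<le> norm (of_real K * u t)"
        using K(1) by (simp add: norm_mult mult.commute)
    qed
  qed
  show "integrable M (\<lambda>t. f' t * g t + f t * g' t)"
    using Bochner_Integration.integrable_add[OF prod[OF prim_integrable[OF assms(1)] cont(2) K(3)]
        prod[OF prim_integrable[OF assms(2)] cont(1) K(2)]]
    by (simp add: mult.commute)
  show "AE t in M. ((\<lambda>t. f t * g t) has_vector_derivative f' t * g t + f t * g' t) (at t within {a..b})"
    using prim_has_derivative_AE[OF assms(1)] prim_has_derivative_AE[OF assms(2)]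
    by eventually_elim (use has_vector_derivative_mult in \<open>force simp: add.commute\<close>)
  show "abs_continuous_on a b (\<lambda>t. f t * g t)"
    unfolding abs_continuous_on_def
  proof (intro allI impI)
    fix e :: real assume "e > 0"
    then have e: "e / (2 * K) > 0" using K by simp
    obtain d1 where d1: "d1 > 0" "\<And>D. finite D \<and> (\<forall>(u, v)\<in>D. a \<le> u \<and> u \<le> v \<and> v \<le> b) \<and>
       disjoint_family_on (\<lambda>(u, v). {u<..<v}) D \<and> (\<Sum>(u, v)\<in>D. v - u) < d1
       \<Longrightarrow> (\<Sum>(u, v)\<in>D. norm (f v - f u)) < e / (2 * K)"
      using prim_abs_continuous[OF assms(1)] e unfolding abs_continuous_on_def by meson
    obtain d2 where d2: "d2 > 0" "\<And>D. finite D \<and> (\<forall>(u, v)\<in>D. a \<le> u \<and> u \<le> v \<and> v \<le> b) \<and>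
       disjoint_family_on (\<lambda>(u, v). {u<..<v}) D \<and> (\<Sum>(u, v)\<in>D. v - u) < d2
       \<Longrightarrow> (\<Sum>(u, v)\<in>D. norm (g v - g u)) < e / (2 * K)"
      using prim_abs_continuous[OF assms(2)] e unfolding abs_continuous_on_def by meson
    show "\<exists>d>0. \<forall>D. finite D \<and> (\<forall>(u, v)\<in>D. a \<le> u \<and> u \<le> v \<and> v \<le> b) \<and>
       disjoint_family_on (\<lambda>(u, v). {u<..<v}) D \<and> (\<Sum>(u, v)\<in>D. v - u) < d
       \<longrightarrow> (\<Sum>(u, v)\<in>D. norm (f v * g v - f u * g u)) < e"
    proof (intro exI[of _ "min d1 d2"] conjI allI impI)
      show "0 < min d1 d2" using d1 d2 by simp
      fix D assume D: "finite D \<and> (\<forall>(u, v)\<in>D. a \<le> u \<and> u \<le> v \<and> v \<le> b) \<and>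
         disjoint_family_on (\<lambda>(u, v). {u<..<v}) D \<and> (\<Sum>(u, v)\<in>D. v - u) < min d1 d2"
      have "norm (f v * g v - f u * g u) \<le> K * norm (f v - f u) + K * norm (g v - g u)" if "(u, v) \<in> D" for u v
      proof -
        have uv: "u \<in> {a..b}" "v \<in> {a..b}" using D that by fastforce+
        have "f v * g v - f u * g u = g v * (f v - f u) + f u * (g v - g u)"
          by (simp add: algebra_simps)
        also have "norm \<dots> \<le> norm (g v) * norm (f v - f u) + norm (f u) * norm (g v - g u)"
          by (metis norm_mult norm_triangle_ineq)
        also have "\<dots> \<le> K * norm (f v - f u) + K * norm (g v - g u)"
          using K uv by (intro add_mono mult_right_mono) auto
        finally show ?thesis .
      qed
      then have "(\<Sum>(u, v)\<in>D. norm (f v * g v - f u * g u)) \<le> (\<Sum>(u, v)\<in>D. K * norm (f v - f u) + K * norm (g v - g u))"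
        by (intro sum_mono) auto
      also have "\<dots> = K * (\<Sum>(u, v)\<in>D. norm (f v - f u)) + K * (\<Sum>(u, v)\<in>D. norm (g v - g u))"
        by (simp add: sum.distrib sum_distrib_left split_def)
      also have "\<dots> < K * (e / (2 * K)) + K * (e / (2 * K))"
        using K D by (intro add_strict_mono mult_strict_left_mono d1 d2) auto
      also have "\<dots> = e" using K by (simp add: field_simps)
      finally show "(\<Sum>(u, v)\<in>D. norm (f v * g v - f u * g u)) < e" .
    qed
  qed
qed

lemma prim_add: "prim f f' \<Longrightarrow> prim g g' \<Longrightarrow> prim (\<lambda>t. f t + g t) (\<lambda>t. f' t + g' t)"
  unfolding prim_def
proof (elim conjE, intro conjI ballI)
  fix t assume *: "integrable M f'" "\<forall>t\<in>{a..b}. f t = f a + integral {a..t} f'"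
    "integrable M g'" "\<forall>t\<in>{a..b}. g t = g a + integral {a..t} g'" "t \<in> {a..b}"
  have "integral {a..t} (\<lambda>t. f' t + g' t) = integral {a..t} f' + integral {a..t} g'"
    using * by (intro Henstock_Kurzweil_Integration.integral_add integrable_M_on) auto
  moreover have "f t = f a + integral {a..t} f'" "g t = g a + integral {a..t} g'" using * by blast+
  ultimately show "f t + g t = f a + g a + integral {a..t} (\<lambda>t. f' t + g' t)"
    by (simp only: add_ac)
qed simp

lemma prim_cmult:
  assumes "prim f f'"
  shows "prim (\<lambda>t. c * f t) (\<lambda>t. c * f' t)"
  unfolding prim_def
proof (intro conjI ballI)
  show "integrable M (\<lambda>t. c * f' t)" using assms by (simp add: prim_def)
  fix t assume t: "t \<in> {a..b}"
  show "c * f t = c * f a + integral {a..t} (\<lambda>t. c * f' t)"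
    using prim_eq[OF assms t] by (simp only: distrib_left integral_mult_right)
qed

text \<open>Equality as elements of \<open>W\<^sub>p\<^sup>l\<close>: for \<open>l = 0\<close> the functions are only determined almost everywhere.\<close>

definition eqv :: "nat \<Rightarrow> (real \<Rightarrow> complex) \<Rightarrow> (real \<Rightarrow> complex) \<Rightarrow> bool" where
  "eqv l u v \<longleftrightarrow> (if l = 0 then AE t in M. u t = v t else \<forall>t\<in>{a..b}. u t = v t)"

lemma eqvI: "(\<And>t. t \<in> {a..b} \<Longrightarrow> u t = v t) \<Longrightarrow> eqv l u v"
  by (auto simp: eqv_def intro!: AE_I2)

lemma eqv_sym: "eqv l u v \<Longrightarrow> eqv l v u"
  by (auto simp: eqv_def elim!: eventually_mono split: if_splits)

lemma Lp_norm_cong: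
  assumes "\<And>t. t \<in> {a..b} \<Longrightarrow> u t = v t"
  shows "N u = N v"
proof -
  have "esssup M (\<lambda>t. ereal (norm (u t))) = esssup M (\<lambda>t. ereal (norm (v t)))"
  proof -
    \<comment> \<open>\<open>esssup\<close> has a default value for functions that are not
      measurable, so measurability of the two sides is compared as well.\<close>
    have "(\<lambda>t. ereal (norm (u t))) \<in> borel_measurable M \<longleftrightarrow> (\<lambda>t. ereal (norm (v t))) \<in> borel_measurable M"
      by (rule measurable_cong) (use assms in auto)
    moreover have "Limsup (ae_filter M) (\<lambda>t. ereal (norm (u t))) = Limsup (ae_filter M) (\<lambda>t. ereal (norm (v t)))"
      by (rule Limsup_eq, rule AE_I2) (use assms in auto)
    ultimately show ?thesis by (simp add: esssup_def)
  qed
  moreover have "(LINT t|M. norm (u t) powr enn2real p) = (LINT t|M. norm (v t) powr enn2real p)"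
    by (rule Bochner_Integration.integral_cong) (use assms in auto)
  ultimately show ?thesis by (simp add: Lp_norm_def)
qed

lemma Lp_cong_AE:
  assumes "u \<in> Lp" "AE t in M. u t = v t"
  shows "v \<in> Lp" "N v = N u"
proof -
  have m: "v \<in> borel_measurable M" using AE_cong_measurable[OF Lp_measurable] assms by blast
  have le: "AE t in M. norm (v t) \<le> norm (u t)" "AE t in M. norm (u t) \<le> norm (v t)"
    using assms(2) by (auto elim!: eventually_mono)
  show v: "v \<in> Lp" using Lp_dominated(1)[OF assms(1) m le(1)] .
  show "N v = N u"
    using Lp_dominated(2)[OF assms(1) m le(1)] Lp_dominated(2)[OF v Lp_measurable[OF assms(1)] le(2)] by simp
qed

subsection \<open>Sobolev spaces\<close>

abbreviation W :: "nat \<Rightarrow> (real \<Rightarrow> complex) set" where "W \<equiv> sobolev a b p"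
abbreviation sn :: "nat \<Rightarrow> (real \<Rightarrow> complex) \<Rightarrow> real" where "sn \<equiv> sobolev_norm a b p"

lemma nth_deriv_on_0 [simp]: "nth_deriv_on a b 0 f = f"
  by (simp add: nth_deriv_on_def)

lemma nth_deriv_on_Suc: "nth_deriv_on a b (Suc k) f = nth_deriv_on a b k (D f)"
  unfolding nth_deriv_on_def funpow_Suc_right by simp

lemma nth_deriv_on_cong:
  assumes "\<And>t. t \<in> {a..b} \<Longrightarrow> u t = v t" "t \<in> {a..b}"
  shows "nth_deriv_on a b k u t = nth_deriv_on a b k (v :: real \<Rightarrow> complex) t"
  using assms
proof (induction k arbitrary: u v t)
  case (Suc k)
  then show ?case unfolding nth_deriv_on_Suc by (intro Suc.IH D_cong)
qed simp

lemma W_0: "W 0 = Lp" and sn_0: "sn 0 = N"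
  by (auto simp: sobolev_def sobolev_norm_def fun_eq_iff)

lemma sn_Suc: "sn (Suc l) y = N y + sn l (D y)"
  unfolding sobolev_norm_def by (subst sum.atMost_Suc_shift) (simp add: nth_deriv_on_Suc)

lemma sn_nonneg [simp]: "sn l y \<ge> 0"
  by (simp add: sobolev_norm_def sum_nonneg)

lemma sobolev_cong:
  assumes "y \<in> W l" "eqv l y z"
  shows "z \<in> W l" "sn l z = sn l y"
proof -
  have "z \<in> W l \<and> sn l z = sn l y"
  proof (cases l)
    case 0
    then show ?thesis using assms Lp_cong_AE[of y z] by (simp add: W_0 sn_0 eqv_def)
  next
    case (Suc k)
    let ?d = "\<lambda>s y. nth_deriv_on a b s y"
    have eq: "y t = z t" if "t \<in> {a..b}" for t using assms(2) that Suc by (simp add: eqv_def)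
    have deq: "?d s y t = ?d s z t" if "t \<in> {a..b}" for s t
      using nth_deriv_on_cong[of y z t s] eq that by blast
    have d: "?d s y differentiable (at t within {a..b}) \<Longrightarrow> ?d s z differentiable (at t within {a..b})"
      if "t \<in> {a..b}" for s t
      using differentiable_transform_within[of "?d s y" t "{a..b}" 1 "?d s z"] deq that by auto
    have "sn l z = sn l y"
      unfolding sobolev_norm_def using deq by (intro sum.cong Lp_norm_cong) auto
    moreover have "\<forall>s<l - 1. ?d s z differentiable_on {a..b}"
      using assms(1) Suc d by (auto simp: sobolev_def differentiable_on_def)
    moreover have "\<forall>s\<le>l - 1. continuous_on {a..b} (?d s z)"
      using assms(1) Suc deq continuous_on_cong[OF refl, of "{a..b}" "?d _ z" "?d _ y"]
      by (auto simp: sobolev_def)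
    moreover have "abs_continuous_on a b (?d (l - 1) z)"
    proof -
      have "(\<Sum>(u, v)\<in>D. norm (?d (l - 1) z v - ?d (l - 1) z u)) = (\<Sum>(u, v)\<in>D. norm (?d (l - 1) y v - ?d (l - 1) y u))"
        if "\<forall>(u, v)\<in>D. a \<le> u \<and> u \<le> v \<and> v \<le> b" for D
        using that deq by (intro sum.cong) (force simp: split_def)+
      moreover have "abs_continuous_on a b (?d (l - 1) y)" using assms(1) Suc by (simp add: sobolev_def)
      ultimately show ?thesis unfolding abs_continuous_on_def by (metis (no_types, lifting))
    qed
    moreover have "AE t in M. ?d (l - 1) z differentiable (at t within {a..b})"
    proof -
      have "AE t in M. ?d (l - 1) y differentiable (at t within {a..b})"
        using assms(1) Suc by (simp add: sobolev_def)
      then show ?thesis using AE_space[of M] by eventually_elim (use d in auto)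
    qed
    moreover have "?d l z \<in> Lp"
      by (rule Lp_cong_AE(1)[of "?d l y"]) (use assms(1) Suc deq in \<open>auto simp: sobolev_def intro!: AE_I2\<close>)
    ultimately show ?thesis using Suc by (simp add: sobolev_def)
  qed
  then show "z \<in> W l" "sn l z = sn l y" by auto
qed

text \<open>Peels off one derivative. At order one y is differentiable only almost everywhere and
  the fundamental theorem for absolutely continuous functions is required; at higher orders D y is
  continuous and the classical one suffices.\<close>

lemma W_SucD:
  assumes "y \<in> W (Suc l)"
  shows "prim y (D y)" "D y \<in> W l"
proof -
  have "prim y (D y) \<and> D y \<in> W l"
  proof (cases l)
    case 0
    then have y: "continuous_on {a..b} y" "abs_continuous_on a b y"
      "AE t in M. y differentiable (at t within {a..b})" "D y \<in> Lp"
      using assms by (auto simp: sobolev_def nth_deriv_on_Suc)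
    have "AE t in M. (y has_vector_derivative D y t) (at t within {a..b})"
      using y(3) by eventually_elim (simp add: vector_derivative_works)
    then have "prim y (D y)"
      by (intro prim_if_derivative_AE y Lp_integrable)
    with y 0 show ?thesis by (simp add: W_0)
  next
    case (Suc k)
    have *: "\<forall>s<l. nth_deriv_on a b s y differentiable_on {a..b}"
      "\<forall>s\<le>l. continuous_on {a..b} (nth_deriv_on a b s y)"
      "abs_continuous_on a b (nth_deriv_on a b l y)"
      "AE t in M. nth_deriv_on a b l y differentiable (at t within {a..b})"
      "nth_deriv_on a b (Suc l) y \<in> Lp"
      using assms by (simp_all add: sobolev_def)
    have "nth_deriv_on a b s (D y) differentiable_on {a..b}" if "s < k" for s
      using *(1)[rule_format, of "Suc s"] that Suc by (simp add: nth_deriv_on_Suc)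
    moreover have "continuous_on {a..b} (nth_deriv_on a b s (D y))" if "s \<le> k" for s
      using *(2)[rule_format, of "Suc s"] that Suc by (simp add: nth_deriv_on_Suc)
    ultimately have Dy: "D y \<in> W l"
      using *(3-5) Suc by (simp add: sobolev_def nth_deriv_on_Suc)
    have "continuous_on {a..b} (D y)"
      using *(2)[rule_format, of 1] Suc by (simp add: nth_deriv_on_Suc)
    moreover have "y differentiable_on {a..b}" using *(1)[rule_format, of 0] Suc by simp
    ultimately have "prim y (D y)"
      by (intro prim_if_derivative) (auto simp: differentiable_on_def vector_derivative_works)
    with Dy show ?thesis by simp
  qed
  then show "prim y (D y)" "D y \<in> W l" by auto
qed

lemma W_Suc_continuous: "y \<in> W (Suc l) \<Longrightarrow> continuous_on {a..b} y"
  using W_SucD(1) prim_continuous by blast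

text \<open>Inverse of \<open>W_SucD\<close>: building a Sobolev function means exhibiting its
  derivative in integral form. The conclusion on D y is as strong as the regularity of g permits,
  everywhere for l > 0 and almost everywhere for l = 0.\<close>

lemma prim_W:
  assumes "prim y g" "g \<in> W l"
  shows "y \<in> W (Suc l)" "sn (Suc l) y = N y + sn l g" "eqv l (D y) g"
proof -
  show eq: "eqv l (D y) g"
  proof (cases l)
    case 0
    then show ?thesis using prim_D_AE[OF assms(1)] by (simp add: eqv_def)
  next
    case (Suc k)
    then have "continuous_on {a..b} g" using W_Suc_continuous assms(2) by blast
    then show ?thesis by (intro eqvI D_eqI prim_has_derivative[OF assms(1)])
  qed
  have Dy: "D y \<in> W l" "sn l (D y) = sn l g"
    using sobolev_cong[OF assms(2) eqv_sym[OF eq]] by auto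
  then show "sn (Suc l) y = N y + sn l g" by (simp add: sn_Suc)
  show "y \<in> W (Suc l)"
  proof (cases l)
    case 0
    have "AE t in M. y differentiable (at t within {a..b})"
      using prim_has_derivative_AE[OF assms(1)]
      by eventually_elim (auto simp: differentiable_def has_vector_derivative_def)
    then show ?thesis
      using Dy(1) 0 prim_continuous[OF assms(1)] prim_abs_continuous[OF assms(1)]
      by (simp add: sobolev_def nth_deriv_on_Suc)
  next
    case (Suc k)
    have *: "\<forall>s<k. nth_deriv_on a b s (D y) differentiable_on {a..b}"
      "\<forall>s\<le>k. continuous_on {a..b} (nth_deriv_on a b s (D y))"
      "abs_continuous_on a b (nth_deriv_on a b k (D y))"
      "AE t in M. nth_deriv_on a b k (D y) differentiable (at t within {a..b})"
      "nth_deriv_on a b (Suc k) (D y) \<in> Lp"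
      using Dy(1) Suc by (simp_all add: sobolev_def)
    have "continuous_on {a..b} g" using W_Suc_continuous assms(2) Suc by blast
    then have "y differentiable_on {a..b}"
      using prim_has_derivative[OF assms(1)]
      by (force simp: differentiable_on_def differentiable_def has_vector_derivative_def)
    then have "nth_deriv_on a b s y differentiable_on {a..b}" if "s < l" for s
      using that Suc *(1) by (cases s) (auto simp: nth_deriv_on_Suc)
    moreover have "continuous_on {a..b} (nth_deriv_on a b s y)" if "s \<le> l" for s
      using that Suc *(2) prim_continuous[OF assms(1)] by (cases s) (auto simp: nth_deriv_on_Suc)
    ultimately show ?thesis
      using *(3-5) Suc by (simp add: sobolev_def nth_deriv_on_Suc)
  qed
qed

lemma Lp_continuous: "continuous_on {a..b} f \<Longrightarrow> f \<in> Lp"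
proof -
  assume f: "continuous_on {a..b} f"
  then have "bounded (f ` {a..b})"
    by (intro compact_imp_bounded compact_continuous_image) auto
  then obtain K where "\<forall>t\<in>{a..b}. norm (f t) \<le> K" by (auto simp: bounded_iff)
  then show ?thesis
    by (intro Lp_bounded(1)[of f K] borel_measurable_integrable integrable_M_continuous f AE_I2) auto
qed

lemma W_imp_Lp: "u \<in> W l \<Longrightarrow> u \<in> Lp"
  by (cases l) (auto simp: W_0 intro: Lp_continuous W_Suc_continuous)

lemma N_le_sn: "N u \<le> sn l u"
  by (cases l) (simp_all add: sn_0 sn_Suc)

lemma W_add:
  assumes "u \<in> W l" "v \<in> W l"
  shows "(\<lambda>t. u t + v t) \<in> W l \<and> sn l (\<lambda>t. u t + v t) \<le> sn l u + sn l v"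
  using assms
proof (induction l arbitrary: u v)
  case 0
  then show ?case using Lp_add[of u v] by (simp add: W_0 sn_0)
next
  case (Suc l)
  note u = W_SucD[OF Suc.prems(1)] and v = W_SucD[OF Suc.prems(2)]
  have IH: "(\<lambda>t. D u t + D v t) \<in> W l" "sn l (\<lambda>t. D u t + D v t) \<le> sn l (D u) + sn l (D v)"
    using Suc.IH[OF u(2) v(2)] by auto
  note w = prim_W[OF prim_add[OF u(1) v(1)] IH(1)]
  have "N (\<lambda>t. u t + v t) \<le> N u + N v"
    using Suc.prems by (intro Lp_add(2) W_imp_Lp)
  with w IH(2) show ?case by (simp add: sn_Suc[of l u] sn_Suc[of l v])
qed

lemma W_cmult:
  assumes "u \<in> W l"
  shows "(\<lambda>t. c * u t) \<in> W l \<and> sn l (\<lambda>t. c * u t) = norm c * sn l u"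
  using assms
proof (induction l arbitrary: u)
  case 0
  then show ?case using Lp_cmult[of u c] by (simp add: W_0 sn_0)
next
  case (Suc l)
  note u = W_SucD[OF Suc.prems(1)]
  have IH: "(\<lambda>t. c * D u t) \<in> W l" "sn l (\<lambda>t. c * D u t) = norm c * sn l (D u)"
    using Suc.IH[OF u(2)] by auto
  note w = prim_W[OF prim_cmult[OF u(1)] IH(1)]
  have "N (\<lambda>t. c * u t) = norm c * N u"
    using Suc.prems by (intro Lp_cmult(2) W_imp_Lp)
  with w IH(2) show ?case by (simp add: sn_Suc[of l u] distrib_left)
qed

lemma W_zero: "(\<lambda>_. 0) \<in> W l" "sn l (\<lambda>_. 0) = 0"
proof -
  have "(\<lambda>_. 0) \<in> W l \<and> sn l (\<lambda>_. 0) = 0"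
  proof (induction l)
    case 0
    have "(\<lambda>_. 0) \<in> Lp" by (intro Lp_continuous) auto
    then show ?case using Lp_cmult[of "\<lambda>_. 0" 0] by (simp add: W_0 sn_0)
  next
    case (Suc l)
    have "prim (\<lambda>_. 0) (\<lambda>_. 0)" by (simp add: prim_def)
    from prim_W[OF this] Suc N_le_sn[of "\<lambda>_. 0" l] Lp_norm_nonneg[of "\<lambda>_. 0"] show ?case by simp
  qed
  then show "(\<lambda>_. 0) \<in> W l" "sn l (\<lambda>_. 0) = 0" by auto
qed

lemma W_diff:
  assumes "u \<in> W l" "v \<in> W l"
  shows "(\<lambda>t. u t - v t) \<in> W l" "sn l (\<lambda>t. u t - v t) \<le> sn l u + sn l v"
  using W_add[OF assms(1) W_cmult[OF assms(2), of "-1", THEN conjunct1]] W_cmult[OF assms(2), of "-1"]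
  by auto

lemma W_sum:
  assumes "finite I" "\<And>i. i \<in> I \<Longrightarrow> f i \<in> W l"
  shows "(\<lambda>t. \<Sum>i\<in>I. f i t) \<in> W l \<and> sn l (\<lambda>t. \<Sum>i\<in>I. f i t) \<le> (\<Sum>i\<in>I. sn l (f i))"
  using assms
proof (induction I)
  case empty
  then show ?case using W_zero by simp
next
  case (insert i I)
  then show ?case using W_add[of "f i" l "\<lambda>t. \<Sum>i\<in>I. f i t"] by fastforce
qed

lemma W_Suc_mono:
  assumes "u \<in> W (Suc l)"
  shows "u \<in> W l \<and> sn l u \<le> sn (Suc l) u"
  using assms
proof (induction l arbitrary: u)
  case 0
  then show ?case using W_imp_Lp[of u 1] by (simp add: W_0 sn_0 sn_Suc)
next
  case (Suc l)
  note u = W_SucD[OF Suc.prems]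
  from Suc.IH[OF u(2)] show ?case
    using prim_W[OF u(1), of l] by (simp add: sn_Suc[of "Suc l" u] sn_Suc[of l u])
qed

lemma W_mono:
  assumes "k \<le> l" "u \<in> W l"
  shows "u \<in> W k" "sn k u \<le> sn l u"
proof -
  have "u \<in> W k \<and> sn k u \<le> sn l u"
    using assms
    by (induction l rule: dec_induct) (use W_Suc_mono in \<open>force intro: order_trans\<close>)+
  then show "u \<in> W k" "sn k u \<le> sn l u" by auto
qed

section \<open>Integration, sup norm, products and completeness in Sobolev spaces\<close>

text \<open>\<open>KN\<close> converts sup bounds into L_p bounds, \<open>KI\<close> bounds
  integration from a as a map from W^l to W^(l+1), where the summand 1 accounts for the derivatives
  of the integral, and \<open>KS\<close> bounds the embedding of W^(l+1) into the continuous
  functions.\<close>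

definition KN :: real where "KN = N (\<lambda>_. 1)"
definition KI :: real where "KI = KN * (b - a + 1) + 1"
definition KS :: real where "KS = (b - a + 1) * (1 / (b - a) + 1)"

lemma KN_nonneg [simp]: "KN \<ge> 0" by (simp add: KN_def)
lemma KI_ge_1: "KI \<ge> 1" using ab by (simp add: KI_def)
lemma KS_nonneg: "KS \<ge> 0" using ab by (simp add: KS_def)

lemma norm_integral_le:
  fixes g :: "real \<Rightarrow> complex"
  assumes "integrable M g" "a \<le> u" "v \<le> b"
  shows "norm (integral {u..v} g) \<le> integral {u..v} (\<lambda>t. norm (g t))"
  using assms by (intro integral_norm_bound_integral integrable_M_on) auto

lemma integral_nonneg_mono:
  fixes h :: "real \<Rightarrow> real"
  assumes "integrable M h" "\<And>t. h t \<ge> 0" "a \<le> u" "u \<le> u'" "v' \<le> v" "v \<le> b"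
  shows "integral {u'..v'} h \<le> integral {u..v} h"
  using assms by (intro integral_subset_le integrable_M_on) auto

lemma prim_bound:
  assumes "prim e h" "h \<in> Lp" "t \<in> {a..b}" "s \<in> {a..b}"
  shows "norm (e t) \<le> norm (e s) + (b - a + 1) * N h"
proof -
  have *: "norm (e v - e u) \<le> (b - a + 1) * N h" if "a \<le> u" "u \<le> v" "v \<le> b" for u v
  proof -
    have h: "integrable M h" "integrable M (\<lambda>t. norm (h t))" using Lp_integrable[OF assms(2)] by auto
    have "norm (e v - e u) = norm (integral {u..v} h)" using prim_diff[OF assms(1) that] by simp
    also have "\<dots> \<le> integral {u..v} (\<lambda>t. norm (h t))" using that h by (intro norm_integral_le)
    also have "\<dots> \<le> integral {a..b} (\<lambda>t. norm (h t))" using that h by (intro integral_nonneg_mono) auto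
    also have "\<dots> \<le> (b - a + 1) * N h" using Lp_integrable(2)[OF assms(2)] LINT_eq_integral[OF h(2)] by simp
    finally show ?thesis .
  qed
  have "norm (e t - e s) \<le> (b - a + 1) * N h"
    using *[of s t] *[of t s] assms(3,4) by (cases "s \<le> t") (auto simp: norm_minus_commute)
  then show ?thesis using norm_triangle_sub[of "e t" "e s"] by simp
qed

lemma N_bounded:
  assumes "u \<in> Lp" "\<And>t. t \<in> {a..b} \<Longrightarrow> norm (u t) \<le> K" "K \<ge> 0"
  shows "N u \<le> K * KN"
  unfolding KN_def using assms by (intro Lp_bounded(2) Lp_measurable AE_I2) auto

lemma prim_Lp: "prim e h \<Longrightarrow> e \<in> Lp"
  by (intro Lp_continuous prim_continuous)

lemma prim_N_bound:
  assumes "prim e h" "h \<in> Lp"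
  shows "N e \<le> (norm (e a) + (b - a + 1) * N h) * KN"
  using ab assms(1) by (intro N_bounded prim_Lp[OF assms(1)] prim_bound[OF assms]) auto

text \<open>The bound |u t| \<le> |u s| + (b - a + 1) N (D u) is averaged over s, which replaces the
  unknown value at s by an L_1 norm.\<close>

lemma sup_bound:
  assumes "u \<in> W (Suc l)" "t \<in> {a..b}"
  shows "norm (u t) \<le> KS * sn (Suc l) u"
proof -
  note u = W_SucD[OF assms(1)]
  have uL: "u \<in> Lp" "D u \<in> Lp" using assms u W_imp_Lp by blast+
  let ?d = "(b - a + 1) * N (D u)"
  have i: "integrable M (\<lambda>s. norm (u s))" using Lp_integrable[OF uL(1)] by auto
  have "(b - a) * norm (u t) = integral {a..b} (\<lambda>_. norm (u t))" using ab by simp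
  also have "\<dots> \<le> integral {a..b} (\<lambda>s. norm (u s) + ?d)"
    using prim_bound[OF u(1) uL(2) assms(2)]
    by (intro Henstock_Kurzweil_Integration.integral_le integrable_add integrable_M_on[OF i]) auto
  also have "\<dots> = integral {a..b} (\<lambda>s. norm (u s)) + (b - a) * ?d"
    using ab by (subst Henstock_Kurzweil_Integration.integral_add) (auto intro: integrable_M_on[OF i])
  also have "\<dots> \<le> (b - a + 1) * N u + (b - a) * ?d"
    using Lp_integrable(2)[OF uL(1)] LINT_eq_integral[OF i] by simp
  also have "\<dots> = (b - a) * ((b - a + 1) * (N u / (b - a) + N (D u)))"
    using ab by (simp add: field_simps)
  finally have "norm (u t) \<le> (b - a + 1) * (N u / (b - a) + N (D u))"
    using ab by simp
  also have "\<dots> \<le> (b - a + 1) * ((1 / (b - a) + 1) * (N u + N (D u)))"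
    using ab by (intro mult_left_mono) (auto simp: distrib_left distrib_right)
  also have "\<dots> = KS * (N u + N (D u))" by (simp add: KS_def)
  also have "\<dots> \<le> KS * sn (Suc l) u"
    using KS_nonneg N_le_sn[of "D u" l] by (intro mult_left_mono) (auto simp: sn_Suc)
  finally show ?thesis .
qed

definition Intg :: "(real \<Rightarrow> complex) \<Rightarrow> real \<Rightarrow> complex" where
  "Intg g t = integral {a..t} g"

lemma Intg_a [simp]: "Intg g a = 0"
  by (simp add: Intg_def)

lemma prim_Intg: "integrable M g \<Longrightarrow> prim (Intg g) g"
  by (simp add: prim_def Intg_def)

lemma Intg_W:
  assumes "g \<in> W l"
  shows "Intg g \<in> W (Suc l)" "sn (Suc l) (Intg g) \<le> KI * sn l g"
proof -
  have gL: "g \<in> Lp" using assms by (rule W_imp_Lp)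
  have pr: "prim (Intg g) g" using Lp_integrable[OF gL] by (intro prim_Intg)
  show "Intg g \<in> W (Suc l)" using prim_W[OF pr assms] by simp
  have "N (Intg g) \<le> ((b - a + 1) * KN) * N g" using prim_N_bound[OF pr gL] by (simp add: mult_ac)
  also have "\<dots> \<le> ((b - a + 1) * KN) * sn l g"
    using ab by (intro mult_left_mono N_le_sn) auto
  finally show "sn (Suc l) (Intg g) \<le> KI * sn l g"
    using prim_W(2)[OF pr assms] by (simp add: KI_def algebra_simps)
qed

lemma N_mult_bounded:
  assumes "u \<in> Lp" "continuous_on {a..b} v" "\<And>t. t \<in> {a..b} \<Longrightarrow> norm (v t) \<le> K" "K \<ge> 0"
  shows "(\<lambda>t. u t * v t) \<in> Lp \<and> N (\<lambda>t. u t * v t) \<le> K * N u"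
proof -
  have m: "(\<lambda>t. u t * v t) \<in> borel_measurable M"
    by (rule borel_measurable_times[OF Lp_measurable[OF assms(1)] Lp_measurable[OF Lp_continuous[OF assms(2)]]])
  have "AE t in M. norm (u t * v t) \<le> norm (of_real K * u t)"
  proof (rule AE_I2)
    fix t assume "t \<in> space M"
    then have "norm (u t) * norm (v t) \<le> norm (u t) * K"
      using assms(3) by (intro mult_left_mono) auto
    then show "norm (u t * v t) \<le> norm (of_real K * u t)"
      using assms(4) by (simp add: norm_mult mult.commute)
  qed
  from Lp_dominated[OF Lp_cmult(1)[OF assms(1)] m this] Lp_cmult(2)[OF assms(1), of "of_real K"] assms(4)
  show ?thesis by simp
qed

text \<open>Leibniz rule: in both D u * v and u * D v the differentiated factor has order l and the
  other order l + 1, so the assumed product bound applies twice with the roles exchanged. This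
  yields the algebra property as well as the induction step of \<open>W_mult_ex\<close>.\<close>

lemma W_algebra_step:
  assumes C: "C \<ge> 0" and m: "\<And>u v. u \<in> W l \<Longrightarrow> v \<in> W (Suc l) \<Longrightarrow>
      (\<lambda>t. u t * v t) \<in> W l \<and> sn l (\<lambda>t. u t * v t) \<le> C * sn l u * sn (Suc l) v"
    and uv: "u \<in> W (Suc l)" "v \<in> W (Suc l)"
  shows "(\<lambda>t. u t * v t) \<in> W (Suc l) \<and>
    sn (Suc l) (\<lambda>t. u t * v t) \<le> (KS + 2 * C) * sn (Suc l) u * sn (Suc l) v"
proof -
  note u = W_SucD[OF uv(1)] and v = W_SucD[OF uv(2)]
  have Dle: "sn l (D u) \<le> sn (Suc l) u" "sn l (D v) \<le> sn (Suc l) v" by (simp_all add: sn_Suc)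
  have 1: "(\<lambda>t. D u t * v t) \<in> W l" "sn l (\<lambda>t. D u t * v t) \<le> C * sn (Suc l) u * sn (Suc l) v"
    using m[OF u(2) uv(2)] Dle C
    by (auto intro!: order_trans[OF _ mult_right_mono[OF mult_left_mono[OF Dle(1) C]]])
  have 2: "(\<lambda>t. u t * D v t) \<in> W l" "sn l (\<lambda>t. u t * D v t) \<le> C * sn (Suc l) v * sn (Suc l) u"
    using m[OF v(2) uv(1)] Dle C
    by (auto simp: mult.commute[of "u _"] intro!: order_trans[OF _ mult_right_mono[OF mult_left_mono[OF Dle(2) C]]])
  have 3: "(\<lambda>t. D u t * v t + u t * D v t) \<in> W l"
    "sn l (\<lambda>t. D u t * v t + u t * D v t) \<le> 2 * C * sn (Suc l) u * sn (Suc l) v"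
    using W_add[OF 1(1) 2(1)] 1(2) 2(2) by (auto simp: mult_ac)
  note w = prim_W[OF prim_mult[OF u(1) v(1)] 3(1)]
  have "N (\<lambda>t. u t * v t) \<le> (KS * sn (Suc l) v) * N u"
    using N_mult_bounded[OF W_imp_Lp[OF uv(1)] W_Suc_continuous[OF uv(2)] sup_bound[OF uv(2)]] KS_nonneg
    by simp
  also have "\<dots> \<le> (KS * sn (Suc l) v) * sn (Suc l) u"
    using KS_nonneg by (intro mult_left_mono N_le_sn) auto
  finally show ?thesis using w 3(2) by (simp add: algebra_simps)
qed

text \<open>L_p is not closed under products, hence the asymmetric pairing: one factor has a spare
  order and is bounded when l = 0. For l > 0 the space is an algebra by
  \<open>W_algebra_step\<close>, which already covers the claim.\<close>

lemma W_mult_ex: "\<exists>C\<ge>0. \<forall>u\<in>W l. \<forall>v\<in>W (Suc l).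
    (\<lambda>t. u t * v t) \<in> W l \<and> sn l (\<lambda>t. u t * v t) \<le> C * sn l u * sn (Suc l) v"
proof (induction l)
  case 0
  show ?case
  proof (intro exI[of _ KS] conjI KS_nonneg ballI)
    fix u v assume "u \<in> W 0" "v \<in> W (Suc 0)"
    then have *: "(\<lambda>t. u t * v t) \<in> Lp \<and> N (\<lambda>t. u t * v t) \<le> (KS * sn (Suc 0) v) * N u"
      using KS_nonneg
      by (intro N_mult_bounded sup_bound W_Suc_continuous) (auto simp: W_0)
    then show "(\<lambda>t. u t * v t) \<in> W 0" "sn 0 (\<lambda>t. u t * v t) \<le> KS * sn 0 u * sn (Suc 0) v"
      by (simp_all add: W_0 sn_0 mult_ac)
  qed
next
  case (Suc l)
  then obtain C where C: "C \<ge> 0" "\<And>u v. u \<in> W l \<Longrightarrow> v \<in> W (Suc l) \<Longrightarrow>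
    (\<lambda>t. u t * v t) \<in> W l \<and> sn l (\<lambda>t. u t * v t) \<le> C * sn l u * sn (Suc l) v" by blast
  show ?case
  proof (intro exI[of _ "KS + 2 * C"] conjI ballI)
    show "0 \<le> KS + 2 * C" using C KS_nonneg by simp
    fix u v assume uv: "u \<in> W (Suc l)" "v \<in> W (Suc (Suc l))"
    then have v: "v \<in> W (Suc l)" "sn (Suc l) v \<le> sn (Suc (Suc l)) v" using W_Suc_mono by blast+
    note * = W_algebra_step[OF C uv(1) v(1)]
    show "(\<lambda>t. u t * v t) \<in> W (Suc l)" using * by blast
    have "sn (Suc l) (\<lambda>t. u t * v t) \<le> (KS + 2 * C) * sn (Suc l) u * sn (Suc l) v" using * by blast
    also have "\<dots> \<le> (KS + 2 * C) * sn (Suc l) u * sn (Suc (Suc l)) v"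
      using C KS_nonneg v(2) by (intro mult_left_mono) auto
    finally show "sn (Suc l) (\<lambda>t. u t * v t) \<le> (KS + 2 * C) * sn (Suc l) u * sn (Suc (Suc l)) v" .
  qed
qed

definition KM :: "nat \<Rightarrow> real" where
  "KM l = (SOME C. C \<ge> 0 \<and> (\<forall>u\<in>W l. \<forall>v\<in>W (Suc l).
    (\<lambda>t. u t * v t) \<in> W l \<and> sn l (\<lambda>t. u t * v t) \<le> C * sn l u * sn (Suc l) v))"

lemma KM_nonneg: "KM l \<ge> 0"
  and W_mult: "u \<in> W l \<Longrightarrow> v \<in> W (Suc l) \<Longrightarrow> (\<lambda>t. u t * v t) \<in> W l"
  and sn_mult: "u \<in> W l \<Longrightarrow> v \<in> W (Suc l) \<Longrightarrow> sn l (\<lambda>t. u t * v t) \<le> KM l * sn l u * sn (Suc l) v"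
  using someI_ex[OF W_mult_ex[of l]] unfolding KM_def by blast+

lemma W_algebra:
  assumes "u \<in> W (Suc l)" "v \<in> W (Suc l)"
  shows "(\<lambda>t. u t * v t) \<in> W (Suc l)"
    "sn (Suc l) (\<lambda>t. u t * v t) \<le> (KS + 2 * KM l) * sn (Suc l) u * sn (Suc l) v"
proof -
  have "(\<lambda>t. u t * v t) \<in> W (Suc l) \<and>
    sn (Suc l) (\<lambda>t. u t * v t) \<le> (KS + 2 * KM l) * sn (Suc l) u * sn (Suc l) v"
    by (rule W_algebra_step[OF KM_nonneg _ assms]) (intro conjI W_mult sn_mult)
  then show "(\<lambda>t. u t * v t) \<in> W (Suc l)"
    "sn (Suc l) (\<lambda>t. u t * v t) \<le> (KS + 2 * KM l) * sn (Suc l) u * sn (Suc l) v" by auto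
qed

text \<open>The derivatives converge to some g in W^l by induction, the values at a converge by
  \<open>sup_bound\<close>, and the limit is the sum of the values at a plus the integral of
  g.\<close>

lemma W_complete:
  assumes "\<And>k. f k \<in> W l" "summable (\<lambda>k. sn l (f k))"
  shows "\<exists>g\<in>W l. (\<lambda>k. sn l (\<lambda>t. g t - (\<Sum>j<k. f j t))) \<longlonglongrightarrow> 0"
  using assms
proof (induction l arbitrary: f)
  case 0
  then show ?case using Lp_complete[of f] by (simp add: W_0 sn_0)
next
  case (Suc l)
  note f = W_SucD[OF Suc.prems(1)]
  have "summable (\<lambda>k. sn l (D (f k)))"
    by (rule summable_comparison_test'[OF Suc.prems(2), of 0]) (simp add: sn_Suc)
  then obtain g where g: "g \<in> W l" "(\<lambda>k. sn l (\<lambda>t. g t - (\<Sum>j<k. D (f j) t))) \<longlonglongrightarrow> 0"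
    using Suc.IH[of "\<lambda>k. D (f k)"] f by blast
  have "summable (\<lambda>k. f k a)"
  proof (rule summable_comparison_test'[OF summable_mult[OF Suc.prems(2), of KS], of 0])
    show "norm (f k a) \<le> KS * sn (Suc l) (f k)" for k
      using ab by (intro sup_bound Suc.prems(1)) simp
  qed
  then have "(\<lambda>k. (\<Sum>k. f k a) - (\<Sum>j<k. f j a)) \<longlonglongrightarrow> (\<Sum>k. f k a) - (\<Sum>k. f k a)"
    by (rule tendsto_diff[OF tendsto_const summable_LIMSEQ])
  then have lim: "(\<lambda>k. norm ((\<Sum>k. f k a) - (\<Sum>j<k. f j a))) \<longlonglongrightarrow> 0"
    by (intro tendsto_norm_zero) simp
  define y where "y t = (\<Sum>k. f k a) + Intg g t" for t
  have gL: "g \<in> Lp" using g W_imp_Lp by blast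
  have y: "prim y g"
    using Lp_integrable(1)[OF gL] unfolding prim_def y_def by (simp add: Intg_def)
  have S: "prim (\<lambda>t. \<Sum>j<k. f j t) (\<lambda>t. \<Sum>j<k. D (f j) t)" for k
    by (induction k) (auto simp: prim_def[of "\<lambda>_. 0"] intro: prim_add f)
  have e: "prim (\<lambda>t. y t - (\<Sum>j<k. f j t)) (\<lambda>t. g t - (\<Sum>j<k. D (f j) t))" for k
    using prim_add[OF y prim_cmult[OF S, of "-1"]] by simp
  have h: "(\<lambda>t. g t - (\<Sum>j<k. D (f j) t)) \<in> W l" for k
    using g f W_sum[of "{..<k}" "\<lambda>j. D (f j)" l] by (intro W_diff) auto
  let ?b = "\<lambda>k. (norm ((\<Sum>k. f k a) - (\<Sum>j<k. f j a)) + (b - a + 1) * sn l (\<lambda>t. g t - (\<Sum>j<k. D (f j) t))) * KN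
      + sn l (\<lambda>t. g t - (\<Sum>j<k. D (f j) t))"
  have "sn (Suc l) (\<lambda>t. y t - (\<Sum>j<k. f j t)) \<le> ?b k" for k
  proof -
    have "N (\<lambda>t. y t - (\<Sum>j<k. f j t)) \<le> (norm (y a - (\<Sum>j<k. f j a)) + (b - a + 1) * N (\<lambda>t. g t - (\<Sum>j<k. D (f j) t))) * KN"
      by (rule prim_N_bound[OF e W_imp_Lp[OF h]])
    also have "\<dots> \<le> (norm (y a - (\<Sum>j<k. f j a)) + (b - a + 1) * sn l (\<lambda>t. g t - (\<Sum>j<k. D (f j) t))) * KN"
      using ab by (intro mult_right_mono add_left_mono mult_left_mono N_le_sn) auto
    finally show ?thesis using prim_W(2)[OF e h] by (simp add: y_def)
  qed
  then have "\<forall>k. norm (sn (Suc l) (\<lambda>t. y t - (\<Sum>j<k. f j t))) \<le> ?b k" by simp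
  moreover have "?b \<longlonglongrightarrow> (0 + (b - a + 1) * 0) * KN + 0"
    by (intro tendsto_intros lim g)
  ultimately have "(\<lambda>k. sn (Suc l) (\<lambda>t. y t - (\<Sum>j<k. f j t))) \<longlonglongrightarrow> 0"
    using Lim_null_comparison[OF always_eventually, of "\<lambda>k. sn (Suc l) (\<lambda>t. y t - (\<Sum>j<k. f j t))" ?b] by simp
  then show ?case using prim_W(1)[OF y g(1)] by blast
qed

section \<open>Taylor monomials and almost everywhere equality\<close>

text \<open>Normalised so that each monomial is the primitive of its predecessor and its derivatives
  at a are unit data.\<close>

definition pw :: "nat \<Rightarrow> real \<Rightarrow> complex" where
  "pw j t = of_real ((t - a) ^ j / fact j)"

lemma pw_a: "pw j a = (if j = 0 then 1 else 0)"
  by (simp add: pw_def)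

lemma continuous_pw: "continuous_on S (pw j)"
  unfolding pw_def by (intro continuous_intros) auto

lemma prim_pw_Suc: "prim (pw (Suc j)) (pw j)"
proof (rule prim_if_derivative[OF continuous_pw])
  fix t
  have "((\<lambda>t. t - a) has_real_derivative 1) (at t within {a..b})"
    by (auto intro!: derivative_eq_intros)
  from DERIV_cdivide[OF DERIV_power[OF this, of "Suc j"], of "fact (Suc j)"]
  have "((\<lambda>t. (t - a) ^ Suc j / fact (Suc j)) has_real_derivative
      (1 + real j) * (t - a) ^ j / ((1 + real j) * fact j)) (at t within {a..b})"
    by (simp add: algebra_simps)
  then have "((\<lambda>t. (t - a) ^ Suc j / fact (Suc j)) has_real_derivative (t - a) ^ j / fact j) (at t within {a..b})"
    by simp
  from has_vector_derivative_of_real[OF this]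
  show "(pw (Suc j) has_vector_derivative pw j t) (at t within {a..b})"
    unfolding pw_def .
qed

lemma prim_pw_0: "prim (pw 0) (\<lambda>_. 0)"
  by (simp add: prim_def pw_def)

lemma pw_W: "pw j \<in> W l"
proof (induction l arbitrary: j)
  case 0
  then show ?case by (simp add: W_0 Lp_continuous continuous_pw)
next
  case (Suc l)
  then show ?case
    by (cases j) (auto intro: prim_W(1)[OF prim_pw_0] prim_W(1)[OF prim_pw_Suc] W_zero)
qed

text \<open>For l > 0 both functions are continuous, so the points of (a, b) where they differ form
  an open null set, which is empty. The end points follow by taking the closure.\<close>

lemma W_eqv_AE:
  assumes "u \<in> W l" "v \<in> W l" "AE t in M. u t = v t"
  shows "eqv l u v"
proof (cases l)
  case 0
  then show ?thesis using assms by (simp add: eqv_def)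
next
  case (Suc k)
  have "continuous_on {a..b} (\<lambda>t. u t - v t)"
    using assms Suc W_Suc_continuous by (intro continuous_intros) auto
  then have cl: "closed {t \<in> {a..b}. u t - v t = 0}"
    by (intro continuous_closed_preimage_constant) auto
  obtain S where S: "negligible S" "\<And>t. t \<in> {a..b} - S \<Longrightarrow> u t = v t"
    using assms(3) unfolding AE_M_negligible by blast
  have "open ({a<..<b} - {t \<in> {a..b}. u t - v t = 0})" using cl by (intro open_Diff) auto
  moreover have "negligible ({a<..<b} - {t \<in> {a..b}. u t - v t = 0})"
    by (rule negligible_subset[OF S(1)]) (use S(2) in force)
  ultimately have "{a<..<b} - {t \<in> {a..b}. u t - v t = 0} = {}"
    using open_not_negligible by blast
  then have "{a<..<b} \<subseteq> {t \<in> {a..b}. u t - v t = 0}" by blast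
  then have "closure {a<..<b} \<subseteq> {t \<in> {a..b}. u t - v t = 0}" using cl by (rule closure_minimal)
  then have "u t = v t" if "t \<in> {a..b}" for t using that ab by auto
  then show ?thesis by (rule eqvI)
qed

subsection \<open>Vector-valued functions\<close>

abbreviation Wv :: "nat \<Rightarrow> (real \<Rightarrow> complex ^ 'm) set" where "Wv \<equiv> sobolev_vec a b p"
abbreviation vn :: "nat \<Rightarrow> (real \<Rightarrow> complex ^ 'm) \<Rightarrow> real" where "vn \<equiv> sobolev_vec_norm a b p"
abbreviation Wm :: "nat \<Rightarrow> (real \<Rightarrow> complex ^ 'm ^ 'm) set" where "Wm \<equiv> sobolev_mat a b p"
abbreviation mn :: "nat \<Rightarrow> (real \<Rightarrow> complex ^ 'm ^ 'm) \<Rightarrow> real" where "mn \<equiv> sobolev_mat_norm a b p"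

lemma Wv_iff: "y \<in> Wv l \<longleftrightarrow> (\<forall>i. (\<lambda>t. y t $ i) \<in> W l)"
  by (simp add: sobolev_vec_def)

lemma Wm_iff: "X \<in> Wm l \<longleftrightarrow> (\<forall>i j. (\<lambda>t. X t $ i $ j) \<in> W l)"
  by (simp add: sobolev_mat_def)

lemma WvD: "y \<in> Wv l \<Longrightarrow> (\<lambda>t. y t $ i) \<in> W l"
  by (simp add: sobolev_vec_def)

lemma vn_eq: "vn l y = (\<Sum>i\<in>UNIV. sn l (\<lambda>t. y t $ i))"
  by (simp add: sobolev_vec_norm_def)

lemma vn_nonneg [simp]: "vn l y \<ge> 0"
  by (simp add: vn_eq sum_nonneg)

lemma mn_nonneg [simp]: "mn l X \<ge> 0"
  by (simp add: sobolev_mat_norm_def sum_nonneg)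

lemma sn_le_vn: "sn l (\<lambda>t. y t $ i) \<le> vn l y"
  unfolding vn_eq by (rule member_le_sum) auto

lemma Wv_add:
  assumes "y \<in> Wv l" "z \<in> Wv l"
  shows "(\<lambda>t. y t + z t) \<in> Wv l" "vn l (\<lambda>t. y t + z t) \<le> vn l y + vn l z"
proof -
  have *: "(\<lambda>t. y t $ i + z t $ i) \<in> W l \<and> sn l (\<lambda>t. y t $ i + z t $ i) \<le> sn l (\<lambda>t. y t $ i) + sn l (\<lambda>t. z t $ i)" for i
    using assms by (intro W_add WvD)
  then show "(\<lambda>t. y t + z t) \<in> Wv l" by (simp add: Wv_iff)
  show "vn l (\<lambda>t. y t + z t) \<le> vn l y + vn l z"
    unfolding vn_eq sum.distrib[symmetric] using * by (intro sum_mono) simp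
qed

lemma Wv_cmult:
  assumes "y \<in> Wv l"
  shows "(\<lambda>t. c *s y t) \<in> Wv l" "vn l (\<lambda>t. c *s y t) = norm c * vn l y"
proof -
  have *: "(\<lambda>t. c * y t $ i) \<in> W l \<and> sn l (\<lambda>t. c * y t $ i) = norm c * sn l (\<lambda>t. y t $ i)" for i
    using assms by (intro W_cmult WvD)
  then show "(\<lambda>t. c *s y t) \<in> Wv l" by (simp add: Wv_iff)
  show "vn l (\<lambda>t. c *s y t) = norm c * vn l y"
    unfolding vn_eq sum_distrib_left using * by (intro sum.cong) simp_all
qed

lemma Wv_minus:
  assumes "y \<in> Wv l"
  shows "(\<lambda>t. - y t) \<in> Wv l" "vn l (\<lambda>t. - y t) = vn l y"
  using Wv_cmult[OF assms, of "-1"] by simp_all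

lemma Wv_diff:
  assumes "y \<in> Wv l" "z \<in> Wv l"
  shows "(\<lambda>t. y t - z t) \<in> Wv l" "vn l (\<lambda>t. y t - z t) \<le> vn l y + vn l z"
  using Wv_add[OF assms(1) Wv_minus(1)[OF assms(2)]] Wv_minus(2)[OF assms(2)] by simp_all

lemma vn_triangle:
  assumes "y \<in> Wv l" "z \<in> Wv l"
  shows "vn l y \<le> vn l (\<lambda>t. y t - z t) + vn l z"
  using Wv_add(2)[OF Wv_diff(1)[OF assms] assms(2)] by simp

lemma Wv_zero: "(\<lambda>_. 0) \<in> Wv l" "vn l (\<lambda>_. 0) = 0"
  by (simp_all add: Wv_iff vn_eq W_zero)

lemma Wv_sum:
  assumes "finite I" "\<And>i. i \<in> I \<Longrightarrow> f i \<in> Wv l"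
  shows "(\<lambda>t. \<Sum>i\<in>I. f i t) \<in> Wv l \<and> vn l (\<lambda>t. \<Sum>i\<in>I. f i t) \<le> (\<Sum>i\<in>I. vn l (f i))"
  using assms
proof (induction I)
  case empty
  then show ?case by (simp add: Wv_zero)
next
  case (insert i I)
  then show ?case using Wv_add[of "f i" l "\<lambda>t. \<Sum>i\<in>I. f i t"] by fastforce
qed

lemma Wv_mono:
  assumes "k \<le> l" "y \<in> Wv l"
  shows "y \<in> Wv k" "vn k y \<le> vn l y"
  using W_mono[OF assms(1)] assms(2) by (auto simp: Wv_iff vn_eq intro!: sum_mono)

lemma Wv_cong:
  assumes "y \<in> Wv l" "\<And>i. eqv l (\<lambda>t. y t $ i) (\<lambda>t. z t $ i)"
  shows "z \<in> Wv l" "vn l z = vn l y"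
  using sobolev_cong[OF WvD[OF assms(1)] assms(2)] by (auto simp: Wv_iff vn_eq)

lemma AE_vec_iff: "(AE t in M. y t = (z t :: complex ^ 'm)) \<longleftrightarrow> (\<forall>i. AE t in M. y t $ i = z t $ i)"
proof -
  have "(AE t in M. y t = z t) \<longleftrightarrow> (AE t in M. \<forall>i\<in>UNIV. y t $ i = z t $ i)"
    by (simp add: vec_eq_iff)
  also have "\<dots> \<longleftrightarrow> (\<forall>i\<in>UNIV. AE t in M. y t $ i = z t $ i)"
    by (rule AE_ball_countable) auto
  finally show ?thesis by simp
qed

lemma Wv_Suc_AE_eq:
  assumes "y \<in> Wv (Suc l)" "z \<in> Wv (Suc l)" "AE t in M. y t = z t" "t \<in> {a..b}"
  shows "y t = z t"
proof -
  have "eqv (Suc l) (\<lambda>t. y t $ i) (\<lambda>t. z t $ i)" for i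
    by (rule W_eqv_AE[OF WvD[OF assms(1)] WvD[OF assms(2)]]) (use assms(3) AE_vec_iff[of y z] in blast)
  then show ?thesis using assms(4) by (simp add: eqv_def vec_eq_iff)
qed

lemma vn_AE_cong:
  assumes "y \<in> Wv l" "z \<in> Wv l" "AE t in M. y t = z t"
  shows "vn l z = vn l y"
proof -
  have "eqv l (\<lambda>t. y t $ i) (\<lambda>t. z t $ i)" for i
    by (rule W_eqv_AE[OF WvD[OF assms(1)] WvD[OF assms(2)]]) (use assms(3) AE_vec_iff[of y z] in blast)
  then show ?thesis by (rule Wv_cong(2)[OF assms(1)])
qed

lemma vn_eq_0_AE:
  assumes "y \<in> Wv l" "vn l y = 0"
  shows "AE t in M. y t = 0"
proof -
  have "AE t in M. y t $ i = 0" for i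
  proof -
    let ?u = "\<lambda>t. y t $ i"
    have u: "?u \<in> Lp" using assms(1) WvD W_imp_Lp by blast
    have "sn l ?u = 0" using sn_le_vn[of l y i] assms(2) sn_nonneg[of l ?u] by linarith
    then have "N ?u = 0" using N_le_sn[of ?u l] Lp_norm_nonneg[of ?u] by linarith
    then have "(LINT t|M. norm (?u t)) \<le> 0" using Lp_integrable(2)[OF u] by simp
    then have "(LINT t|M. norm (?u t)) = 0" by (intro antisym) auto
    then have "AE t in M. norm (?u t) = 0"
      using Lp_integrable(1)[OF u] by (subst (asm) integral_nonneg_eq_0_iff_AE) auto
    then show ?thesis by simp
  qed
  then show ?thesis using AE_vec_iff[of y "\<lambda>_. 0"] by simp
qed

lemma vn_AE_0: "y \<in> Wv l \<Longrightarrow> AE t in M. y t = 0 \<Longrightarrow> vn l y = 0"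
  using vn_AE_cong[of y l "\<lambda>_. 0"] Wv_zero by (simp add: Wv_zero)

lemma Wv_complete:
  fixes f :: "nat \<Rightarrow> real \<Rightarrow> complex ^ 'm"
  assumes "\<And>k. f k \<in> Wv l" "summable (\<lambda>k. vn l (f k))"
  shows "\<exists>g\<in>Wv l. (\<lambda>k. vn l (\<lambda>t. g t - (\<Sum>j<k. f j t))) \<longlonglongrightarrow> 0"
proof -
  have ex: "\<exists>g\<in>W l. (\<lambda>k. sn l (\<lambda>t. g t - (\<Sum>j<k. f j t $ i))) \<longlonglongrightarrow> 0" for i
  proof (rule W_complete[of "\<lambda>k t. f k t $ i"])
    show "(\<lambda>t. f k t $ i) \<in> W l" for k using assms(1) by (rule WvD)
    show "summable (\<lambda>k. sn l (\<lambda>t. f k t $ i))"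
      by (rule summable_comparison_test'[OF assms(2), of 0]) (simp add: sn_le_vn)
  qed
  define g where "g i = (SOME g. g \<in> W l \<and> (\<lambda>k. sn l (\<lambda>t. g t - (\<Sum>j<k. f j t $ i))) \<longlonglongrightarrow> 0)" for i
  have g: "g i \<in> W l" "(\<lambda>k. sn l (\<lambda>t. g i t - (\<Sum>j<k. f j t $ i))) \<longlonglongrightarrow> 0" for i
    using someI_ex[OF ex[of i, unfolded Bex_def]] unfolding g_def by blast+
  show ?thesis
  proof (intro bexI[of _ "\<lambda>t. \<chi> i. g i t"])
    show "(\<lambda>t. \<chi> i. g i t) \<in> Wv l" using g by (simp add: Wv_iff)
    have "(\<lambda>k. \<Sum>i\<in>UNIV. sn l (\<lambda>t. g i t - (\<Sum>j<k. f j t $ i))) \<longlonglongrightarrow> (\<Sum>i\<in>(UNIV::'m set). 0)"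
      by (rule tendsto_sum) (rule g)
    then show "(\<lambda>k. vn l (\<lambda>t. (\<chi> i. g i t) - (\<Sum>j<k. f j t))) \<longlonglongrightarrow> 0"
      by (simp add: vn_eq)
  qed
qed

section \<open>Componentwise derivatives and matrix coefficients\<close>

text \<open>May differ from the derivative of the vector function where some component is not
  differentiable, because the unspecified values are chosen separately; \<open>nth_deriv_vec\<close>
  says when the two agree.\<close>

abbreviation dv :: "nat \<Rightarrow> (real \<Rightarrow> complex ^ 'm) \<Rightarrow> real \<Rightarrow> complex ^ 'm" where
  "dv s y t \<equiv> (\<chi> i. nth_deriv_on a b s (\<lambda>t. y t $ i) t)"

lemma nth_deriv_on_Suc': "nth_deriv_on a b (Suc k) f = D (nth_deriv_on a b k f)"
  by (simp add: nth_deriv_on_def)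

lemma nth_deriv_W:
  assumes "u \<in> W (k + s)"
  shows "nth_deriv_on a b s u \<in> W k" "sn k (nth_deriv_on a b s u) \<le> sn (k + s) u"
proof -
  have "nth_deriv_on a b s u \<in> W k \<and> sn k (nth_deriv_on a b s u) \<le> sn (k + s) u"
    using assms
  proof (induction s arbitrary: u)
    case (Suc s)
    then have "D u \<in> W (k + s)" using W_SucD(2)[of u "k + s"] by simp
    from Suc.IH[OF this] show ?case
      by (simp add: nth_deriv_on_Suc sn_Suc) (use Lp_norm_nonneg[of u] in linarith)
  qed simp
  then show "nth_deriv_on a b s u \<in> W k" "sn k (nth_deriv_on a b s u) \<le> sn (k + s) u" by auto
qed

lemma dv_W:
  assumes "y \<in> Wv (k + s)"
  shows "dv s y \<in> Wv k" "vn k (dv s y) \<le> vn (k + s) y"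
  using nth_deriv_W[OF WvD[OF assms]] by (auto simp: Wv_iff vn_eq intro!: sum_mono)

lemma nth_deriv_prim:
  assumes "u \<in> W (Suc k + s)"
  shows "prim (nth_deriv_on a b s u) (nth_deriv_on a b (Suc s) u)"
  using W_SucD(1)[OF nth_deriv_W(1)[OF assms]] by (simp add: nth_deriv_on_Suc')

lemma vec_D_eq:
  fixes f :: "real \<Rightarrow> complex ^ 'm"
  assumes "t \<in> {a..b}" "\<And>i. ((\<lambda>t. f t $ i) has_vector_derivative c $ i) (at t within {a..b})"
    "\<And>t. t \<in> {a..b} \<Longrightarrow> g t = f t"
  shows "vector_derivative g (at t within {a..b}) = c"
  using assms(1) has_vector_derivative_transform[OF assms(1,3) vector_derivative_vec[OF assms(2)]]
  by (rule vector_derivative_within_closed_interval[OF ab])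

text \<open>The two claims are proved together: the almost-everywhere claim at order s + 1
  differentiates the pointwise identity at order s, which must hold on all of [a, b] to be
  differentiated.\<close>

lemma nth_deriv_vec:
  fixes y :: "real \<Rightarrow> complex ^ 'm"
  shows "y \<in> Wv (Suc s) \<Longrightarrow> t \<in> {a..b} \<Longrightarrow> nth_deriv_on a b s y t = dv s y t"
    and "y \<in> Wv s \<Longrightarrow> AE t in M. nth_deriv_on a b s y t = dv s y t"
proof -
  have "(y \<in> Wv (Suc s) \<longrightarrow> (\<forall>t\<in>{a..b}. nth_deriv_on a b s y t = dv s y t)) \<and>
      (y \<in> Wv s \<longrightarrow> (AE t in M. nth_deriv_on a b s y t = dv s y t))"
  proof (induction s)
    case 0
    then show ?case by (simp add: nth_deriv_on_def)
  next
    case (Suc s)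
    have step: "nth_deriv_on a b (Suc s) y t = dv (Suc s) y t"
      if y: "y \<in> Wv (Suc s)" and t: "t \<in> {a..b}"
        and d: "\<And>i. (nth_deriv_on a b s (\<lambda>t. y t $ i) has_vector_derivative nth_deriv_on a b (Suc s) (\<lambda>t. y t $ i) t) (at t within {a..b})"
      for t
    proof -
      have "vector_derivative (nth_deriv_on a b s y) (at t within {a..b}) = dv (Suc s) y t"
        by (rule vec_D_eq[OF t, of "dv s y"]) (use d Suc.IH y in auto)
      then show ?thesis by (simp add: nth_deriv_on_def)
    qed
    show ?case
    proof (intro conjI impI ballI)
      fix t assume y: "y \<in> Wv (Suc (Suc s))" and t: "t \<in> {a..b}"
      show "nth_deriv_on a b (Suc s) y t = dv (Suc s) y t"
      proof (rule step[OF Wv_mono(1)[OF _ y] t])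
        fix i
        have u: "(\<lambda>t. y t $ i) \<in> W (Suc (Suc 0) + s)" "(\<lambda>t. y t $ i) \<in> W (Suc 0 + Suc s)" using WvD[OF y] by simp_all
        show "(nth_deriv_on a b s (\<lambda>t. y t $ i) has_vector_derivative nth_deriv_on a b (Suc s) (\<lambda>t. y t $ i) t) (at t within {a..b})"
          by (rule prim_has_derivative[OF nth_deriv_prim[OF u(1)] W_Suc_continuous[OF nth_deriv_W(1)[OF u(2)]] t])
      qed simp
    next
      assume y: "y \<in> Wv (Suc s)"
      have "AE t in M. \<forall>i\<in>UNIV. (nth_deriv_on a b s (\<lambda>t. y t $ i) has_vector_derivative nth_deriv_on a b (Suc s) (\<lambda>t. y t $ i) t) (at t within {a..b})"
        by (subst AE_ball_countable)
          (use WvD[OF y] in \<open>auto intro!: prim_has_derivative_AE nth_deriv_prim[of _ 0]\<close>)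
      then show "AE t in M. nth_deriv_on a b (Suc s) y t = dv (Suc s) y t"
        using AE_space[of M] by eventually_elim (rule step[OF y], auto)
    qed
  qed
  then show "y \<in> Wv (Suc s) \<Longrightarrow> t \<in> {a..b} \<Longrightarrow> nth_deriv_on a b s y t = dv s y t"
    "y \<in> Wv s \<Longrightarrow> AE t in M. nth_deriv_on a b s y t = dv s y t" by auto
qed

lemma nth_deriv_eqv:
  assumes "u \<in> W (k + s)" "eqv (k + s) u v"
  shows "eqv k (nth_deriv_on a b s u) (nth_deriv_on a b s v)"
proof (cases "k + s = 0")
  case True
  then show ?thesis using assms by (simp add: nth_deriv_on_def)
next
  case False
  then show ?thesis using assms(2) by (intro eqvI nth_deriv_on_cong) (auto simp: eqv_def)
qed

lemma eqv_trans: "eqv l u v \<Longrightarrow> eqv l v w \<Longrightarrow> eqv l u w"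
  unfolding eqv_def by (cases "l = 0") (auto elim: eventually_elim2)

lemma eqv_AE: "eqv l u v \<Longrightarrow> AE t in M. u t = v t"
  by (cases "l = 0") (auto simp: eqv_def intro!: AE_I2)

text \<open>For k = 0 a sum may be differentiable at points where its summands are not, so linearity
  holds only almost everywhere; \<open>eqv k\<close> covers this case and the pointwise one.\<close>

lemma nth_deriv_lin:
  assumes "u \<in> W (k + s)" "v \<in> W (k + s)"
  shows "eqv k (nth_deriv_on a b s (\<lambda>t. u t + c * v t)) (\<lambda>t. nth_deriv_on a b s u t + c * nth_deriv_on a b s v t)"
  using assms
proof (induction s arbitrary: u v)
  case 0
  then show ?case by (simp add: eqvI)
next
  case (Suc s)
  have u: "prim u (D u)" "D u \<in> W (k + s)" and v: "prim v (D v)" "D v \<in> W (k + s)"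
    using W_SucD[of u "k + s"] W_SucD[of v "k + s"] Suc.prems by simp_all
  have w: "(\<lambda>t. D u t + c * D v t) \<in> W (k + s)"
    using W_add[OF u(2) W_cmult[OF v(2), THEN conjunct1]] by blast
  note pw = prim_W[OF prim_add[OF u(1) prim_cmult[OF v(1), of c]] w]
  have "eqv k (nth_deriv_on a b s (D (\<lambda>t. u t + c * v t))) (nth_deriv_on a b s (\<lambda>t. D u t + c * D v t))"
    by (rule nth_deriv_eqv[OF W_SucD(2)[OF pw(1)] pw(3)])
  from eqv_trans[OF this Suc.IH[OF u(2) v(2)]] show ?case
    unfolding nth_deriv_on_Suc .
qed

lemma dv_lin_AE:
  fixes y z :: "real \<Rightarrow> complex ^ 'm"
  assumes "y \<in> Wv s" "z \<in> Wv s"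
  shows "AE t in M. dv s (\<lambda>t. y t + c *s z t) t = dv s y t + c *s dv s z t"
proof -
  have "AE t in M. nth_deriv_on a b s (\<lambda>t. y t $ i + c * z t $ i) t
      = nth_deriv_on a b s (\<lambda>t. y t $ i) t + c * nth_deriv_on a b s (\<lambda>t. z t $ i) t" for i
    using nth_deriv_lin[of "\<lambda>t. y t $ i" 0 s "\<lambda>t. z t $ i" c] WvD[OF assms(1)] WvD[OF assms(2)]
    by (simp add: eqv_def)
  then show ?thesis by (simp add: AE_vec_iff)
qed

lemma dv_lin:
  fixes y z :: "real \<Rightarrow> complex ^ 'm"
  assumes "y \<in> Wv (Suc s)" "z \<in> Wv (Suc s)" "t \<in> {a..b}"
  shows "dv s (\<lambda>t. y t + c *s z t) t = dv s y t + c *s dv s z t"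
proof -
  have "nth_deriv_on a b s (\<lambda>t. y t $ i + c * z t $ i) t
      = nth_deriv_on a b s (\<lambda>t. y t $ i) t + c * nth_deriv_on a b s (\<lambda>t. z t $ i) t" for i
    using nth_deriv_lin[of "\<lambda>t. y t $ i" 1 s "\<lambda>t. z t $ i" c] WvD[OF assms(1)] WvD[OF assms(2)] assms(3)
    by (simp add: eqv_def)
  then show ?thesis by (simp add: vec_eq_iff)
qed

text \<open>Abstract in the product bound, so that it serves both the pairing of W^l with W^(l+1)
  and the algebra property.\<close>

lemma matvec_bound:
  fixes X :: "real \<Rightarrow> complex ^ 'm ^ 'm" and v :: "real \<Rightarrow> complex ^ 'm"
  assumes m: "\<And>u w. u \<in> W l \<Longrightarrow> w \<in> W k \<Longrightarrow> (\<lambda>t. u t * w t) \<in> W l"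
      "\<And>u w. u \<in> W l \<Longrightarrow> w \<in> W k \<Longrightarrow> sn l (\<lambda>t. u t * w t) \<le> C * sn l u * sn k w"
    and C: "C \<ge> 0" and X: "X \<in> Wm l" and v: "v \<in> Wv k"
  shows "(\<lambda>t. X t *v v t) \<in> Wv l" "vn l (\<lambda>t. X t *v v t) \<le> C * mn l X * vn k v"
proof -
  have X': "(\<lambda>t. X t $ i $ j) \<in> W l" for i j using X by (simp add: Wm_iff)
  have *: "(\<lambda>t. \<Sum>j\<in>UNIV. X t $ i $ j * v t $ j) \<in> W l \<and>
      sn l (\<lambda>t. \<Sum>j\<in>UNIV. X t $ i $ j * v t $ j) \<le> (\<Sum>j\<in>UNIV. sn l (\<lambda>t. X t $ i $ j * v t $ j))" for i
    by (rule W_sum) (auto intro!: m(1) X' WvD[OF v])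
  then show "(\<lambda>t. X t *v v t) \<in> Wv l" by (simp add: Wv_iff matrix_vector_mult_def)
  have "vn l (\<lambda>t. X t *v v t) \<le> (\<Sum>i\<in>UNIV. \<Sum>j\<in>UNIV. sn l (\<lambda>t. X t $ i $ j * v t $ j))"
    using * by (simp add: vn_eq matrix_vector_mult_def sum_mono)
  also have "\<dots> \<le> (\<Sum>i\<in>UNIV. \<Sum>j\<in>UNIV. C * sn l (\<lambda>t. X t $ i $ j) * vn k v)"
  proof (intro sum_mono)
    fix i j
    have "sn l (\<lambda>t. X t $ i $ j * v t $ j) \<le> C * sn l (\<lambda>t. X t $ i $ j) * sn k (\<lambda>t. v t $ j)"
      by (intro m(2) X' WvD[OF v])
    also have "\<dots> \<le> C * sn l (\<lambda>t. X t $ i $ j) * vn k v"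
      using C by (intro mult_left_mono sn_le_vn) auto
    finally show "sn l (\<lambda>t. X t $ i $ j * v t $ j) \<le> C * sn l (\<lambda>t. X t $ i $ j) * vn k v" .
  qed
  also have "\<dots> = C * mn l X * vn k v"
    by (simp add: sobolev_mat_norm_def sum_distrib_left sum_distrib_right)
  finally show "vn l (\<lambda>t. X t *v v t) \<le> C * mn l X * vn k v" .
qed

lemma matvec_W:
  fixes X :: "real \<Rightarrow> complex ^ 'm ^ 'm" and v :: "real \<Rightarrow> complex ^ 'm"
  assumes "X \<in> Wm l" "v \<in> Wv (Suc l)"
  shows "(\<lambda>t. X t *v v t) \<in> Wv l" "vn l (\<lambda>t. X t *v v t) \<le> KM l * mn l X * vn (Suc l) v"
proof -
  note * = matvec_bound[OF _ _ KM_nonneg[of l] assms]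
  show "(\<lambda>t. X t *v v t) \<in> Wv l"
    by (rule *(1); intro W_mult sn_mult; assumption)
  show "vn l (\<lambda>t. X t *v v t) \<le> KM l * mn l X * vn (Suc l) v"
    by (rule *(2); intro W_mult sn_mult; assumption)
qed

lemma matvec_algebra:
  fixes X :: "real \<Rightarrow> complex ^ 'm ^ 'm" and v :: "real \<Rightarrow> complex ^ 'm"
  assumes "X \<in> Wm (Suc l)" "v \<in> Wv (Suc l)"
  shows "(\<lambda>t. X t *v v t) \<in> Wv (Suc l)" "vn (Suc l) (\<lambda>t. X t *v v t) \<le> (KS + 2 * KM l) * mn (Suc l) X * vn (Suc l) v"
proof -
  have "KS + 2 * KM l \<ge> 0" using KS_nonneg KM_nonneg[of l] by simp
  note * = matvec_bound[OF _ _ this assms]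
  show "(\<lambda>t. X t *v v t) \<in> Wv (Suc l)"
    by (rule *(1); intro W_algebra; assumption)
  show "vn (Suc l) (\<lambda>t. X t *v v t) \<le> (KS + 2 * KM l) * mn (Suc l) X * vn (Suc l) v"
    by (rule *(2); intro W_algebra; assumption)
qed

lemma Wm_mono:
  assumes "k \<le> l" "X \<in> Wm l"
  shows "X \<in> Wm k" "mn k X \<le> mn l X"
  using W_mono[OF assms(1)] assms(2)
  by (auto simp: Wm_iff sobolev_mat_norm_def intro!: sum_mono)

lemma Wm_diff:
  fixes P R :: "real \<Rightarrow> complex ^ 'm ^ 'm"
  assumes "P \<in> Wm l" "R \<in> Wm l"
  shows "(\<lambda>t. P t - R t) \<in> Wm l" "mn l P \<le> mn l (\<lambda>t. P t - R t) + mn l R"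
proof -
  have PR: "(\<lambda>t. P t $ i $ j) \<in> W l" "(\<lambda>t. R t $ i $ j) \<in> W l" for i j
    using assms by (auto simp: Wm_iff)
  show "(\<lambda>t. P t - R t) \<in> Wm l" using W_diff(1)[OF PR] by (simp add: Wm_iff)
  have "sn l (\<lambda>t. P t $ i $ j) \<le> sn l (\<lambda>t. P t $ i $ j - R t $ i $ j) + sn l (\<lambda>t. R t $ i $ j)" for i j
    using W_add[OF W_diff(1)[OF PR(1)[of i j] PR(2)[of i j]] PR(2)[of i j]] by simp
  then show "mn l P \<le> mn l (\<lambda>t. P t - R t) + mn l R"
    unfolding sobolev_mat_norm_def sum.distrib[symmetric] by (intro sum_mono) simp
qed

end

section \<open>The differential expression on Sobolev spaces\<close>

locale linear_bvp = interval_Lp +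
  fixes n r :: nat
  assumes r_ge_1: "r \<ge> 1"
begin

abbreviation coeffs :: "(nat \<Rightarrow> real \<Rightarrow> complex ^ 'm ^ 'm) \<Rightarrow> bool" where
  "coeffs A \<equiv> \<forall>l\<in>{1..r}. A (r - l) \<in> Wm n"

definition an :: "(nat \<Rightarrow> real \<Rightarrow> complex ^ 'm ^ 'm) \<Rightarrow> real" where
  "an A = (\<Sum>l=1..r. mn n (A (r - l)))"

text \<open>The part of lower order, written with \<open>dv\<close> instead of derivatives of the
  vector function. It is linear in the coefficients, so a change of \<mu> acts on a fixed y as
  \<open>Q\<close> of the coefficient differences.\<close>

definition Q :: "(nat \<Rightarrow> real \<Rightarrow> complex ^ 'm ^ 'm) \<Rightarrow> (real \<Rightarrow> complex ^ 'm) \<Rightarrow> real \<Rightarrow> complex ^ 'm" where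
  "Q A y t = (\<Sum>l=1..r. A (r - l) t *v dv (r - l) y t)"

definition L :: "(nat \<Rightarrow> real \<Rightarrow> complex ^ 'm ^ 'm) \<Rightarrow> (real \<Rightarrow> complex ^ 'm) \<Rightarrow> real \<Rightarrow> complex ^ 'm" where
  "L A y t = dv r y t + Q A y t"

lemma an_nonneg [simp]: "an A \<ge> 0"
  by (simp add: an_def sum_nonneg)

lemma dv_low:
  assumes "y \<in> Wv (n + r)" "l \<in> {1..r}"
  shows "dv (r - l) y \<in> Wv (Suc n)" "vn (Suc n) (dv (r - l) y) \<le> vn (n + r) y"
proof -
  have *: "Suc n + (r - l) \<le> n + r" using assms(2) by auto
  show "dv (r - l) y \<in> Wv (Suc n)" "vn (Suc n) (dv (r - l) y) \<le> vn (n + r) y"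
    using dv_W[OF Wv_mono(1)[OF * assms(1)]] Wv_mono(2)[OF * assms(1)] by auto
qed

text \<open>The factor of A (r - l) is a derivative of order at most r - 1 and therefore one order
  smoother than the coefficient; \<open>matvec_W\<close> consumes this spare order.\<close>

lemma Q_W:
  assumes "coeffs A" "y \<in> Wv (n + r)"
  shows "Q A y \<in> Wv n" "vn n (Q A y) \<le> KM n * an A * vn (n + r) y"
proof -
  have *: "(\<lambda>t. A (r - l) t *v dv (r - l) y t) \<in> Wv n"
    "vn n (\<lambda>t. A (r - l) t *v dv (r - l) y t) \<le> KM n * mn n (A (r - l)) * vn (n + r) y" if l: "l \<in> {1..r}" for l
  proof -
    have A: "A (r - l) \<in> Wm n" using assms(1) l by blast
    show "(\<lambda>t. A (r - l) t *v dv (r - l) y t) \<in> Wv n"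
      by (rule matvec_W(1)[OF A dv_low(1)[OF assms(2) l]])
    have "vn n (\<lambda>t. A (r - l) t *v dv (r - l) y t) \<le> KM n * mn n (A (r - l)) * vn (Suc n) (dv (r - l) y)"
      by (rule matvec_W(2)[OF A dv_low(1)[OF assms(2) l]])
    also have "\<dots> \<le> KM n * mn n (A (r - l)) * vn (n + r) y"
      using KM_nonneg by (intro mult_left_mono dv_low assms l) auto
    finally show "vn n (\<lambda>t. A (r - l) t *v dv (r - l) y t) \<le> KM n * mn n (A (r - l)) * vn (n + r) y" .
  qed
  have **: "Q A y \<in> Wv n \<and> vn n (Q A y) \<le> (\<Sum>l=1..r. vn n (\<lambda>t. A (r - l) t *v dv (r - l) y t))"
    unfolding Q_def[abs_def] using * by (intro Wv_sum) auto
  then show "Q A y \<in> Wv n" by blast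
  have "(\<Sum>l=1..r. vn n (\<lambda>t. A (r - l) t *v dv (r - l) y t)) \<le> (\<Sum>l=1..r. KM n * mn n (A (r - l)) * vn (n + r) y)"
    using * by (intro sum_mono) auto
  also have "\<dots> = KM n * an A * vn (n + r) y"
    by (simp add: an_def sum_distrib_left sum_distrib_right)
  finally show "vn n (Q A y) \<le> KM n * an A * vn (n + r) y" using ** by linarith
qed

lemma L_W:
  assumes "coeffs A" "y \<in> Wv (n + r)"
  shows "L A y \<in> Wv n" "vn n (L A y) \<le> (1 + KM n * an A) * vn (n + r) y"
proof -
  note * = Wv_add[OF dv_W(1)[OF assms(2)] Q_W(1)[OF assms]]
  show "L A y \<in> Wv n" unfolding L_def[abs_def] using *(1) .
  show "vn n (L A y) \<le> (1 + KM n * an A) * vn (n + r) y"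
    unfolding L_def[abs_def] using *(2) dv_W(2)[OF assms(2)] Q_W(2)[OF assms] by (simp add: distrib_right)
qed

lemma Q_diff: "Q (\<lambda>j t. A j t - A' j t) y t = Q A y t - Q A' y t"
  by (simp add: Q_def sum_subtractf matrix_vector_mult_diff_rdistrib)

lemma L_lin:
  fixes y z :: "real \<Rightarrow> complex ^ 'm"
  assumes "y \<in> Wv (n + r)" "z \<in> Wv (n + r)"
  shows "AE t in M. L A (\<lambda>t. y t + c *s z t) t = L A y t + c *s L A z t"
proof -
  have low: "dv (r - l) (\<lambda>t. y t + c *s z t) t = dv (r - l) y t + c *s dv (r - l) z t" if "l \<in> {1..r}" "t \<in> {a..b}" for l t
    using assms that by (intro dv_lin Wv_mono(1)[of "Suc (r - l)" "n + r"]) auto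
  have Q: "Q A (\<lambda>t. y t + c *s z t) t = Q A y t + c *s Q A z t" if "t \<in> {a..b}" for t
    unfolding Q_def using low[OF _ that]
    by (simp add: matrix_vector_right_distrib vector_scalar_commute sum.distrib vec.scale_sum_right)
  have "AE t in M. dv r (\<lambda>t. y t + c *s z t) t = dv r y t + c *s dv r z t"
    using assms by (intro dv_lin_AE Wv_mono(1)[of r "n + r"]) auto
  then show ?thesis using AE_space[of M]
    by eventually_elim (simp add: L_def Q vec.scale_right_distrib)
qed

lemma diff_expr_eq_L:
  fixes y :: "real \<Rightarrow> complex ^ 'm"
  assumes "y \<in> Wv (n + r)"
  shows "AE t in M. diff_expr a b r A y t = L A y t"
    "n > 0 \<Longrightarrow> t \<in> {a..b} \<Longrightarrow> diff_expr a b r A y t = L A y t"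
proof -
  have low: "nth_deriv_on a b (r - l) y t = dv (r - l) y t" if "l \<in> {1..r}" "t \<in> {a..b}" for l t
    using assms that by (intro nth_deriv_vec(1) Wv_mono(1)[of "Suc (r - l)" "n + r"]) auto
  have *: "diff_expr a b r A y t = L A y t" if "t \<in> {a..b}" "nth_deriv_on a b r y t = dv r y t" for t
    using that low by (simp add: diff_expr_def L_def Q_def)
  have "AE t in M. nth_deriv_on a b r y t = dv r y t"
    using assms by (intro nth_deriv_vec(2) Wv_mono(1)[of r "n + r"]) auto
  then show "AE t in M. diff_expr a b r A y t = L A y t"
    using AE_space[of M] by eventually_elim (use * in auto)
  show "diff_expr a b r A y t = L A y t" if "n > 0" "t \<in> {a..b}"
    using assms that by (intro * nth_deriv_vec(1) Wv_mono(1)[of "Suc r" "n + r"]) auto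
qed

text \<open>One almost-everywhere formulation for all n. For n > 0 both L A y and f are in W^n,
  hence continuous, and almost everywhere equality is equality on [a, b]; the end points left out by
  the definition form a null set.\<close>

lemma bvp_solution_iff:
  fixes f :: "real \<Rightarrow> complex ^ 'm"
  assumes A: "coeffs A" and f: "f \<in> Wv n"
  shows "bvp_solution a b p n r A B f c y \<longleftrightarrow> y \<in> Wv (n + r) \<and> (AE t in M. L A y t = f t) \<and> B y = c"
proof (cases "y \<in> Wv (n + r)")
  case y: True
  show ?thesis
  proof (cases "n = 0")
    case True
    have "(AE t in M. diff_expr a b r A y t = f t) \<longleftrightarrow> (AE t in M. L A y t = f t)"
      using diff_expr_eq_L(1)[OF y, of A] by (auto elim: eventually_elim2)
    then show ?thesis using True y by (simp add: bvp_solution_def)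
  next
    case False
    then obtain k where k: "n = Suc k" by (cases n) auto
    have "(\<forall>t\<in>{a<..<b}. diff_expr a b r A y t = f t) \<longleftrightarrow> (AE t in M. L A y t = f t)"
    proof
      assume *: "\<forall>t\<in>{a<..<b}. diff_expr a b r A y t = f t"
      show "AE t in M. L A y t = f t"
        unfolding AE_M_negligible
      proof (intro exI[of _ "{a, b}"] conjI ballI)
        fix t assume "t \<in> {a..b} - {a, b}"
        then have "t \<in> {a<..<b}" "t \<in> {a..b}" by auto
        then show "L A y t = f t" using * diff_expr_eq_L(2)[OF y, of t A] False by simp
      qed simp
    next
      assume *: "AE t in M. L A y t = f t"
      show "\<forall>t\<in>{a<..<b}. diff_expr a b r A y t = f t"
      proof
        fix t assume "t \<in> {a<..<b}"
        then have t: "t \<in> {a..b}" by auto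
        have "L A y t = f t"
          using Wv_Suc_AE_eq[OF _ _ * t, of k] L_W(1)[OF A y] f k by simp
        then show "diff_expr a b r A y t = f t" using diff_expr_eq_L(2)[OF y, of t A] False t by simp
      qed
    qed
    then show ?thesis using False y by (simp add: bvp_solution_def)
  qed
qed (simp add: bvp_solution_def)

end

context interval_Lp
begin

subsection \<open>Iterated integrals and Taylor expansion\<close>

definition Ik :: "nat \<Rightarrow> (real \<Rightarrow> complex) \<Rightarrow> real \<Rightarrow> complex" where
  "Ik k = Intg ^^ k"

lemma Ik_0 [simp]: "Ik 0 u = u" and Ik_Suc: "Ik (Suc k) u = Intg (Ik k u)"
  by (simp_all add: Ik_def)

lemma Ik_W:
  assumes "u \<in> W l"
  shows "Ik k u \<in> W (l + k)" "sn (l + k) (Ik k u) \<le> KI ^ k * sn l u"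
proof -
  have "Ik k u \<in> W (l + k) \<and> sn (l + k) (Ik k u) \<le> KI ^ k * sn l u"
  proof (induction k)
    case (Suc k)
    then have "sn (Suc (l + k)) (Intg (Ik k u)) \<le> KI * (KI ^ k * sn l u)"
      using KI_ge_1 by (intro order_trans[OF Intg_W(2)] mult_left_mono) auto
    then show ?case using Intg_W(1)[of "Ik k u" "l + k"] Suc by (simp add: Ik_Suc mult_ac)
  qed (simp add: assms)
  then show "Ik k u \<in> W (l + k)" "sn (l + k) (Ik k u) \<le> KI ^ k * sn l u" by auto
qed

lemma W_integrable: "u \<in> W l \<Longrightarrow> integrable M u"
  using Lp_integrable W_imp_Lp by blast

lemma nth_deriv_Ik:
  assumes "u \<in> W l" "s \<le> k"
  shows "eqv (l + (k - s)) (nth_deriv_on a b s (Ik k u)) (Ik (k - s) u)"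
  using assms(2)
proof (induction s arbitrary: k)
  case 0
  then show ?case by (simp add: eqvI)
next
  case (Suc s)
  then obtain k' where k: "k = Suc k'" "s \<le> k'" by (cases k) auto
  have v: "Ik k' u \<in> W (l + k')" by (rule Ik_W[OF assms(1)])
  note pw = prim_W[OF prim_Intg[OF W_integrable[OF v]] v]
  have "l + k' = (l + (k' - s)) + s" using k by simp
  then have "eqv (l + (k' - s)) (nth_deriv_on a b s (D (Intg (Ik k' u)))) (nth_deriv_on a b s (Ik k' u))"
    using W_SucD(2)[OF pw(1)] pw(3) by (intro nth_deriv_eqv) simp_all
  from eqv_trans[OF this Suc.IH[OF k(2)]] show ?case
    using k by (simp add: Ik_Suc nth_deriv_on_Suc)
qed

text \<open>A single integration turns almost everywhere equality into equality, hence the index Suc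
  k.\<close>

lemma Ik_cong_AE:
  assumes "u \<in> Lp" "AE t in M. u t = v t" "t \<in> {a..b}"
  shows "Ik (Suc k) u t = Ik (Suc k) v t"
  using assms(3)
proof (induction k arbitrary: t)
  case 0
  obtain S where S: "negligible S" "\<And>t. t \<in> {a..b} - S \<Longrightarrow> u t = v t"
    using assms(2) unfolding AE_M_negligible by blast
  have "integral {a..t} u = integral {a..t} v"
    by (rule integral_spike[OF S(1)]) (use S(2) 0 in force)
  then show ?case by (simp add: Ik_Suc Intg_def)
next
  case (Suc k)
  have "integral {a..t} (Ik (Suc k) u) = integral {a..t} (Ik (Suc k) v)"
    using Suc by (intro integral_cong) auto
  then show ?case by (simp add: Ik_Suc[of "Suc k"] Intg_def)
qed

text \<open>The remainder stays an iterated integral, so the formula requires only that the k-th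
  derivative be in W^l, possibly L_p.\<close>

lemma taylor:
  assumes "u \<in> W (l + k)" "t \<in> {a..b}"
  shows "u t = (\<Sum>s<k. nth_deriv_on a b s u a * pw s t) + Ik k (nth_deriv_on a b k u) t"
  using assms
proof (induction k arbitrary: u t)
  case 0
  then show ?case by simp
next
  case (Suc k)
  have u: "prim u (D u)" "D u \<in> W (l + k)" using W_SucD[of u "l + k"] Suc.prems by auto
  let ?v = "\<lambda>t. \<Sum>s<k. nth_deriv_on a b s (D u) a * pw s t"
  let ?w = "Ik k (nth_deriv_on a b k (D u))"
  have w: "?w \<in> W (l + k)" by (rule Ik_W[OF nth_deriv_W(1)[OF u(2)]])
  have v: "prim (\<lambda>t. \<Sum>s<k. nth_deriv_on a b s (D u) a * pw (Suc s) t) ?v"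
  proof (induction k)
    case (Suc k)
    then show ?case using prim_add[OF Suc prim_cmult[OF prim_pw_Suc]] by simp
  qed (simp add: prim_def)
  note p = prim_add[OF v prim_Intg[OF W_integrable[OF w]]]
  have "u t - u a = integral {a..t} (D u)" using prim_diff[OF u(1), of a t] Suc.prems by simp
  also have "\<dots> = integral {a..t} (\<lambda>t. ?v t + ?w t)"
    using Suc.prems by (intro integral_cong Suc.IH[OF u(2)]) auto
  also have "\<dots> = (\<Sum>s<k. nth_deriv_on a b s (D u) a * pw (Suc s) t) + Intg ?w t"
    using prim_diff[OF p, of a t] Suc.prems by (simp add: pw_a)
  finally have "u t = u a + (\<Sum>s<k. nth_deriv_on a b s (D u) a * pw (Suc s) t) + Intg ?w t"
    by (simp add: algebra_simps)
  moreover have "pw 0 t = 1" by (simp add: pw_def)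
  ultimately show ?case
    by (simp add: sum.lessThan_Suc_shift nth_deriv_on_Suc Ik_Suc del: sum.lessThan_Suc)
qed

lemma sn_split: "sn (m + k) u \<le> sn k u + sn m (nth_deriv_on a b k u)"
proof (induction k arbitrary: u)
  case (Suc k)
  from Suc[of "D u"] show ?case by (simp add: sn_Suc nth_deriv_on_Suc)
qed simp

lemma pw_sum_W: "(\<lambda>t. \<Sum>s<k. c s * pw s t) \<in> W l"
  using W_sum[of "{..<k}" "\<lambda>s t. c s * pw s t" l] W_cmult[OF pw_W] by auto

text \<open>By Taylor's formula u is a polynomial plus the k-fold integral of its k-th derivative,
  and that derivative may be replaced by the smoother v under the integral. This is the gain of
  regularity in the bootstrapping.\<close>

lemma W_lift:
  assumes "u \<in> W k" "v \<in> W m" "AE t in M. nth_deriv_on a b k u t = v t" "k > 0"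
  shows "u \<in> W (m + k)" "sn (m + k) u \<le> sn k u + sn m v"
proof -
  have d: "nth_deriv_on a b k u \<in> W 0" using nth_deriv_W(1)[of u 0 k] assms(1) by simp
  obtain k' where k: "k = Suc k'" using assms(4) by (cases k) auto
  have eq: "u t = (\<Sum>s<k. nth_deriv_on a b s u a * pw s t) + Ik k v t" if "t \<in> {a..b}" for t
  proof -
    have u: "u \<in> W (0 + k)" using assms(1) by simp
    have eq: "Ik k (nth_deriv_on a b k u) t = Ik k v t"
      using Ik_cong_AE[OF W_imp_Lp[OF d] assms(3) that, of k'] by (simp only: k)
    show ?thesis by (rule trans[OF taylor[OF u that]]) (simp only: eq)
  qed
  have w: "(\<lambda>t. (\<Sum>s<k. nth_deriv_on a b s u a * pw s t) + Ik k v t) \<in> W (m + k)"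
    by (intro conjunct1[OF W_add] pw_sum_W Ik_W assms)
  show u: "u \<in> W (m + k)"
    by (rule sobolev_cong(1)[OF w eqvI]) (rule eq[symmetric])
  have "eqv m (nth_deriv_on a b k u) v"
    by (rule W_eqv_AE[OF nth_deriv_W(1)[OF u] assms(2,3)])
  then have "sn m (nth_deriv_on a b k u) = sn m v"
    using sobolev_cong(2)[OF assms(2) eqv_sym] by simp
  then show "sn (m + k) u \<le> sn k u + sn m v" using sn_split[of m k u] by simp
qed

text \<open>The integral on the right stops at t, not at b: this keeps the Volterra structure on
  which the factorials rest. The base 1 + (b - a) is at least 1, so its powers increase with
  k.\<close>

lemma norm_Ik_le:
  assumes "u \<in> W l" "t \<in> {a..b}"
  shows "norm (Ik (Suc k) u t) \<le> (1 + (b - a)) ^ k * integral {a..t} (\<lambda>s. norm (u s))"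
  using assms(2)
proof (induction k arbitrary: t)
  case 0
  then show ?case
    using norm_integral_le[OF W_integrable[OF assms(1)], of a t] by (simp add: Ik_Suc Intg_def)
next
  case (Suc k)
  let ?c = "(1 + (b - a)) ^ k" and ?U = "\<lambda>t. integral {a..t} (\<lambda>s. norm (u s))"
  have i: "integrable M (\<lambda>s. norm (u s))" using W_integrable[OF assms(1)] by simp
  have U: "?U s \<le> ?U t" if "s \<in> {a..t}" for s
    using that Suc.prems by (intro integral_nonneg_mono i) auto
  have U0: "?U t \<ge> 0" using Suc.prems integrable_M_on[OF i, of a t]
    by (intro Henstock_Kurzweil_Integration.integral_nonneg) auto
  have c: "?c \<ge> 0" using ab by simp
  have "norm (Ik (Suc (Suc k)) u t) = norm (integral {a..t} (Ik (Suc k) u))"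
    by (simp add: Ik_Suc[of "Suc k"] Intg_def)
  also have "\<dots> \<le> integral {a..t} (\<lambda>_. ?c * ?U t)"
  proof (intro integral_norm_bound_integral)
    show "Ik (Suc k) u integrable_on {a..t}"
      using integrable_M_on[OF W_integrable[OF Ik_W(1)[OF assms(1)]], of a t] Suc.prems by simp
    show "norm (Ik (Suc k) u s) \<le> ?c * ?U t" if "s \<in> {a..t}" for s
      using that Suc.prems c by (intro order_trans[OF Suc.IH] mult_left_mono U) auto
    show "(\<lambda>_. ?c * ?U t) integrable_on {a..t}" by (rule integrable_const_ivl)
  qed
  also have "\<dots> = (t - a) * (?c * ?U t)"
    using Suc.prems integral_const_real[of "?c * ?U t" a t] by simp
  also have "\<dots> \<le> (1 + (b - a)) * (?c * ?U t)"
    using Suc.prems c U0 by (intro mult_right_mono) auto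
  finally show ?case by (simp add: mult_ac)
qed

text \<open>The chain rule for powers of \<Phi> with \<phi> merely integrable: it follows from the
  product rule \<open>prim_mult\<close> by induction on the exponent. The detour through complex
  values only serves to use \<open>prim\<close>.\<close>

lemma integral_power_primitive:
  fixes \<phi> :: "real \<Rightarrow> real"
  assumes \<phi>: "integrable M \<phi>" and t: "t \<in> {a..b}"
  defines "\<Phi> \<equiv> \<lambda>t. integral {a..t} \<phi>"
  shows "integrable M (\<lambda>s. \<phi> s * (\<Phi> s ^ j / fact j))"
    "integral {a..t} (\<lambda>s. \<phi> s * (\<Phi> s ^ j / fact j)) = \<Phi> t ^ Suc j / fact (Suc j)"
proof -
  let ?P = "\<lambda>t. complex_of_real (\<Phi> t)" and ?f = "\<lambda>t. complex_of_real (\<phi> t)"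
  have \<Phi>a: "\<Phi> a = 0" by (simp add: \<Phi>_def)
  have p: "prim ?P ?f"
    unfolding prim_def
  proof (intro conjI ballI)
    show "integrable M ?f" using \<phi> by simp
    fix t assume "t \<in> {a..b}"
    then have "\<phi> integrable_on {a..t}" by (intro integrable_M_on[OF \<phi>]) auto
    then have "((\<lambda>t. of_real (\<phi> t)) has_integral complex_of_real (\<Phi> t)) {a..t}"
      unfolding \<Phi>_def by (intro has_integral_of_real integrable_integral)
    then show "?P t = ?P a + integral {a..t} ?f" by (simp add: integral_unique \<Phi>a)
  qed
  have pow: "prim (\<lambda>t. ?P t ^ Suc j) (\<lambda>t. of_nat (Suc j) * (?f t * ?P t ^ j))" for j
  proof (induction j)
    case (Suc j)
    have "?f t * ?P t ^ Suc j + ?P t * (of_nat (Suc j) * (?f t * ?P t ^ j)) = of_nat (Suc (Suc j)) * (?f t * ?P t ^ Suc j)" for t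
      by (simp add: algebra_simps)
    with prim_mult[OF p Suc] show ?case by simp
  qed (use p in simp)
  from prim_cmult[OF pow[of j], of "1 / fact (Suc j)"]
  have "prim (\<lambda>t. 1 / fact (Suc j) * ?P t ^ Suc j) (\<lambda>t. 1 / fact (Suc j) * (of_nat (Suc j) * (?f t * ?P t ^ j)))" .
  moreover have "1 / fact (Suc j) * (of_nat (Suc j) * (?f t * ?P t ^ j)) = complex_of_real (\<phi> t * (\<Phi> t ^ j / fact j))" for t
    by (simp add: field_simps del: of_nat_Suc)
  ultimately have pr: "prim (\<lambda>t. 1 / fact (Suc j) * ?P t ^ Suc j) (\<lambda>t. complex_of_real (\<phi> t * (\<Phi> t ^ j / fact j)))"
    by simp
  show int: "integrable M (\<lambda>s. \<phi> s * (\<Phi> s ^ j / fact j))"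
    using prim_integrable[OF pr] by (simp only: complex_of_real_integrable_eq)
  have "complex_of_real (\<Phi> t ^ Suc j / fact (Suc j)) = integral {a..t} (\<lambda>t. complex_of_real (\<phi> t * (\<Phi> t ^ j / fact j)))"
    using prim_diff[OF pr, of a t] t by (simp add: \<Phi>a)
  also have "\<dots> = complex_of_real (integral {a..t} (\<lambda>s. \<phi> s * (\<Phi> s ^ j / fact j)))"
    using t by (intro integral_unique has_integral_of_real integrable_integral integrable_M_on[OF int]) auto
  finally show "integral {a..t} (\<lambda>s. \<phi> s * (\<Phi> s ^ j / fact j)) = \<Phi> t ^ Suc j / fact (Suc j)"
    by (simp only: of_real_eq_iff)
qed

text \<open>Gronwall-type iteration. Each step multiplies by \<phi> and integrates up to t, which
  turns \<Phi>^k / k! into \<Phi>^(k+1) / (k+1)!.\<close>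

lemma iterated_bound:
  fixes u :: "nat \<Rightarrow> real \<Rightarrow> real" and \<phi> :: "real \<Rightarrow> real"
  assumes \<phi>: "integrable M \<phi>" "\<And>t. \<phi> t \<ge> 0" and u: "\<And>k. integrable M (u k)" "\<And>k t. u k t \<ge> 0"
    and step: "\<And>k. AE t in M. u (Suc k) t \<le> \<phi> t * integral {a..t} (u k)" and t: "t \<in> {a..b}"
  shows "integral {a..t} (u k) \<le> integral {a..b} (u 0) * (integral {a..t} \<phi> ^ k / fact k)"
  using t
proof (induction k arbitrary: t)
  case 0
  then show ?case using integral_nonneg_mono[OF u(1)[of 0] u(2), of a a t b] by simp
next
  case (Suc k)
  let ?\<Phi> = "\<lambda>t. integral {a..t} \<phi>" and ?U = "integral {a..b} (u 0)"
  note ip = integral_power_primitive[OF \<phi>(1) Suc.prems, of k]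
  obtain S where S: "negligible S" "\<And>s. s \<in> {a..b} - S \<Longrightarrow> u (Suc k) s \<le> \<phi> s * integral {a..s} (u k)"
    using step[of k] unfolding AE_M_negligible by blast
  have *: "u (Suc k) s \<le> ?U * (\<phi> s * (?\<Phi> s ^ k / fact k))" if "s \<in> {a..t} - S" for s
  proof -
    have "u (Suc k) s \<le> \<phi> s * integral {a..s} (u k)" using S(2) that Suc.prems by auto
    also have "\<dots> \<le> \<phi> s * (?U * (?\<Phi> s ^ k / fact k))"
      using that Suc.prems by (intro mult_left_mono Suc.IH \<phi>) auto
    finally show ?thesis by (simp add: mult_ac)
  qed
  have i: "u (Suc k) integrable_on {a..t}" "(\<lambda>s. \<phi> s * (?\<Phi> s ^ k / fact k)) integrable_on {a..t}"
    by (rule integrable_M_on[OF u(1)]; use Suc.prems in simp)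
      (rule integrable_M_on[OF ip(1)]; use Suc.prems in simp)
  \<comment> \<open>Both integrands are set to zero on S because the comparison of integrals asks
    for an inequality at every point.\<close>
  have "((\<lambda>s. if s \<in> S then 0 else u (Suc k) s) has_integral integral {a..t} (u (Suc k))) {a..t}"
    by (rule has_integral_spike[OF S(1) _ integrable_integral[OF i(1)]]) auto
  moreover have "((\<lambda>s. if s \<in> S then 0 else ?U * (\<phi> s * (?\<Phi> s ^ k / fact k))) has_integral
      ?U * integral {a..t} (\<lambda>s. \<phi> s * (?\<Phi> s ^ k / fact k))) {a..t}"
    by (rule has_integral_spike[OF S(1) _ has_integral_mult_right[OF integrable_integral[OF i(2)]]]) auto
  ultimately have "integral {a..t} (u (Suc k)) \<le> ?U * integral {a..t} (\<lambda>s. \<phi> s * (?\<Phi> s ^ k / fact k))"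
    by (rule has_integral_le) (use * in auto)
  then show ?case by (simp only: ip(2))
qed

definition Iv :: "nat \<Rightarrow> (real \<Rightarrow> complex ^ 'm) \<Rightarrow> real \<Rightarrow> complex ^ 'm" where
  "Iv k z t = (\<chi> i. Ik k (\<lambda>t. z t $ i) t)"

lemma Iv_nth: "(\<lambda>t. Iv k z t $ i) = Ik k (\<lambda>t. z t $ i)"
  by (simp add: Iv_def)

lemma Iv_W:
  assumes "z \<in> Wv l"
  shows "Iv k z \<in> Wv (l + k)" "vn (l + k) (Iv k z) \<le> KI ^ k * vn l z"
  using Ik_W[OF WvD[OF assms]]
  by (auto simp: Wv_iff vn_eq Iv_nth sum_distrib_left intro!: sum_mono)

lemma dv_Iv:
  assumes "z \<in> Wv l" "s < k" "t \<in> {a..b}"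
  shows "dv s (Iv k z) t = Iv (k - s) z t"
proof -
  have "nth_deriv_on a b s (Ik k (\<lambda>t. z t $ i)) t = Ik (k - s) (\<lambda>t. z t $ i) t" for i
    using nth_deriv_Ik[OF WvD[OF assms(1), of i], of s k] assms(2,3) by (simp add: eqv_def)
  then show ?thesis by (simp add: Iv_def)
qed

lemma dv_Iv_top:
  assumes "z \<in> Wv l"
  shows "AE t in M. dv k (Iv k z) t = z t"
proof -
  have "AE t in M. nth_deriv_on a b k (Ik k (\<lambda>t. z t $ i)) t = z t $ i" for i
    using eqv_AE[OF nth_deriv_Ik[OF WvD[OF assms, of i], of k k]] by simp
  then show ?thesis by (simp add: AE_vec_iff Iv_def)
qed

lemma dv_Iv_a:
  assumes "z \<in> Wv l" "s < k"
  shows "dv s (Iv k z) a = 0"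
proof -
  obtain j where "k - s = Suc j" using assms(2) by (metis Suc_diff_Suc)
  then show ?thesis using dv_Iv[OF assms, of a] ab by (simp add: Iv_def Ik_Suc vec_eq_iff)
qed

lemma Iv_taylor:
  assumes "y \<in> Wv (l + k)" "\<And>s. s < k \<Longrightarrow> dv s y a = 0" "t \<in> {a..b}"
  shows "y t = Iv k (dv k y) t"
proof -
  have "nth_deriv_on a b s (\<lambda>t. y t $ i) a = 0" if "s < k" for s i
    using assms(2)[OF that] by (simp add: vec_eq_iff)
  then show ?thesis
    using taylor[OF WvD[OF assms(1)] assms(3)] by (simp add: Iv_def vec_eq_iff)
qed

lemma dv_cong: "(\<And>t. t \<in> {a..b} \<Longrightarrow> y t = z t) \<Longrightarrow> t \<in> {a..b} \<Longrightarrow> dv s y t = dv s z t"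
  by (auto simp: vec_eq_iff intro!: nth_deriv_on_cong)

lemma Lp_of_real_norm:
  assumes "u \<in> Lp"
  shows "(\<lambda>t. complex_of_real (norm (u t))) \<in> Lp" "N (\<lambda>t. complex_of_real (norm (u t))) \<le> N u"
  using Lp_dominated[OF assms, of "\<lambda>t. complex_of_real (norm (u t))"] Lp_measurable[OF assms] by auto

text \<open>The 1-norm of the value at t, matching the sum over components in
  \<open>vn\<close>.\<close>

definition cn :: "(real \<Rightarrow> complex ^ 'm) \<Rightarrow> real \<Rightarrow> real" where
  "cn z t = (\<Sum>i\<in>UNIV. norm (z t $ i))"

lemma cn_nonneg [simp]: "cn z t \<ge> 0"
  by (simp add: cn_def sum_nonneg)

lemma cn_integrable: "z \<in> Wv l \<Longrightarrow> integrable M (cn z)"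
  unfolding cn_def[abs_def]
  by (intro Bochner_Integration.integrable_sum Bochner_Integration.integrable_norm W_integrable WvD)

lemma integral_cn_le:
  assumes "z \<in> Wv l"
  shows "integral {a..b} (cn z) \<le> (b - a + 1) * vn l z"
proof -
  have *: "integrable M (\<lambda>t. norm (z t $ i))" for i
    using assms by (intro integrable_norm W_integrable WvD)
  have "integral {a..b} (cn z) = (\<Sum>i\<in>UNIV. LINT t|M. norm (z t $ i))"
    unfolding LINT_eq_integral[OF cn_integrable[OF assms], symmetric] cn_def
    by (rule Bochner_Integration.integral_sum) (rule *)
  also have "\<dots> \<le> (\<Sum>i\<in>UNIV. (b - a + 1) * sn l (\<lambda>t. z t $ i))"
  proof (rule sum_mono)
    fix i
    have "(LINT t|M. norm (z t $ i)) \<le> (b - a + 1) * N (\<lambda>t. z t $ i)"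
      using assms by (intro Lp_integrable(2) W_imp_Lp WvD)
    also have "\<dots> \<le> (b - a + 1) * sn l (\<lambda>t. z t $ i)"
      using ab by (intro mult_left_mono N_le_sn) auto
    finally show "(LINT t|M. norm (z t $ i)) \<le> (b - a + 1) * sn l (\<lambda>t. z t $ i)" .
  qed
  finally show ?thesis by (simp add: vn_eq sum_distrib_left)
qed

end

context linear_bvp
begin

subsection \<open>The initial value problem with zero data\<close>

text \<open>Dominates the factors (1 + (b - a))^k of \<open>norm_Ik_le\<close> for all k \<le> r at
  once.\<close>

definition \<kappa> :: real where "\<kappa> = (1 + (b - a)) ^ r"

text \<open>Majorant of the Volterra operator z \<mapsto> Q A (Iv r z), see \<open>cn_Q_le\<close>.
  It is only an L_p function of t.\<close>

definition \<phi> :: "(nat \<Rightarrow> real \<Rightarrow> complex ^ 'm ^ 'm) \<Rightarrow> real \<Rightarrow> real" where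
  "\<phi> A t = \<kappa> * (\<Sum>l=1..r. \<Sum>i\<in>UNIV. \<Sum>j\<in>UNIV. norm (A (r - l) t $ i $ j))"

lemma \<kappa>_nonneg: "\<kappa> \<ge> 0" using ab by (simp add: \<kappa>_def)

lemma \<phi>_nonneg [simp]: "\<phi> A t \<ge> 0"
  using \<kappa>_nonneg by (simp add: \<phi>_def sum_nonneg)

lemma \<phi>_Lp:
  assumes A: "\<forall>l\<in>{1..r}. A (r - l) \<in> Wm k"
  shows "(\<lambda>t. complex_of_real (\<phi> A t)) \<in> Lp"
    "N (\<lambda>t. complex_of_real (\<phi> A t)) \<le> \<kappa> * (\<Sum>l=1..r. mn k (A (r - l)))"
proof -
  let ?a = "\<lambda>l i j t. complex_of_real (norm (A (r - l) t $ i $ j))"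
  have a: "?a l i j \<in> Lp" "N (?a l i j) \<le> sn k (\<lambda>t. A (r - l) t $ i $ j)" if "l \<in> {1..r}" for l i j
  proof -
    have u: "(\<lambda>t. A (r - l) t $ i $ j) \<in> Lp" using bspec[OF A that] W_imp_Lp by (auto simp: Wm_iff)
    show "?a l i j \<in> Lp" by (rule Lp_of_real_norm[OF u])
    show "N (?a l i j) \<le> sn k (\<lambda>t. A (r - l) t $ i $ j)"
      using Lp_of_real_norm(2)[OF u] N_le_sn order_trans by blast
  qed
  have 1: "(\<lambda>t. \<Sum>j\<in>UNIV. ?a l i j t) \<in> Lp \<and> N (\<lambda>t. \<Sum>j\<in>UNIV. ?a l i j t) \<le> (\<Sum>j\<in>UNIV. N (?a l i j))" if "l \<in> {1..r}" for l i
    using a that by (intro Lp_sum) auto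
  have 2: "(\<lambda>t. \<Sum>i\<in>UNIV. \<Sum>j\<in>UNIV. ?a l i j t) \<in> Lp \<and> N (\<lambda>t. \<Sum>i\<in>UNIV. \<Sum>j\<in>UNIV. ?a l i j t) \<le> (\<Sum>i\<in>UNIV. N (\<lambda>t. \<Sum>j\<in>UNIV. ?a l i j t))" if "l \<in> {1..r}" for l
    using 1 that by (intro Lp_sum) auto
  have 3: "(\<lambda>t. \<Sum>l=1..r. \<Sum>i\<in>UNIV. \<Sum>j\<in>UNIV. ?a l i j t) \<in> Lp \<and> N (\<lambda>t. \<Sum>l=1..r. \<Sum>i\<in>UNIV. \<Sum>j\<in>UNIV. ?a l i j t) \<le> (\<Sum>l=1..r. N (\<lambda>t. \<Sum>i\<in>UNIV. \<Sum>j\<in>UNIV. ?a l i j t))"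
    using 2 by (intro Lp_sum) auto
  have eq: "(\<lambda>t. complex_of_real (\<phi> A t)) = (\<lambda>t. complex_of_real \<kappa> * (\<Sum>l=1..r. \<Sum>i\<in>UNIV. \<Sum>j\<in>UNIV. ?a l i j t))"
    by (simp add: \<phi>_def fun_eq_iff)
  show "(\<lambda>t. complex_of_real (\<phi> A t)) \<in> Lp" unfolding eq using 3 by (intro Lp_cmult) blast
  have "(\<Sum>l=1..r. N (\<lambda>t. \<Sum>i\<in>UNIV. \<Sum>j\<in>UNIV. ?a l i j t)) \<le> (\<Sum>l=1..r. mn k (A (r - l)))"
    unfolding sobolev_mat_norm_def
  proof (rule sum_mono)
    fix l assume l: "l \<in> {1..r}"
    have "N (\<lambda>t. \<Sum>i\<in>UNIV. \<Sum>j\<in>UNIV. ?a l i j t) \<le> (\<Sum>i\<in>UNIV. \<Sum>j\<in>UNIV. N (?a l i j))"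
      using 2[OF l] 1[OF l] by (intro order_trans[OF conjunct2[OF 2[OF l]]] sum_mono) blast
    also have "\<dots> \<le> (\<Sum>i\<in>UNIV. \<Sum>j\<in>UNIV. sn k (\<lambda>t. A (r - l) t $ i $ j))"
      by (intro sum_mono a l)
    finally show "N (\<lambda>t. \<Sum>i\<in>UNIV. \<Sum>j\<in>UNIV. ?a l i j t) \<le> (\<Sum>i\<in>UNIV. \<Sum>j\<in>UNIV. sn k (\<lambda>t. A (r - l) t $ i $ j))" .
  qed
  with 3 have "N (\<lambda>t. \<Sum>l=1..r. \<Sum>i\<in>UNIV. \<Sum>j\<in>UNIV. ?a l i j t) \<le> (\<Sum>l=1..r. mn k (A (r - l)))"
    by linarith
  then show "N (\<lambda>t. complex_of_real (\<phi> A t)) \<le> \<kappa> * (\<Sum>l=1..r. mn k (A (r - l)))"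
    unfolding eq using Lp_cmult(2)[OF conjunct1[OF 3], of "complex_of_real \<kappa>"] \<kappa>_nonneg
    by (simp add: mult_left_mono)
qed

text \<open>The derivative of order r - l of \<open>Iv r z\<close> is \<open>Iv l z\<close> with l
  \<ge> 1, so at least one integration is left in every term and \<open>norm_Ik_le\<close>
  applies.\<close>

lemma cn_Q_le:
  assumes z: "z \<in> Wv 0" and t: "t \<in> {a..b}"
  shows "cn (Q A (Iv r z)) t \<le> \<phi> A t * integral {a..t} (cn z)"
proof -
  let ?U = "integral {a..t} (cn z)"
  have I: "norm (Iv l z t $ j) \<le> \<kappa> * ?U" if l: "l \<in> {1..r}" for l j
  proof -
    obtain k where k: "l = Suc k" "k \<le> r" using l by (cases l) auto
    have i: "integrable M (\<lambda>s. norm (z s $ j))" using WvD[OF z] W_integrable by (intro integrable_norm) blast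
    have "integral {a..t} (\<lambda>s. norm (z s $ j)) \<le> ?U"
      using t by (intro Henstock_Kurzweil_Integration.integral_le integrable_M_on[OF i] integrable_M_on[OF cn_integrable[OF z]])
        (auto simp: cn_def intro: member_le_sum)
    moreover have "(1 + (b - a)) ^ k \<le> \<kappa>"
      unfolding \<kappa>_def using ab k by (intro power_increasing) auto
    moreover have "integral {a..t} (\<lambda>s. norm (z s $ j)) \<ge> 0"
      using t by (intro Henstock_Kurzweil_Integration.integral_nonneg integrable_M_on[OF i]) auto
    ultimately have "(1 + (b - a)) ^ k * integral {a..t} (\<lambda>s. norm (z s $ j)) \<le> \<kappa> * ?U"
      using \<kappa>_nonneg by (intro mult_mono) auto
    then show ?thesis
      using norm_Ik_le[OF WvD[OF z] t, of k j] k by (simp add: Iv_def)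
  qed
  have comp: "Q A (Iv r z) t $ i = (\<Sum>l=1..r. \<Sum>j\<in>UNIV. A (r - l) t $ i $ j * Iv l z t $ j)" for i
  proof -
    have "Q A (Iv r z) t = (\<Sum>l=1..r. A (r - l) t *v Iv l z t)"
      unfolding Q_def using dv_Iv[OF z _ t, of _ r] by (intro sum.cong) auto
    then show ?thesis by (simp add: matrix_vector_mult_def)
  qed
  have "cn (Q A (Iv r z)) t \<le> (\<Sum>i\<in>UNIV. \<Sum>l=1..r. \<Sum>j\<in>UNIV. norm (A (r - l) t $ i $ j) * (\<kappa> * ?U))"
    unfolding cn_def comp
  proof (rule sum_mono)
    fix i
    have "norm (\<Sum>l=1..r. \<Sum>j\<in>UNIV. A (r - l) t $ i $ j * Iv l z t $ j)
        \<le> (\<Sum>l=1..r. \<Sum>j\<in>UNIV. norm (A (r - l) t $ i $ j * Iv l z t $ j))"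
      by (intro order_trans[OF norm_sum] sum_mono norm_sum)
    also have "\<dots> \<le> (\<Sum>l=1..r. \<Sum>j\<in>UNIV. norm (A (r - l) t $ i $ j) * (\<kappa> * ?U))"
      unfolding norm_mult by (intro sum_mono mult_left_mono I) auto
    finally show "norm (\<Sum>l=1..r. \<Sum>j\<in>UNIV. A (r - l) t $ i $ j * Iv l z t $ j)
        \<le> (\<Sum>l=1..r. \<Sum>j\<in>UNIV. norm (A (r - l) t $ i $ j) * (\<kappa> * integral {a..t} (\<lambda>t. \<Sum>i\<in>UNIV. norm (z t $ i))))"
      by (simp add: cn_def[abs_def])
  qed
  also have "\<dots> = (\<Sum>l=1..r. \<Sum>i\<in>UNIV. \<Sum>j\<in>UNIV. norm (A (r - l) t $ i $ j)) * (\<kappa> * ?U)"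
    by (subst sum.swap) (simp add: sum_distrib_right)
  also have "\<dots> = \<phi> A t * ?U" by (simp add: \<phi>_def)
  finally show ?thesis .
qed

lemma Q_cong: "(\<And>t. t \<in> {a..b} \<Longrightarrow> y t = z t) \<Longrightarrow> t \<in> {a..b} \<Longrightarrow> Q A y t = Q A z t"
  unfolding Q_def by (simp only: dv_cong[of y z])

lemma \<phi>_integrable:
  assumes A: "\<forall>l\<in>{1..r}. A (r - l) \<in> Wm k"
  shows "integrable M (\<phi> A)"
  using Lp_integrable(1)[OF \<phi>_Lp(1)[OF assms]] by (simp add: complex_of_real_integrable_eq)

lemma integral_\<phi>_le:
  assumes A: "\<forall>l\<in>{1..r}. A (r - l) \<in> Wm k"
  shows "integral {a..b} (\<phi> A) \<le> (b - a + 1) * (\<kappa> * (\<Sum>l=1..r. mn k (A (r - l))))"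
proof -
  have "integral {a..b} (\<phi> A) = (LINT t|M. norm (complex_of_real (\<phi> A t)))"
    using LINT_eq_integral[OF \<phi>_integrable[OF assms]] by simp
  also have "\<dots> \<le> (b - a + 1) * N (\<lambda>t. complex_of_real (\<phi> A t))"
    by (rule Lp_integrable(2)[OF \<phi>_Lp(1)[OF assms]])
  also have "\<dots> \<le> (b - a + 1) * (\<kappa> * (\<Sum>l=1..r. mn k (A (r - l))))"
    using ab by (intro mult_left_mono \<phi>_Lp(2) assms) auto
  finally show ?thesis .
qed

text \<open>With zero data y is the r-fold integral of z = dv r y, and the equation makes cn z at
  most \<phi> A times its own integral. Iterating this one inequality, with a constant sequence in
  \<open>iterated_bound\<close>, bounds the integral U of cn z by U \<Phi>^k / k! for every k, so U
  vanishes.\<close>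

lemma zero_data_unique:
  assumes A: "\<forall>l\<in>{1..r}. A (r - l) \<in> Wm 0" and y: "y \<in> Wv r"
    and data: "\<And>s. s < r \<Longrightarrow> dv s y a = 0" and eq: "AE t in M. L A y t = 0" and t: "t \<in> {a..b}"
  shows "y t = 0"
proof -
  define z where "z = dv r y"
  have z: "z \<in> Wv 0" unfolding z_def using dv_W(1)[of y 0 r] y by simp
  have yz: "y t = Iv r z t" if "t \<in> {a..b}" for t
    unfolding z_def using Iv_taylor[of y 0 r t] y data that by simp
  let ?U = "\<lambda>t. integral {a..t} (cn z)" and ?\<Phi> = "\<lambda>t. integral {a..t} (\<phi> A)"
  have "AE t in M. cn z t \<le> \<phi> A t * ?U t"
    using eq AE_space[of M]
  proof eventually_elim
    case (elim t)
    then have t: "t \<in> {a..b}" by simp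
    have "Q A y t = Q A (Iv r z) t" by (rule Q_cong[OF yz t])
    then have "z t = - Q A (Iv r z) t"
      using elim(1) by (simp add: L_def z_def eq_neg_iff_add_eq_0)
    then show ?case using cn_Q_le[OF z t, of A] by (simp add: cn_def)
  qed
  then have *: "?U b \<le> ?U b * (?\<Phi> b ^ k / fact k)" for k
    using ab by (intro iterated_bound[of "\<phi> A" "\<lambda>_. cn z", OF \<phi>_integrable[OF A] _ cn_integrable[OF z]]) auto
  have "(\<lambda>k. ?\<Phi> b ^ k / fact k) \<longlonglongrightarrow> 0"
    using summable_LIMSEQ_zero[OF summable_exp[of "?\<Phi> b"]] by (simp add: divide_inverse mult.commute)
  then have "(\<lambda>k. ?U b * (?\<Phi> b ^ k / fact k)) \<longlonglongrightarrow> ?U b * 0"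
    by (intro tendsto_mult tendsto_const)
  then have "?U b \<le> ?U b * 0"
    by (rule LIMSEQ_le_const) (use * in blast)
  then have U: "?U b \<le> 0" by simp
  have "norm (y t $ i) \<le> 0" for i
  proof -
    obtain k where k: "r = Suc k" using r_ge_1 by (cases r) auto
    have i: "integrable M (\<lambda>s. norm (z s $ i))" using WvD[OF z] W_integrable by (intro integrable_norm) blast
    have "norm (y t $ i) \<le> (1 + (b - a)) ^ k * integral {a..t} (\<lambda>s. norm (z s $ i))"
      using yz[OF t] norm_Ik_le[OF WvD[OF z] t, of k i] by (simp add: Iv_def k)
    also have "\<dots> \<le> (1 + (b - a)) ^ k * ?U b"
    proof (intro mult_left_mono)
      have "integral {a..t} (\<lambda>s. norm (z s $ i)) \<le> integral {a..b} (\<lambda>s. norm (z s $ i))"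
        using t by (intro integral_nonneg_mono i) auto
      also have "\<dots> \<le> ?U b"
        by (intro Henstock_Kurzweil_Integration.integral_le integrable_M_on[OF i] integrable_M_on[OF cn_integrable[OF z]])
          (auto simp: cn_def intro: member_le_sum)
      finally show "integral {a..t} (\<lambda>s. norm (z s $ i)) \<le> ?U b" .
    qed (use ab in simp)
    also have "\<dots> \<le> 0" using U ab by (intro mult_nonneg_nonpos) auto
    finally show ?thesis .
  qed
  then show ?thesis by (simp add: vec_eq_iff)
qed

lemma L_diff:
  assumes "y \<in> Wv (n + r)" "z \<in> Wv (n + r)"
  shows "AE t in M. L A (\<lambda>t. y t - z t) t = L A y t - L A z t"
  using L_lin[OF assms, of A "-1"] by simp

lemma L_add:
  assumes "y \<in> Wv (n + r)" "z \<in> Wv (n + r)"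
  shows "AE t in M. L A (\<lambda>t. y t + z t) t = L A y t + L A z t"
  using L_lin[OF assms, of A 1] by simp

lemma L_zero: "AE t in M. L A (\<lambda>_. 0) t = 0"
  using L_diff[OF Wv_zero(1) Wv_zero(1)] by simp

lemma dv_add:
  assumes "y \<in> Wv (n + r)" "z \<in> Wv (n + r)" "s < r" "t \<in> {a..b}"
  shows "dv s (\<lambda>t. y t + c *s z t) t = dv s y t + c *s dv s z t"
  using assms by (intro dv_lin Wv_mono(1)[of "Suc s" "n + r"]) auto

lemma dv_diff:
  assumes "y \<in> Wv (n + r)" "z \<in> Wv (n + r)" "s < r" "t \<in> {a..b}"
  shows "dv s (\<lambda>t. y t - z t) t = dv s y t - dv s z t"
  using dv_add[OF assms, of "-1"] by simp

lemma dv_zero: "s < r \<Longrightarrow> t \<in> {a..b} \<Longrightarrow> dv s (\<lambda>_. 0) t = 0"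
  using dv_diff[OF Wv_zero(1) Wv_zero(1)] by simp

lemma dv_bound:
  assumes "y \<in> Wv (n + r)" "s < r" "t \<in> {a..b}"
  shows "norm (dv s y t $ i) \<le> KS * vn (n + r) y"
proof -
  have y: "y \<in> Wv (Suc 0 + s)" "vn (Suc 0 + s) y \<le> vn (n + r) y"
    using Wv_mono[OF _ assms(1), of "Suc 0 + s"] assms(2) by auto
  have "norm (dv s y t $ i) \<le> KS * sn (Suc 0) (\<lambda>t. dv s y t $ i)"
    by (rule sup_bound[OF WvD[OF dv_W(1)[OF y(1)]] assms(3)])
  also have "\<dots> \<le> KS * vn (n + r) y"
    using KS_nonneg order_trans[OF sn_le_vn order_trans[OF dv_W(2)[OF y(1)] y(2)]]
    by (intro mult_left_mono)
  finally show ?thesis .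
qed

text \<open>The factor \<open>KI ^ r\<close> comes from r integrations, the summand 1 from f itself,
  and the exponential from summing the factorial bounds of the other terms of the Neumann series.
  The argument d is the number of components.\<close>

definition Kbase :: "nat \<Rightarrow> real \<Rightarrow> real" where
  "Kbase d R = KI ^ r * (1 + real d * (\<kappa> * R) * (b - a + 1) * exp ((b - a + 1) * (\<kappa> * R)))"

text \<open>The summands \<open>fs k\<close> of the Neumann series satisfy \<open>fs (k + 1) = - Q A (I\<^sup>r (fs k))\<close>; integrating them \<open>r\<close>
  times gives partial sums that solve the equation up to \<open>fs k\<close>.\<close>

lemma zero_data_solvable_base:
  fixes A :: "nat \<Rightarrow> real \<Rightarrow> complex ^ 'm ^ 'm" and f :: "real \<Rightarrow> complex ^ 'm"
  assumes A: "\<forall>l\<in>{1..r}. A (r - l) \<in> Wm 0" and R: "(\<Sum>l=1..r. mn 0 (A (r - l))) \<le> R" and f: "f \<in> Wv 0"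
  shows "\<exists>y\<in>Wv r. (\<forall>s<r. dv s y a = 0) \<and> (AE t in M. L A y t = f t) \<and> vn r y \<le> Kbase CARD('m) R * vn 0 f"
proof -
  \<comment> \<open>The base case lives at order n = 0, whatever n the surrounding locale
    has.\<close>
  interpret z: linear_bvp a b p 0 r by unfold_locales (rule r_ge_1)
  have R0: "R \<ge> 0" using R by (intro order_trans[OF sum_nonneg R]) auto
  define fs where "fs k = ((\<lambda>g t. - Q A (Iv r g) t) ^^ k) f" for k
  have fs_Suc: "fs (Suc k) = (\<lambda>t. - Q A (Iv r (fs k)) t)" for k by (simp add: fs_def)
  have fs: "fs k \<in> Wv 0" for k
  proof (induction k)
    case 0
    then show ?case by (simp add: fs_def f)
  next
    case (Suc k)
    then show ?case unfolding fs_Suc by (intro Wv_minus(1) z.Q_W(1) A Iv_W(1))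
  qed
  let ?\<Phi> = "\<lambda>t. integral {a..t} (\<phi> A)" and ?\<rho> = "(b - a + 1) * (\<kappa> * R)" and ?U = "integral {a..b} (cn f)"
  have \<phi>R: "N (\<lambda>t. complex_of_real (\<phi> A t)) \<le> \<kappa> * R"
    using \<phi>_Lp(2)[OF A] R \<kappa>_nonneg by (meson mult_left_mono order_trans)
  have \<Phi>: "0 \<le> ?\<Phi> t" "?\<Phi> t \<le> ?\<rho>" if "t \<in> {a..b}" for t
  proof -
    show "0 \<le> ?\<Phi> t"
      using that by (intro Henstock_Kurzweil_Integration.integral_nonneg integrable_M_on[OF \<phi>_integrable[OF A]]) auto
    have "?\<Phi> t \<le> ?\<Phi> b" using that by (intro integral_nonneg_mono \<phi>_integrable[OF A]) auto
    also have "\<dots> \<le> (b - a + 1) * (\<kappa> * (\<Sum>l=1..r. mn 0 (A (r - l))))" by (rule integral_\<phi>_le[OF A])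
    also have "\<dots> \<le> ?\<rho>" using R \<kappa>_nonneg ab by (intro mult_left_mono) auto
    finally show "?\<Phi> t \<le> ?\<rho>" .
  qed
  have U: "0 \<le> ?U" "?U \<le> (b - a + 1) * vn 0 f"
    using integral_cn_le[OF f] ab
    by (auto intro!: Henstock_Kurzweil_Integration.integral_nonneg integrable_M_on[OF cn_integrable[OF f]])
  have step: "cn (fs (Suc k)) t \<le> \<phi> A t * integral {a..t} (cn (fs k))" if "t \<in> {a..b}" for k t
    using cn_Q_le[OF fs that] by (simp add: fs_Suc cn_def)
  have iter: "integral {a..t} (cn (fs k)) \<le> ?U * (?\<rho> ^ k / fact k)" if t: "t \<in> {a..b}" for k t
  proof -
    have "integral {a..t} (cn (fs k)) \<le> integral {a..b} (cn (fs 0)) * (?\<Phi> t ^ k / fact k)"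
      by (intro iterated_bound[of "\<phi> A" "\<lambda>k. cn (fs k)", OF \<phi>_integrable[OF A] _ cn_integrable[OF fs] _ _ t] AE_I2)
        (auto intro: step)
    also have "\<dots> \<le> ?U * (?\<rho> ^ k / fact k)"
      using \<Phi>[OF t] U by (auto simp: fs_def intro!: mult_left_mono divide_right_mono power_mono)
    finally show ?thesis .
  qed
  let ?H = "real CARD('m) * (\<kappa> * R) * ((b - a + 1) * vn 0 f)"
  \<comment> \<open>The iteration controls only L_1 integrals. One more application of
    \<open>step\<close> gives an L_p bound: the integral is at most a number c, and the remaining
    factor \<phi> A lies in L_p. The term f itself is added in \<open>total\<close>.\<close>
  have vfs: "vn 0 (fs (Suc k)) \<le> ?H * (?\<rho> ^ k / fact k)" for k
  proof -
    define c where "c = (b - a + 1) * vn 0 f * (?\<rho> ^ k / fact k)"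
    have \<rho>: "0 \<le> ?\<rho> ^ k / fact k" using ab \<kappa>_nonneg R0 by simp
    have c: "c \<ge> 0" unfolding c_def using \<rho> ab by (intro mult_nonneg_nonneg) auto
    have "sn 0 (\<lambda>t. fs (Suc k) t $ i) \<le> \<kappa> * R * c" for i
    proof -
      let ?g = "\<lambda>t. complex_of_real c * complex_of_real (\<phi> A t)"
      have "AE t in M. norm (fs (Suc k) t $ i) \<le> norm (?g t)"
      proof (rule AE_I2)
        fix t assume "t \<in> space M"
        then have t: "t \<in> {a..b}" by simp
        have "norm (fs (Suc k) t $ i) \<le> cn (fs (Suc k)) t"
          unfolding cn_def by (rule member_le_sum) auto
        also have "\<dots> \<le> \<phi> A t * (?U * (?\<rho> ^ k / fact k))"
          by (intro order_trans[OF step[OF t]] mult_left_mono iter t) simp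
        also have "\<dots> \<le> \<phi> A t * c"
          unfolding c_def using U \<rho> by (intro mult_left_mono mult_right_mono) auto
        finally show "norm (fs (Suc k) t $ i) \<le> norm (?g t)"
          using c by (simp add: norm_mult mult.commute)
      qed
      then have "N (\<lambda>t. fs (Suc k) t $ i) \<le> N ?g"
        using WvD[OF fs] by (intro Lp_dominated(2)[OF Lp_cmult(1)[OF \<phi>_Lp(1)[OF A]]] Lp_measurable) (auto simp: W_0)
      also have "\<dots> = c * N (\<lambda>t. complex_of_real (\<phi> A t))"
        using Lp_cmult(2)[OF \<phi>_Lp(1)[OF A], of "complex_of_real c"] c by simp
      also have "\<dots> \<le> c * (\<kappa> * R)" by (intro mult_left_mono \<phi>R c)
      finally show ?thesis by (simp add: sn_0 mult.commute)
    qed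
    then have "vn 0 (fs (Suc k)) \<le> (\<Sum>i\<in>(UNIV::'m set). \<kappa> * R * c)"
      unfolding vn_eq by (intro sum_mono)
    then show ?thesis by (simp add: c_def mult_ac)
  qed
  have expS: "(\<lambda>k. ?H * (?\<rho> ^ k / fact k)) sums (?H * exp ?\<rho>)"
    using sums_mult[OF exp_converges[of ?\<rho>], of ?H] by (simp add: divide_inverse mult.commute)
  have sumSuc: "summable (\<lambda>k. vn 0 (fs (Suc k)))"
    by (rule summable_comparison_test'[OF sums_summable[OF expS], of 0]) (use vfs in simp)
  then have sumfs: "summable (\<lambda>k. vn 0 (fs k))" using summable_Suc_iff[of "\<lambda>k. vn 0 (fs k)"] by simp
  have "(\<Sum>k. vn 0 (fs (Suc k))) \<le> ?H * exp ?\<rho>"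
    using suminf_le[OF vfs sumSuc sums_summable[OF expS]] sums_unique[OF expS] by simp
  then have total: "(\<Sum>k. vn 0 (fs k)) \<le> vn 0 f + ?H * exp ?\<rho>"
    using suminf_split_head[OF sumfs] by (simp add: fs_def)
  define y where "y k = Iv r (fs k)" for k
  have y: "y k \<in> Wv (0 + r)" "vn (0 + r) (y k) \<le> KI ^ r * vn 0 (fs k)" for k
    unfolding y_def by (rule Iv_W[OF fs])+
  have sumKI: "summable (\<lambda>k. KI ^ r * vn 0 (fs k))" by (rule summable_mult[OF sumfs])
  have sumy: "summable (\<lambda>k. vn (0 + r) (y k))"
    by (rule summable_comparison_test'[OF sumKI, of 0]) (use y(2) in simp)
  obtain Y where Y: "Y \<in> Wv (0 + r)" and lim: "(\<lambda>k. vn (0 + r) (\<lambda>t. Y t - (\<Sum>j<k. y j t))) \<longlonglongrightarrow> 0"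
    using Wv_complete[of y "0 + r", OF y(1) sumy] by blast
  define S where "S k t = (\<Sum>j<k. y j t)" for k t
  have S_Suc: "S (Suc k) = (\<lambda>t. S k t + y k t)" for k by (simp add: S_def fun_eq_iff)
  have S: "S k \<in> Wv (0 + r)" "vn (0 + r) (S k) \<le> (\<Sum>j<k. vn (0 + r) (y j))" for k
    unfolding S_def using Wv_sum[of "{..<k}" y "0 + r"] y(1) by auto
  have YS: "(\<lambda>t. Y t - S k t) \<in> Wv (0 + r)" for k by (rule Wv_diff(1)[OF Y S(1)])
  have lim: "(\<lambda>k. vn (0 + r) (\<lambda>t. Y t - S k t)) \<longlonglongrightarrow> 0" using lim by (simp add: S_def)
  have LS: "AE t in M. L A (S k) t = f t - fs k t" for k
  proof (induction k)
    case 0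
    have "S 0 = (\<lambda>_. 0)" by (simp add: S_def fun_eq_iff)
    then show ?case using z.L_zero by (simp add: fs_def)
  next
    case (Suc k)
    have "AE t in M. dv r (y k) t = fs k t" unfolding y_def by (rule dv_Iv_top[OF fs])
    with Suc z.L_add[OF S(1) y(1), of A k k] show ?case
      unfolding S_Suc by eventually_elim (simp add: L_def fs_Suc y_def)
  qed
  have dS: "dv s (S k) a = 0" if "s < r" for s k
  proof (induction k)
    case 0
    have "S 0 = (\<lambda>_. 0)" by (simp add: S_def fun_eq_iff)
    then show ?case using z.dv_zero[OF that, of a] ab by simp
  next
    case (Suc k)
    then show ?case
      using z.dv_add[OF S(1) y(1) that, of a k 1 k] ab dv_Iv_a[OF fs that] unfolding S_Suc y_def by simp
  qed
  \<comment> \<open>Cauchy data are continuous in the norm by the sup bound, so they stay zero in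
    the limit.\<close>
  have data: "dv s Y a = 0" if s: "s < r" for s
  proof -
    have "norm (dv s Y a $ i) \<le> 0" for i
    proof (rule LIMSEQ_le_const)
      show "(\<lambda>k. KS * vn (0 + r) (\<lambda>t. Y t - S k t)) \<longlonglongrightarrow> 0"
        using tendsto_mult[OF tendsto_const lim, of KS] by simp
      have "norm (dv s Y a $ i) \<le> KS * vn (0 + r) (\<lambda>t. Y t - S k t)" for k
      proof -
        have "dv s (\<lambda>t. Y t - S k t) a = dv s Y a"
          using z.dv_diff[OF Y S(1) s, of a k] dS[OF s] ab by simp
        then show ?thesis using z.dv_bound[OF YS s, of a k i] ab by (simp only:) simp
      qed
      then show "\<exists>N. \<forall>k\<ge>N. norm (dv s Y a $ i) \<le> KS * vn (0 + r) (\<lambda>t. Y t - S k t)" by blast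
    qed
    then show ?thesis by (simp add: vec_eq_iff)
  qed
  let ?e = "\<lambda>t. L A Y t - f t"
  have e: "?e \<in> Wv 0" by (rule Wv_diff(1)[OF z.L_W(1)[OF A Y] f])
  \<comment> \<open>Up to a null set the defect of Y is L A (Y - S k) - fs k; the first term
    vanishes in the limit by boundedness of L A, the second as a term of a summable series.\<close>
  have "vn 0 ?e \<le> 0"
  proof (rule LIMSEQ_le_const)
    have "(\<lambda>k. (1 + KM 0 * z.an A) * vn (0 + r) (\<lambda>t. Y t - S k t) + vn 0 (fs k)) \<longlonglongrightarrow> (1 + KM 0 * z.an A) * 0 + 0"
      by (intro tendsto_add tendsto_mult tendsto_const lim summable_LIMSEQ_zero sumfs)
    then show "(\<lambda>k. (1 + KM 0 * z.an A) * vn (0 + r) (\<lambda>t. Y t - S k t) + vn 0 (fs k)) \<longlonglongrightarrow> 0" by simp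
    have "vn 0 ?e \<le> (1 + KM 0 * z.an A) * vn (0 + r) (\<lambda>t. Y t - S k t) + vn 0 (fs k)" for k
    proof -
      let ?d = "L A (\<lambda>t. Y t - S k t)"
      note d = z.L_W[OF A YS[of k]]
      have "AE t in M. ?e t = ?d t - fs k t"
        using LS[of k] z.L_diff[OF Y S(1), of A k] by eventually_elim simp
      then have "vn 0 ?e = vn 0 (\<lambda>t. ?d t - fs k t)"
        using vn_AE_cong[OF e Wv_diff(1)[OF d(1) fs]] by simp
      also have "\<dots> \<le> vn 0 ?d + vn 0 (fs k)" by (rule Wv_diff(2)[OF d(1) fs])
      finally show ?thesis using d(2) by simp
    qed
    then show "\<exists>N. \<forall>k\<ge>N. vn 0 ?e \<le> (1 + KM 0 * z.an A) * vn (0 + r) (\<lambda>t. Y t - S k t) + vn 0 (fs k)" by blast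
  qed
  then have "AE t in M. ?e t = 0" by (intro vn_eq_0_AE[OF e] antisym) auto
  then have LY: "AE t in M. L A Y t = f t" by simp
  have "vn (0 + r) Y \<le> KI ^ r * (vn 0 f + ?H * exp ?\<rho>)"
  proof (rule LIMSEQ_le_const)
    show "(\<lambda>k. vn (0 + r) (\<lambda>t. Y t - S k t) + KI ^ r * (vn 0 f + ?H * exp ?\<rho>)) \<longlonglongrightarrow> KI ^ r * (vn 0 f + ?H * exp ?\<rho>)"
      using tendsto_add[OF lim tendsto_const] by simp
    have "vn (0 + r) Y \<le> vn (0 + r) (\<lambda>t. Y t - S k t) + KI ^ r * (vn 0 f + ?H * exp ?\<rho>)" for k
    proof -
      have "vn (0 + r) (S k) \<le> (\<Sum>j<k. KI ^ r * vn 0 (fs j))"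
        by (rule order_trans[OF S(2) sum_mono]) (rule y(2))
      also have "\<dots> = KI ^ r * (\<Sum>j<k. vn 0 (fs j))" by (simp add: sum_distrib_left)
      also have "\<dots> \<le> KI ^ r * (vn 0 f + ?H * exp ?\<rho>)"
        using KI_ge_1 by (intro mult_left_mono order_trans[OF sum_le_suminf[OF sumfs] total]) auto
      finally show ?thesis using vn_triangle[OF Y S(1), of k] by linarith
    qed
    then show "\<exists>N. \<forall>k\<ge>N. vn (0 + r) Y \<le> vn (0 + r) (\<lambda>t. Y t - S k t) + KI ^ r * (vn 0 f + ?H * exp ?\<rho>)" by blast
  qed
  then have "vn r Y \<le> Kbase CARD('m) R * vn 0 f" by (simp add: Kbase_def algebra_simps)
  with Y data LY show ?thesis by auto
qed

section \<open>Bootstrapping from L_p to the full order\<close>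

text \<open>The derivatives of y of order below r lie in W^(k+1), as do the coefficients, and this
  space is an algebra. Hence \<open>Q A y\<close> is one order smoother than dv r y, which is only
  known to be in W^k.\<close>

lemma Q_boot:
  assumes A: "\<forall>l\<in>{1..r}. A (r - l) \<in> Wm (Suc k)" and y: "y \<in> Wv (k + r)"
  shows "Q A y \<in> Wv (Suc k)"
    "vn (Suc k) (Q A y) \<le> (KS + 2 * KM k) * (\<Sum>l=1..r. mn (Suc k) (A (r - l))) * vn (k + r) y"
proof -
  let ?C = "KS + 2 * KM k"
  have C: "?C \<ge> 0" using KS_nonneg KM_nonneg[of k] by simp
  have *: "(\<lambda>t. A (r - l) t *v dv (r - l) y t) \<in> Wv (Suc k)"
    "vn (Suc k) (\<lambda>t. A (r - l) t *v dv (r - l) y t) \<le> ?C * mn (Suc k) (A (r - l)) * vn (k + r) y" if l: "l \<in> {1..r}" for l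
  proof -
    have y': "y \<in> Wv (Suc k + (r - l))" "vn (Suc k + (r - l)) y \<le> vn (k + r) y"
      using Wv_mono[OF _ y, of "Suc k + (r - l)"] l by auto
    note d = dv_W[OF y'(1)]
    show "(\<lambda>t. A (r - l) t *v dv (r - l) y t) \<in> Wv (Suc k)"
      by (rule matvec_algebra(1)[OF bspec[OF A l] d(1)])
    have "vn (Suc k) (\<lambda>t. A (r - l) t *v dv (r - l) y t) \<le> ?C * mn (Suc k) (A (r - l)) * vn (Suc k) (dv (r - l) y)"
      by (rule matvec_algebra(2)[OF bspec[OF A l] d(1)])
    also have "\<dots> \<le> ?C * mn (Suc k) (A (r - l)) * vn (k + r) y"
      using C by (intro mult_left_mono order_trans[OF d(2) y'(2)]) auto
    finally show "vn (Suc k) (\<lambda>t. A (r - l) t *v dv (r - l) y t) \<le> ?C * mn (Suc k) (A (r - l)) * vn (k + r) y" .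
  qed
  have **: "Q A y \<in> Wv (Suc k) \<and> vn (Suc k) (Q A y) \<le> (\<Sum>l=1..r. vn (Suc k) (\<lambda>t. A (r - l) t *v dv (r - l) y t))"
    unfolding Q_def[abs_def] using * by (intro Wv_sum) auto
  then show "Q A y \<in> Wv (Suc k)" by blast
  have "(\<Sum>l=1..r. vn (Suc k) (\<lambda>t. A (r - l) t *v dv (r - l) y t)) \<le> (\<Sum>l=1..r. ?C * mn (Suc k) (A (r - l)) * vn (k + r) y)"
    using * by (intro sum_mono) auto
  also have "\<dots> = ?C * (\<Sum>l=1..r. mn (Suc k) (A (r - l))) * vn (k + r) y"
    by (simp add: sum_distrib_left sum_distrib_right)
  finally show "vn (Suc k) (Q A y) \<le> ?C * (\<Sum>l=1..r. mn (Suc k) (A (r - l))) * vn (k + r) y" using ** by linarith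
qed

lemma Wv_lift:
  assumes "y \<in> Wv r" "v \<in> Wv m" "AE t in M. dv r y t = v t"
  shows "y \<in> Wv (m + r)" "vn (m + r) y \<le> vn r y + vn m v"
proof -
  have AE: "AE t in M. nth_deriv_on a b r (\<lambda>t. y t $ i) t = v t $ i" for i
    using assms(3) by (auto simp: AE_vec_iff)
  note * = W_lift[OF WvD[OF assms(1)] WvD[OF assms(2)] AE]
  show "y \<in> Wv (m + r)" using * r_ge_1 by (auto simp: Wv_iff)
  show "vn (m + r) y \<le> vn r y + vn m v"
    unfolding vn_eq sum.distrib[symmetric] using * r_ge_1 by (intro sum_mono) auto
qed

primrec Kboot :: "real \<Rightarrow> nat \<Rightarrow> real" where
  "Kboot R 0 = 1"
| "Kboot R (Suc k) = 1 + (KS + 2 * KM k) * R * Kboot R k"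

lemma Kboot_ge_1: "R \<ge> 0 \<Longrightarrow> Kboot R k \<ge> 1"
proof (induction k)
  case (Suc k)
  then have "(KS + 2 * KM k) * R * Kboot R k \<ge> 0"
    using KS_nonneg KM_nonneg[of k] by (intro mult_nonneg_nonneg) auto
  then show ?case by simp
qed simp

text \<open>The equation reads dv r y = f - Q A y; if y is in W^(k+r), the right-hand side is in
  W^(k+1) and \<open>Wv_lift\<close> raises y by one order. The gain stops at k = n, the order of f
  and of the coefficients. \<open>Kboot\<close> collects the constants of the steps.\<close>

lemma regularity:
  fixes A :: "nat \<Rightarrow> real \<Rightarrow> complex ^ 'm ^ 'm"
  assumes A: "coeffs A" "an A \<le> R" and f: "f \<in> Wv n" and y: "y \<in> Wv r" and eq: "AE t in M. L A y t = f t"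
  shows "k \<le> n \<Longrightarrow> y \<in> Wv (k + r) \<and> vn (k + r) y \<le> Kboot R k * (vn n f + vn r y)"
proof (induction k)
  case 0
  then show ?case using y by simp
next
  case (Suc k)
  have R0: "R \<ge> 0" using A(2) an_nonneg[of A] by linarith
  have IH: "y \<in> Wv (k + r)" "vn (k + r) y \<le> Kboot R k * (vn n f + vn r y)" using Suc by auto
  have Ak: "A (r - l) \<in> Wm (Suc k)" "mn (Suc k) (A (r - l)) \<le> mn n (A (r - l))" if "l \<in> {1..r}" for l
    using Wm_mono[OF Suc.prems] A(1) that by blast+
  have sumA: "(\<Sum>l=1..r. mn (Suc k) (A (r - l))) \<le> R"
    using A(2) unfolding an_def by (intro order_trans[OF sum_mono[OF Ak(2)]])
  have C: "KS + 2 * KM k \<ge> 0" using KS_nonneg KM_nonneg[of k] by simp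
  have "\<forall>l\<in>{1..r}. A (r - l) \<in> Wm (Suc k)" using Ak(1) by blast
  note q = Q_boot[OF this IH(1)]
  note f' = Wv_mono[OF Suc.prems f]
  let ?v = "\<lambda>t. f t - Q A y t"
  note v = Wv_diff[OF f'(1) q(1)]
  have "AE t in M. dv r y t = ?v t" using eq by eventually_elim (simp add: L_def algebra_simps)
  note l = Wv_lift[OF y v(1) this]
  have "vn (Suc k) (Q A y) \<le> (KS + 2 * KM k) * R * (Kboot R k * (vn n f + vn r y))"
    using C R0 sumA IH(2) by (intro order_trans[OF q(2)] mult_mono) (auto intro: sum_nonneg)
  then have "vn (Suc k + r) y \<le> vn r y + vn n f + (KS + 2 * KM k) * R * (Kboot R k * (vn n f + vn r y))"
    using l(2) v(2) f'(2) by linarith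
  then show ?case using l(1) by (simp add: algebra_simps)
qed

definition KL :: "nat \<Rightarrow> real \<Rightarrow> real" where
  "KL d R = Kboot R n * (1 + Kbase d R)"

lemma zero_data_solvable:
  fixes A :: "nat \<Rightarrow> real \<Rightarrow> complex ^ 'm ^ 'm"
  assumes A: "coeffs A" "an A \<le> R" and f: "f \<in> Wv n"
  shows "\<exists>y\<in>Wv (n + r). (\<forall>s<r. dv s y a = 0) \<and> (AE t in M. L A y t = f t) \<and> vn (n + r) y \<le> KL CARD('m) R * vn n f"
proof -
  have R0: "R \<ge> 0" using A(2) an_nonneg[of A] by linarith
  have A0: "A (r - l) \<in> Wm 0" "mn 0 (A (r - l)) \<le> mn n (A (r - l))" if "l \<in> {1..r}" for l
    using Wm_mono[of 0 n] A(1) that by blast+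
  have "(\<Sum>l=1..r. mn 0 (A (r - l))) \<le> R"
    using A(2) unfolding an_def by (intro order_trans[OF sum_mono[OF A0(2)]])
  then obtain y where y: "y \<in> Wv r" "\<forall>s<r. dv s y a = 0" "AE t in M. L A y t = f t"
    and bound: "vn r y \<le> Kbase CARD('m) R * vn 0 f"
    using zero_data_solvable_base[of A R f] A0(1) Wv_mono(1)[OF _ f, of 0] by blast
  have K0: "Kbase CARD('m) R \<ge> 0"
    using ab \<kappa>_nonneg R0 KI_ge_1 by (simp add: Kbase_def)
  have "vn r y \<le> Kbase CARD('m) R * vn n f"
    using bound K0 Wv_mono(2)[OF _ f, of 0] by (meson le0 mult_left_mono order_trans)
  then have "Kboot R n * (vn n f + vn r y) \<le> Kboot R n * (vn n f + Kbase CARD('m) R * vn n f)"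
    using Kboot_ge_1[OF R0, of n] by (intro mult_left_mono) auto
  also have "\<dots> = KL CARD('m) R * vn n f" by (simp add: KL_def algebra_simps)
  finally show ?thesis using regularity[OF A f y(1,3), of n] y by fastforce
qed

text \<open>The bound is known for the solution that the Neumann series constructs; uniqueness
  transfers it to every y with zero data.\<close>

lemma zero_data_estimate:
  fixes A :: "nat \<Rightarrow> real \<Rightarrow> complex ^ 'm ^ 'm"
  assumes A: "coeffs A" "an A \<le> R" and y: "y \<in> Wv (n + r)" "\<And>s. s < r \<Longrightarrow> dv s y a = 0"
  shows "vn (n + r) y \<le> KL CARD('m) R * vn n (L A y)"
proof -
  have Ly: "L A y \<in> Wv n" by (rule L_W(1)[OF A(1) y(1)])
  obtain z where z: "z \<in> Wv (n + r)" "\<And>s. s < r \<Longrightarrow> dv s z a = 0" "AE t in M. L A z t = L A y t"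
    and bound: "vn (n + r) z \<le> KL CARD('m) R * vn n (L A y)"
    using zero_data_solvable[OF A Ly] by blast
  have A0: "\<forall>l\<in>{1..r}. A (r - l) \<in> Wm 0" using Wm_mono(1)[of 0 n] A(1) by blast
  have "y t - z t = 0" if t: "t \<in> {a..b}" for t
  proof (rule zero_data_unique[OF A0 _ _ _ t])
    show "(\<lambda>t. y t - z t) \<in> Wv r" using Wv_mono(1)[OF _ Wv_diff(1)[OF y(1) z(1)], of r] by simp
    show "dv s (\<lambda>t. y t - z t) a = 0" if "s < r" for s
      using dv_diff[OF y(1) z(1) that, of a] y(2) z(2) that ab by simp
    show "AE t in M. L A (\<lambda>t. y t - z t) t = 0"
      using L_diff[OF y(1) z(1), of A] z(3) by eventually_elim simp
  qed
  then have "vn (n + r) y = vn (n + r) z"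
    by (intro Wv_cong(2)[OF z(1)] eqvI) (simp add: eq_iff_diff_eq_0[symmetric])
  then show ?thesis using bound by simp
qed

end

context interval_Lp
begin

lemma Wv_scaleR:
  assumes "y \<in> Wv l"
  shows "(\<lambda>t. c *\<^sub>R y t) \<in> Wv l" "vn l (\<lambda>t. c *\<^sub>R y t) = \<bar>c\<bar> * vn l y"
  using Wv_cmult[OF assms, of "complex_of_real c"] by (simp_all add: of_real_smult)

subsection \<open>Uniform boundedness\<close>

context
  fixes l :: nat and T :: "(real \<Rightarrow> complex ^ 'm) \<Rightarrow> complex ^ 'k"
  assumes T: "continuous_linear_operator a b p l T"
begin

lemma clo_lin:
  assumes "y \<in> Wv l" "z \<in> Wv l"
  shows "T (\<lambda>t. y t + c *s z t) = T y + c *s T z"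
  using T assms Wv_cmult(1)[OF assms(2), of c] unfolding continuous_linear_operator_def by simp

lemma clo_scale: "y \<in> Wv l \<Longrightarrow> T (\<lambda>t. c *s y t) = c *s T y"
  using T unfolding continuous_linear_operator_def by blast

lemma clo_scaleR: "y \<in> Wv l \<Longrightarrow> T (\<lambda>t. c *\<^sub>R y t) = c *\<^sub>R T y"
  using clo_scale[of y "complex_of_real c"] by (simp add: of_real_smult)

lemma clo_diff:
  assumes "y \<in> Wv l" "z \<in> Wv l"
  shows "T (\<lambda>t. y t - z t) = T y - T z"
  using clo_lin[OF assms, of "-1"] by simp

lemma clo_add:
  assumes "y \<in> Wv l" "z \<in> Wv l"
  shows "T (\<lambda>t. y t + z t) = T y + T z"
  using clo_lin[OF assms, of 1] by simp

lemma clo_zero: "T (\<lambda>_. 0) = 0"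
  using clo_diff[OF Wv_zero(1) Wv_zero(1)] by simp

lemma clo_sum:
  assumes "finite I" "\<And>i. i \<in> I \<Longrightarrow> f i \<in> Wv l"
  shows "T (\<lambda>t. \<Sum>i\<in>I. q i *s f i t) = (\<Sum>i\<in>I. q i *s T (f i))"
  using assms
proof (induction I)
  case empty
  then show ?case using clo_zero by simp
next
  case (insert i I)
  have S: "(\<lambda>t. \<Sum>i\<in>I. q i *s f i t) \<in> Wv l"
    using Wv_sum[of I "\<lambda>i t. q i *s f i t" l] insert Wv_cmult(1) by blast
  have fi: "f i \<in> Wv l" using insert.prems by blast
  show ?case using clo_lin[OF S fi, of "q i"] insert by (simp add: add.commute)
qed

lemma clo_bounded: "\<exists>K\<ge>0. \<forall>y\<in>Wv l. norm (T y) \<le> K * vn l y"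
proof -
  have "\<forall>y\<in>Wv l. \<forall>e>0. \<exists>d>0. \<forall>z\<in>Wv l. vn l (\<lambda>t. z t - y t) < d \<longrightarrow> dist (T z) (T y) < e"
    using T unfolding continuous_linear_operator_def by (elim conjE)
  from this[rule_format, OF Wv_zero(1) zero_less_one] obtain d where d: "d > 0" "\<And>z. z \<in> Wv l \<Longrightarrow> vn l z < d \<Longrightarrow> norm (T z) < 1"
    by (auto simp: clo_zero)
  have "norm (T y) \<le> 2 / d * vn l y" if y: "y \<in> Wv l" for y
  proof (rule field_le_epsilon)
    fix e :: real assume "e > 0"
    \<comment> \<open>Positive even if the norm of y vanishes, so that y can be rescaled into the
      ball of radius d.\<close>
    define s where "s = vn l y + e * d / 2"
    have s: "s > 0" "vn l y < s" unfolding s_def using \<open>e > 0\<close> d(1) by (auto intro: add_nonneg_pos)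
    have "vn l (\<lambda>t. (d / s) *\<^sub>R y t) = d * (vn l y / s)"
      using Wv_scaleR(2)[OF y, of "d / s"] d s by simp
    also have "\<dots> < d * 1" using d s by (intro mult_strict_left_mono) auto
    finally have "norm (T (\<lambda>t. (d / s) *\<^sub>R y t)) < 1" using d(2) Wv_scaleR(1)[OF y] by simp
    then have "d / s * norm (T y) < 1" using clo_scaleR[OF y, of "d / s"] d s by simp
    then have "norm (T y) < s / d" using d s by (simp add: field_simps)
    also have "\<dots> \<le> 2 / d * vn l y + e"
    proof -
      have "vn l y \<le> 2 * vn l y" by simp
      then show ?thesis unfolding s_def using d \<open>e > 0\<close> by (simp add: field_simps)
    qed
    finally show "norm (T y) \<le> 2 / d * vn l y + e" by simp
  qed
  then show ?thesis using d(1) by (intro exI[of _ "2 / d"]) auto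
qed

lemma clo_cong:
  assumes "y \<in> Wv l" "z \<in> Wv l" "\<And>t. t \<in> {a..b} \<Longrightarrow> y t = z t"
  shows "T y = T z"
proof -
  obtain K where K: "\<And>y. y \<in> Wv l \<Longrightarrow> norm (T y) \<le> K * vn l y" using clo_bounded by blast
  have "vn l (\<lambda>t. y t - z t) = vn l (\<lambda>_. 0 :: complex ^ 'm)"
    using assms(3) by (intro Wv_cong(2)[OF Wv_zero(1)] eqvI) simp
  then have "norm (T (\<lambda>t. y t - z t)) \<le> 0"
    using K[OF Wv_diff(1)[OF assms(1,2)]] by (simp add: Wv_zero(2))
  then show ?thesis using clo_diff[OF assms(1,2)] by simp
qed

text \<open>The supremum over the unit ball need not be attained, but some v reaches two thirds of
  it. The factor 3 / 2 is tuned to the ratio 1 / 3 of the gliding hump.\<close>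

lemma clo_nearly_attained:
  "\<exists>v\<in>Wv l. vn l v \<le> 1 \<and> (\<forall>y\<in>Wv l. norm (T y) \<le> 3 / 2 * norm (T v) * vn l y)"
proof -
  obtain K where K: "K \<ge> 0" "\<And>y. y \<in> Wv l \<Longrightarrow> norm (T y) \<le> K * vn l y" using clo_bounded by blast
  define V where "V = {norm (T y) | y. y \<in> Wv l \<and> vn l y \<le> 1}"
  have bdd: "bdd_above V"
  proof (rule bdd_aboveI)
    fix x assume "x \<in> V"
    then obtain y where y: "x = norm (T y)" "y \<in> Wv l" "vn l y \<le> 1" by (auto simp: V_def)
    have "norm (T y) \<le> K * vn l y" using K(2) y by blast
    also have "\<dots> \<le> K * 1" using K(1) y by (intro mult_left_mono)
    finally show "x \<le> K" using y by simp
  qed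
  have V0: "0 \<in> V" 
    unfolding V_def mem_Collect_eq by (rule exI[of _ "\<lambda>_. 0"]) (simp add: clo_zero Wv_zero)
  have le: "norm (T y) \<le> Sup V * vn l y" if y: "y \<in> Wv l" for y
  proof (cases "vn l y = 0")
    case True
    then show ?thesis using K(2)[OF y] by simp
  next
    case False
    then have pos: "vn l y > 0" using vn_nonneg[of l y] by linarith
    have "norm (T (\<lambda>t. (1 / vn l y) *\<^sub>R y t)) \<in> V"
      unfolding V_def mem_Collect_eq using Wv_scaleR[OF y, of "1 / vn l y"] pos
      by (intro exI[of _ "\<lambda>t. (1 / vn l y) *\<^sub>R y t"]) simp
    then have "norm (T (\<lambda>t. (1 / vn l y) *\<^sub>R y t)) \<le> Sup V" using bdd by (rule cSup_upper)
    then have "1 / vn l y * norm (T y) \<le> Sup V" using clo_scaleR[OF y, of "1 / vn l y"] pos by simp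
    then show ?thesis using pos by (simp add: field_simps)
  qed
  have "Sup V \<ge> 0" using cSup_upper[OF V0 bdd] .
  then consider "Sup V = 0" | "2 / 3 * Sup V < Sup V" by linarith
  then show ?thesis
  proof cases
    case 1
    then show ?thesis using le by (intro bexI[of _ "\<lambda>_. 0"]) (auto simp: Wv_zero clo_zero)
  next
    case 2
    then obtain x where "x \<in> V" "2 / 3 * Sup V < x" using less_cSupE[of "2 / 3 * Sup V" V] V0 by blast
    then obtain v where v: "v \<in> Wv l" "vn l v \<le> 1" "Sup V \<le> 3 / 2 * norm (T v)" by (auto simp: V_def)
    have "norm (T y) \<le> 3 / 2 * norm (T v) * vn l y" if "y \<in> Wv l" for y
      using v(3) by (intro order_trans[OF le[OF that]] mult_right_mono) auto
    with v show ?thesis by blast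
  qed
qed

end

text \<open>Sokal's gliding hump: the signs are chosen so that the \<open>j\<close>-th summand is not cancelled
  by the preceding ones when \<open>T j\<close> is applied, and the later summands are too small to matter.\<close>

lemma uniform_boundedness:
  fixes T :: "nat \<Rightarrow> (real \<Rightarrow> complex ^ 'm) \<Rightarrow> complex ^ 'k"
  assumes T: "\<And>k. continuous_linear_operator a b p l (T k)"
    and bdd: "\<And>y. y \<in> Wv l \<Longrightarrow> \<exists>C. \<forall>k. norm (T k y) \<le> C"
  shows "\<exists>C. \<forall>k. \<forall>y\<in>Wv l. norm (T k y) \<le> C * vn l y"
proof (rule ccontr)
  assume unb: "\<not> ?thesis"
  have "\<forall>k. \<exists>v. v \<in> Wv l \<and> vn l v \<le> 1 \<and> (\<forall>y\<in>Wv l. norm (T k y) \<le> 3 / 2 * norm (T k v) * vn l y)"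
    using clo_nearly_attained[OF T] by blast
  from choice[OF this] obtain v where v: "\<And>k. v k \<in> Wv l" "\<And>k. vn l (v k) \<le> 1"
    "\<And>k y. y \<in> Wv l \<Longrightarrow> norm (T k y) \<le> 3 / 2 * norm (T k (v k)) * vn l y" by blast
  \<comment> \<open>The growth 4^j outruns the damping (1/3)^j of the summands, so that the j-th
    hump has size at least (4/3)^j.\<close>
  have "\<exists>k. norm (T k (v k)) \<ge> 4 ^ j" for j
  proof (rule ccontr)
    assume "\<not> ?thesis"
    then have small: "norm (T k (v k)) \<le> 4 ^ j" for k by (meson linear not_le)
    have "norm (T k y) \<le> (3 / 2 * 4 ^ j) * vn l y" if "y \<in> Wv l" for k y
      using small by (intro order_trans[OF v(3)[OF that]] mult_right_mono mult_left_mono) auto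
    then show False using unb by blast
  qed
  then have "\<forall>j. \<exists>k. norm (T k (v k)) \<ge> 4 ^ j" by blast
  from choice[OF this] obtain h where h: "\<And>j. norm (T (h j) (v (h j))) \<ge> 4 ^ j" by blast
  define S where "S j = T (h j)" for j
  have S: "continuous_linear_operator a b p l (S j)" for j unfolding S_def by (rule T)
  define w where "w j = (\<lambda>t. ((1/3) ^ j) *\<^sub>R v (h j) t)" for j
  have w: "w j \<in> Wv l" "vn l (w j) \<le> (1/3) ^ j" "norm (S j (w j)) = (1/3) ^ j * norm (S j (v (h j)))" for j
  proof -
    show "w j \<in> Wv l" unfolding w_def by (rule Wv_scaleR(1)[OF v(1)])
    show "vn l (w j) \<le> (1/3) ^ j"
      unfolding w_def Wv_scaleR(2)[OF v(1)] using v(2)[of "h j"] by (simp add: mult_left_le)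
    show "norm (S j (w j)) = (1/3) ^ j * norm (S j (v (h j)))"
      unfolding w_def clo_scaleR[OF S v(1)] by simp
  qed
  define x where "x = rec_nat (\<lambda>_. 0) (\<lambda>j x. if norm (S j (w j)) \<le> norm (S j (\<lambda>t. x t + w j t))
      then (\<lambda>t. x t + w j t) else (\<lambda>t. x t - w j t))"
  have x_0: "x 0 = (\<lambda>_. 0)" by (simp add: x_def)
  have x_Suc: "x (Suc j) = (if norm (S j (w j)) \<le> norm (S j (\<lambda>t. x j t + w j t))
      then (\<lambda>t. x j t + w j t) else (\<lambda>t. x j t - w j t))" for j
    by (simp add: x_def)
  have x: "x j \<in> Wv l" for j
    by (induction j) (auto simp: x_0 x_Suc Wv_zero intro!: Wv_add Wv_diff w)
  have hump: "norm (S j (w j)) \<le> norm (S j (x (Suc j)))" for j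
  proof (cases "norm (S j (w j)) \<le> norm (S j (\<lambda>t. x j t + w j t))")
    case False
    have "2 * norm (S j (w j)) = norm ((S j (x j) + S j (w j)) - (S j (x j) - S j (w j)))"
      by (simp add: scaleR_2[symmetric])
    also have "\<dots> \<le> norm (S j (\<lambda>t. x j t + w j t)) + norm (S j (\<lambda>t. x j t - w j t))"
      unfolding clo_add[OF S x w(1)] clo_diff[OF S x w(1)] by (rule norm_triangle_ineq4)
    finally show ?thesis using False by (simp add: x_Suc)
  qed (simp add: x_Suc)
  define f where "f j = (\<lambda>t. x (Suc j) t - x j t)" for j
  have f: "f j \<in> Wv l" "vn l (f j) \<le> (1/3) ^ j" for j
  proof -
    show "f j \<in> Wv l" unfolding f_def by (intro Wv_diff x)
    have "f j = w j \<or> f j = (\<lambda>t. - w j t)" by (auto simp: f_def x_Suc)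
    then show "vn l (f j) \<le> (1/3) ^ j" using w(2)[of j] Wv_minus(2)[OF w(1)] by auto
  qed
  have sumf: "(\<Sum>j<k. f j t) = x k t" for k t
    by (induction k) (auto simp: x_0 f_def)
  have "summable (\<lambda>j. vn l (f j))"
    by (rule summable_comparison_test'[OF summable_geometric[of "1/3 :: real"], of 0]) (use f in auto)
  from Wv_complete[of f, OF f(1) this] obtain g where g: "g \<in> Wv l"
    and lim: "(\<lambda>k. vn l (\<lambda>t. g t - x k t)) \<longlonglongrightarrow> 0" by (auto simp: sumf)
  \<comment> \<open>The right-hand side is the exact geometric sum of the i summands after the j-th,
    so that the induction closes; (1/3)^j / 2 is its limit.\<close>
  have step: "vn l (\<lambda>t. x (Suc j + i) t - x (Suc j) t) \<le> (1/3) ^ j / 2 - (1/3) ^ (j + i) / 2" for i j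
  proof (induction i)
    case 0
    then show ?case by (simp add: Wv_zero(2))
  next
    case (Suc i)
    have "vn l (\<lambda>t. x (Suc j + Suc i) t - x (Suc j) t) = vn l (\<lambda>t. (x (Suc j + i) t - x (Suc j) t) + f (Suc j + i) t)"
      by (simp add: f_def)
    also have "\<dots> \<le> vn l (\<lambda>t. x (Suc j + i) t - x (Suc j) t) + vn l (f (Suc j + i))"
      by (intro Wv_add(2) Wv_diff x f)
    also have "\<dots> \<le> ((1/3) ^ j / 2 - (1/3) ^ (j + i) / 2) + (1/3) ^ (Suc j + i)"
      by (intro add_mono Suc f)
    also have "\<dots> = (1/3) ^ j / 2 - (1/3) ^ (j + Suc i) / 2" by (simp add: field_simps)
    finally show ?case .
  qed
  have tail: "vn l (\<lambda>t. g t - x (Suc j) t) \<le> (1/3) ^ j / 2" for j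
  proof (rule LIMSEQ_le_const)
    show "(\<lambda>i. vn l (\<lambda>t. g t - x (Suc j + i) t) + (1/3) ^ j / 2) \<longlonglongrightarrow> (1/3) ^ j / 2"
      using tendsto_add[OF LIMSEQ_ignore_initial_segment[OF lim, of "Suc j"] tendsto_const, of "(1/3) ^ j / 2"]
      by (simp add: add.commute)
    have "vn l (\<lambda>t. g t - x (Suc j) t) \<le> vn l (\<lambda>t. g t - x (Suc j + i) t) + (1/3) ^ j / 2" for i
    proof -
      have "vn l (\<lambda>t. g t - x (Suc j) t) = vn l (\<lambda>t. (g t - x (Suc j + i) t) + (x (Suc j + i) t - x (Suc j) t))"
        by simp
      also have "\<dots> \<le> vn l (\<lambda>t. g t - x (Suc j + i) t) + vn l (\<lambda>t. x (Suc j + i) t - x (Suc j) t)"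
        by (intro Wv_add(2) Wv_diff x g)
      finally show ?thesis using step[of j i] zero_le_power[of "1/3 :: real" "j + i"] by linarith
    qed
    then show "\<exists>N. \<forall>i\<ge>N. vn l (\<lambda>t. g t - x (Suc j) t) \<le> vn l (\<lambda>t. g t - x (Suc j + i) t) + (1/3) ^ j / 2" by blast
  qed
  \<comment> \<open>The tail costs at most 3 / 2 times 1 / 2, that is three quarters of the hump,
    and one quarter survives.\<close>
  have big: "(4/3) ^ j / 4 \<le> norm (S j g)" for j
  proof -
    let ?\<tau> = "norm (S j (v (h j)))"
    have "norm (S j (\<lambda>t. g t - x (Suc j) t)) \<le> 3 / 2 * ?\<tau> * vn l (\<lambda>t. g t - x (Suc j) t)"
      unfolding S_def by (intro v(3) Wv_diff g x)
    also have "\<dots> \<le> 3 / 2 * ?\<tau> * ((1/3) ^ j / 2)" by (intro mult_left_mono tail) auto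
    finally have "norm (S j g - S j (x (Suc j))) \<le> 3 / 4 * ((1/3) ^ j * ?\<tau>)"
      unfolding clo_diff[OF S g x] by (simp add: mult_ac)
    moreover have "(1/3) ^ j * ?\<tau> \<le> norm (S j (x (Suc j)))" using hump[of j] w(3)[of j] by simp
    moreover have "norm (S j (x (Suc j))) \<le> norm (S j g) + norm (S j g - S j (x (Suc j)))"
      using norm_triangle_sub[of "S j (x (Suc j))" "S j g"] by (simp add: norm_minus_commute)
    moreover have "(1/3) ^ j * 4 ^ j \<le> (1/3) ^ j * ?\<tau>" using h[of j] by (intro mult_left_mono) (auto simp: S_def)
    moreover have "(1/3) ^ j * 4 ^ j = (4/3 :: real) ^ j" by (simp add: power_mult_distrib[symmetric])
    ultimately show ?thesis by linarith
  qed
  obtain C where C: "\<And>k. norm (T k g) \<le> C" using bdd[OF g] by blast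
  obtain j where "4 * C < (4/3 :: real) ^ j" using real_arch_pow[of "4/3" "4 * C"] by auto
  moreover have "norm (S j g) \<le> C" unfolding S_def by (rule C)
  ultimately show False using big[of j] by linarith
qed

text \<open>If no bound held near \<open>\<mu>\<^sub>0\<close>, parameters m k within distance 1 /
  (k + 1) would violate the bound with constant k. Along this convergent sequence the operators are
  pointwise bounded, so \<open>uniform_boundedness\<close> contradicts the choice. Some m k may
  equal \<open>\<mu>\<^sub>0\<close>, so limits are taken along \<open>nhds\<close>.\<close>

lemma locally_bounded:
  fixes B :: "'p::metric_space \<Rightarrow> (real \<Rightarrow> complex ^ 'm) \<Rightarrow> complex ^ 'k"
  assumes B: "\<And>\<mu>. continuous_linear_operator a b p l (B \<mu>)"
    and lim: "\<And>y. y \<in> Wv l \<Longrightarrow> ((\<lambda>\<mu>. B \<mu> y) \<longlongrightarrow> B \<mu>\<^sub>0 y) (at \<mu>\<^sub>0)"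
  shows "\<exists>C\<ge>0. \<forall>\<^sub>F \<mu> in nhds \<mu>\<^sub>0. \<forall>y\<in>Wv l. norm (B \<mu> y) \<le> C * vn l y"
proof (rule ccontr)
  assume neg: "\<not> ?thesis"
  have *: "\<exists>\<mu> y. dist \<mu> \<mu>\<^sub>0 < 1 / real (Suc k) \<and> y \<in> Wv l \<and> norm (B \<mu> y) > real k * vn l y" for k
  proof (rule ccontr)
    assume "\<not> ?thesis"
    then have "\<forall>\<^sub>F \<mu> in nhds \<mu>\<^sub>0. \<forall>y\<in>Wv l. norm (B \<mu> y) \<le> real k * vn l y"
      unfolding eventually_nhds_metric
      by (intro exI[of _ "1 / real (Suc k)"] conjI allI impI ballI) (simp, meson not_less)
    then show False using neg of_nat_0_le_iff[of k] by blast
  qed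
  have "\<forall>k. \<exists>\<mu> y. dist \<mu> \<mu>\<^sub>0 < 1 / real (Suc k) \<and> y \<in> Wv l \<and> norm (B \<mu> y) > real k * vn l y"
    by (rule allI) (rule *)
  from choice[OF this] obtain m
    where "\<forall>k. \<exists>y. dist (m k) \<mu>\<^sub>0 < 1 / real (Suc k) \<and> y \<in> Wv l \<and> norm (B (m k) y) > real k * vn l y" by blast
  from choice[OF this] obtain y where m: "\<And>k. dist (m k) \<mu>\<^sub>0 < 1 / real (Suc k)" and y: "\<And>k. y k \<in> Wv l"
    "\<And>k. norm (B (m k) (y k)) > real k * vn l (y k)" by blast
  have "m \<longlonglongrightarrow> \<mu>\<^sub>0"
  proof -
    have "\<forall>k. norm (dist (m k) \<mu>\<^sub>0) \<le> inverse (real (Suc k))"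
      using less_imp_le[OF m] by (simp add: inverse_eq_divide del: of_nat_Suc)
    from Lim_null_comparison[OF always_eventually[OF this] LIMSEQ_inverse_real_of_nat]
    show ?thesis by (rule tendsto_dist_iff[THEN iffD2])
  qed
  have "\<exists>C. \<forall>k. norm (B (m k) z) \<le> C" if z: "z \<in> Wv l" for z
  proof -
    have "((\<lambda>\<mu>. B \<mu> z) \<longlongrightarrow> B \<mu>\<^sub>0 z) (nhds \<mu>\<^sub>0)"
      using lim[OF z] by (rule tendsto_at_iff_tendsto_nhds[THEN iffD1])
    from filterlim_compose[OF this \<open>m \<longlonglongrightarrow> \<mu>\<^sub>0\<close>] have "Bseq (\<lambda>k. B (m k) z)"
      by (intro convergent_imp_Bseq convergentI)
    then show ?thesis by (auto simp: Bseq_def)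
  qed
  from uniform_boundedness[OF B this] obtain C where C: "\<And>k z. z \<in> Wv l \<Longrightarrow> norm (B (m k) z) \<le> C * vn l z" by blast
  obtain k where k: "C \<le> real k" using real_arch_simple by blast
  have "norm (B (m k) (y k)) \<le> real k * vn l (y k)"
    using k by (intro order_trans[OF C[OF y(1)]] mult_right_mono) auto
  then show False using y(2)[of k] by linarith
qed

subsection \<open>Families of boundary-value problems\<close>

lemma nth_deriv_zero: "t \<in> {a..b} \<Longrightarrow> nth_deriv_on a b s (\<lambda>_. 0 :: complex) t = 0"
proof (induction s)
  case (Suc s)
  have "D (\<lambda>_. 0) t = 0" if "t \<in> {a..b}" for t
    using that by (intro D_eqI has_vector_derivative_const)
  then have "nth_deriv_on a b s (D (\<lambda>_. 0)) t = nth_deriv_on a b s (\<lambda>_. 0) t"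
    using Suc.prems by (intro nth_deriv_on_cong)
  then show ?case using Suc by (simp only: nth_deriv_on_Suc)
qed simp

lemma nth_deriv_pw:
  assumes "t \<in> {a..b}"
  shows "nth_deriv_on a b s (pw j) t = (if s \<le> j then pw (j - s) t else 0)"
  using assms
proof (induction s arbitrary: j)
  case (Suc s)
  show ?case
  proof (cases j)
    case 0
    have "D (pw 0) t = 0" if "t \<in> {a..b}" for t
      by (rule D_eqI[OF that prim_has_derivative[OF prim_pw_0 _ that]]) simp
    then have "nth_deriv_on a b s (D (pw 0)) t = nth_deriv_on a b s (\<lambda>_. 0) t"
      using Suc.prems by (intro nth_deriv_on_cong)
    then show ?thesis using 0 Suc.prems by (simp add: nth_deriv_on_Suc nth_deriv_zero)
  next
    case (Suc i)
    have "D (pw (Suc i)) t = pw i t" if "t \<in> {a..b}" for t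
      by (rule D_eqI[OF that prim_has_derivative[OF prim_pw_Suc continuous_pw that]])
    then have "nth_deriv_on a b s (D (pw (Suc i))) t = nth_deriv_on a b s (pw i) t"
      using Suc.prems by (intro nth_deriv_on_cong)
    then show ?thesis using Suc Suc.IH[OF Suc.prems, of i] by (simp add: nth_deriv_on_Suc)
  qed
qed simp

text \<open>Used twice: as functions with prescribed Cauchy data at a, and as test functions that
  isolate columns of the coefficients.\<close>

definition pv :: "nat \<Rightarrow> 'm \<Rightarrow> real \<Rightarrow> complex ^ 'm" where
  "pv j i t = axis i (pw j t)"

lemma pv_nth: "(\<lambda>t. pv j i t $ k) = (if k = i then pw j else (\<lambda>_. 0))"
  by (auto simp: pv_def axis_def)

lemma pv_W: "pv j i \<in> Wv l"
  by (simp add: Wv_iff pv_nth pw_W W_zero)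

lemma dv_pv:
  assumes "t \<in> {a..b}"
  shows "dv s (pv j i) t = (if s \<le> j then pv (j - s) i t else 0)"
  using assms nth_deriv_pw[OF assms, of s j] nth_deriv_zero[OF assms, of s]
  by (simp add: pv_nth vec_eq_iff) (simp add: pv_def axis_def)

end

locale bvp_family = linear_bvp +
  fixes A :: "nat \<Rightarrow> 'p::metric_space \<Rightarrow> real \<Rightarrow> complex ^ 'm ^ 'm"
    and B :: "'p \<Rightarrow> (real \<Rightarrow> complex ^ 'm) \<Rightarrow> complex ^ 'k"
    and \<mu>\<^sub>0 :: 'p
  assumes card_k: "CARD('k) = r * CARD('m)"
    and A_W: "\<And>\<mu> l. l \<in> {1..r} \<Longrightarrow> A (r - l) \<mu> \<in> sobolev_mat a b p n"
    and B_clo: "\<And>\<mu>. continuous_linear_operator a b p (n + r) (B \<mu>)"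
begin

abbreviation Ap :: "'p \<Rightarrow> nat \<Rightarrow> real \<Rightarrow> complex ^ 'm ^ 'm" where "Ap \<mu> \<equiv> (\<lambda>j. A j \<mu>)"

abbreviation dA :: "'p \<Rightarrow> nat \<Rightarrow> real \<Rightarrow> complex ^ 'm ^ 'm" where
  "dA \<mu> \<equiv> (\<lambda>j t. A j \<mu> t - A j \<mu>\<^sub>0 t)"

abbreviation X :: "(real \<Rightarrow> complex ^ 'm) set" where "X \<equiv> Wv (n + r)"
abbreviation xn :: "(real \<Rightarrow> complex ^ 'm) \<Rightarrow> real" where "xn \<equiv> vn (n + r)"

lemma Ap: "coeffs (Ap \<mu>)"
  using A_W by blast

lemma dA: "coeffs (dA \<mu>)"
  using A_W Wm_diff(1) by blast

lemma an_le: "an (Ap \<mu>) \<le> an (dA \<mu>) + an (Ap \<mu>\<^sub>0)"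
  unfolding an_def sum.distrib[symmetric] by (intro sum_mono Wm_diff(2) A_W)

lemma L_perturb: "L (Ap \<mu>) y t - L (Ap \<mu>\<^sub>0) y t = Q (dA \<mu>) y t"
  by (simp add: L_def Q_diff)

lemmas Q_dA = Q_W[OF dA]

lemma xn_0_imp:
  assumes "y \<in> X" "xn y = 0" "t \<in> {a..b}"
  shows "y t = 0"
proof -
  obtain l where l: "n + r = Suc l" using r_ge_1 by (cases "n + r") auto
  show ?thesis
    using Wv_Suc_AE_eq[of y l "\<lambda>_. 0" t] vn_eq_0_AE[OF assms(1,2)] assms Wv_zero(1)[of "Suc l"] l by simp
qed

text \<open>Since \<open>'k\<close> has \<open>r * CARD('m)\<close> elements, the Cauchy data at \<open>a\<close> of a solution form a vector indexed by \<open>'k\<close>.\<close>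

definition ix :: "'k \<Rightarrow> nat \<times> 'm" where
  "ix = (SOME h. bij_betw h UNIV ({..<r} \<times> UNIV))"

lemma ix: "bij_betw ix UNIV ({..<r} \<times> UNIV)"
proof -
  have "card (UNIV :: 'k set) = card ({..<r} \<times> (UNIV :: 'm set))"
    using card_k by (simp add: card_cartesian_product)
  then have "\<exists>h. bij_betw h (UNIV :: 'k set) ({..<r} \<times> (UNIV :: 'm set))"
    by (intro finite_same_card_bij) auto
  then show ?thesis unfolding ix_def by (rule someI_ex)
qed

lemma ix_less: "fst (ix j) < r"
proof -
  have "ix j \<in> range ix" by simp
  then show ?thesis unfolding bij_betw_imp_surj_on[OF ix] by (simp add: mem_Times_iff)
qed

definition cd :: "(real \<Rightarrow> complex ^ 'm) \<Rightarrow> complex ^ 'k" where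
  "cd y = (\<chi> j. dv (fst (ix j)) y a $ snd (ix j))"

lemma cd_0_imp:
  assumes "cd y = 0" "s < r"
  shows "dv s y a = 0"
proof -
  have "dv s y a $ i = 0" for i
  proof -
    have "(s, i) \<in> range ix" using ix assms(2) by (auto simp: bij_betw_def)
    then obtain j where "ix j = (s, i)" by (metis imageE)
    then show ?thesis using assms(1) by (simp add: cd_def vec_eq_iff) (metis fst_conv snd_conv)
  qed
  then show ?thesis by (simp add: vec_eq_iff)
qed

lemma a_in: "a \<in> {a..b}" using ab by simp

lemma cd_lin:
  assumes "y \<in> X" "z \<in> X"
  shows "cd (\<lambda>t. y t + c *s z t) = cd y + c *s cd z"
proof -
  have *: "dv (fst (ix j)) (\<lambda>t. y t + c *s z t) a = dv (fst (ix j)) y a + c *s dv (fst (ix j)) z a" for j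
    by (rule dv_add[OF assms ix_less a_in])
  show ?thesis unfolding cd_def * by (simp add: vec_eq_iff)
qed

lemma cd_diff: "y \<in> X \<Longrightarrow> z \<in> X \<Longrightarrow> cd (\<lambda>t. y t - z t) = cd y - cd z"
  using cd_lin[of y z "-1"] by simp

lemma cd_zero: "cd (\<lambda>_. 0) = 0"
  using cd_diff[OF Wv_zero(1) Wv_zero(1)] by simp

lemma cd_pv: "cd (pv (fst (ix j)) (snd (ix j))) = axis j 1"
proof -
  have "dv (fst (ix i)) (pv (fst (ix j)) (snd (ix j))) a $ snd (ix i) = (axis j 1 :: complex ^ 'k) $ i" for i
  proof -
    have "i = j" if "fst (ix i) = fst (ix j)" "snd (ix i) = snd (ix j)"
      using ix that by (auto simp: bij_betw_def inj_def prod_eq_iff)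
    then show ?thesis unfolding dv_pv[OF a_in] by (auto simp: pv_def axis_def pw_a)
  qed
  then show ?thesis by (simp add: cd_def vec_eq_iff)
qed

section \<open>Fundamental solutions and solvability for a fixed parameter\<close>

text \<open>A polynomial with the required data, corrected by the zero-data solution that has the
  same image under L.\<close>

lemma fundamental_ex: "\<exists>y\<in>X. cd y = axis j 1 \<and> (AE t in M. L (Ap \<mu>) y t = 0)"
proof -
  let ?P = "pv (fst (ix j)) (snd (ix j))"
  have P: "?P \<in> X" by (rule pv_W)
  obtain z where z: "z \<in> X" "\<forall>s<r. dv s z a = 0" "AE t in M. L (Ap \<mu>) z t = L (Ap \<mu>) ?P t"
    using zero_data_solvable[OF Ap order_refl L_W(1)[OF Ap P]] by blast
  have "cd z = 0" using z(2) ix_less by (simp add: cd_def vec_eq_iff)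
  then have "cd (\<lambda>t. ?P t - z t) = axis j 1" using cd_diff[OF P z(1)] cd_pv by simp
  moreover have "AE t in M. L (Ap \<mu>) (\<lambda>t. ?P t - z t) t = 0"
    using L_diff[OF P z(1), of "Ap \<mu>"] z(3) by eventually_elim simp
  ultimately show ?thesis using Wv_diff(1)[OF P z(1)] by blast
qed

definition \<psi> :: "'p \<Rightarrow> 'k \<Rightarrow> real \<Rightarrow> complex ^ 'm" where
  "\<psi> \<mu> j = (SOME y. y \<in> X \<and> cd y = axis j 1 \<and> (AE t in M. L (Ap \<mu>) y t = 0))"

lemma \<psi>: "\<psi> \<mu> j \<in> X" "cd (\<psi> \<mu> j) = axis j 1" "AE t in M. L (Ap \<mu>) (\<psi> \<mu> j) t = 0"
proof -
  have "\<psi> \<mu> j \<in> X \<and> cd (\<psi> \<mu> j) = axis j 1 \<and> (AE t in M. L (Ap \<mu>) (\<psi> \<mu> j) t = 0)"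
    unfolding \<psi>_def by (rule someI_ex[OF fundamental_ex[unfolded Bex_def]])
  then show "\<psi> \<mu> j \<in> X" "cd (\<psi> \<mu> j) = axis j 1" "AE t in M. L (Ap \<mu>) (\<psi> \<mu> j) t = 0" by auto
qed

lemma combination:
  fixes f :: "'k \<Rightarrow> real \<Rightarrow> complex ^ 'm" and q :: "complex ^ 'k"
  assumes f: "\<And>j. f j \<in> X" "\<And>j. AE t in M. L (Ap \<mu>) (f j) t = 0" and I: "finite I"
  shows "(\<lambda>t. \<Sum>j\<in>I. q $ j *s f j t) \<in> X \<and> (AE t in M. L (Ap \<mu>) (\<lambda>t. \<Sum>j\<in>I. q $ j *s f j t) t = 0)
    \<and> cd (\<lambda>t. \<Sum>j\<in>I. q $ j *s f j t) = (\<Sum>j\<in>I. q $ j *s cd (f j))"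
  using I
proof (induction I)
  case empty
  then show ?case using L_zero[of "Ap \<mu>"] by (simp add: Wv_zero cd_zero)
next
  case (insert j I)
  let ?S = "\<lambda>t. \<Sum>j\<in>I. q $ j *s f j t"
  have S: "?S \<in> X" "AE t in M. L (Ap \<mu>) ?S t = 0" "cd ?S = (\<Sum>j\<in>I. q $ j *s cd (f j))" using insert.IH by auto
  have eq: "(\<lambda>t. \<Sum>j\<in>insert j I. q $ j *s f j t) = (\<lambda>t. ?S t + q $ j *s f j t)"
    using insert.hyps by (simp add: add.commute)
  have "AE t in M. L (Ap \<mu>) (\<lambda>t. ?S t + q $ j *s f j t) t = 0"
    using L_lin[OF S(1) f(1), of "Ap \<mu>" "q $ j" j] S(2) f(2)[of j] by eventually_elim simp
  moreover have "(\<lambda>t. ?S t + q $ j *s f j t) \<in> X" using S(1) f(1) by (intro Wv_add Wv_cmult)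
  moreover have "cd (\<lambda>t. ?S t + q $ j *s f j t) = (\<Sum>j\<in>insert j I. q $ j *s cd (f j))"
    using cd_lin[OF S(1) f(1)] S(3) insert.hyps by (simp add: add.commute)
  ultimately show ?case unfolding eq by blast
qed

definition \<Psi> :: "'p \<Rightarrow> complex ^ 'k \<Rightarrow> real \<Rightarrow> complex ^ 'm" where
  "\<Psi> \<mu> q t = (\<Sum>j\<in>UNIV. q $ j *s \<psi> \<mu> j t)"

lemma \<Psi>: "\<Psi> \<mu> q \<in> X" "AE t in M. L (Ap \<mu>) (\<Psi> \<mu> q) t = 0" "cd (\<Psi> \<mu> q) = q"
proof -
  have "(\<Sum>j\<in>UNIV. q $ j *s cd (\<psi> \<mu> j)) = q"
    by (simp add: \<psi>(2) vec_eq_iff axis_def if_distrib[of "\<lambda>x. _ * x"] cong: if_cong)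
  then show "\<Psi> \<mu> q \<in> X" "AE t in M. L (Ap \<mu>) (\<Psi> \<mu> q) t = 0" "cd (\<Psi> \<mu> q) = q"
    using combination[where f = "\<psi> \<mu>" and q = q and I = UNIV, OF \<psi>(1,3) finite] unfolding \<Psi>_def[abs_def] by simp_all
qed

lemma B_\<Psi>: "B \<nu> (\<Psi> \<mu> q) = (\<Sum>j\<in>UNIV. q $ j *s B \<nu> (\<psi> \<mu> j))"
  unfolding \<Psi>_def[abs_def] by (intro clo_sum[OF B_clo] \<psi>) auto

text \<open>Real linearity is enough: what is drawn from it (injective implies surjective, bounded
  below) concerns finite-dimensional real spaces.\<close>

lemma linear_B_\<Psi>: "linear (\<lambda>q. B \<nu> (\<Psi> \<mu> q))"
  by (rule linearI)
    (simp_all add: B_\<Psi> vec.scale_left_distrib sum.distrib scaleR_sum_right vec_eq_iff sum_component)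

lemma \<Psi>_bound: "\<exists>H\<ge>0. \<forall>q. xn (\<Psi> \<mu> q) \<le> H * norm q"
proof (intro exI conjI allI)
  show "0 \<le> (\<Sum>j\<in>UNIV. xn (\<psi> \<mu> j))" by (simp add: sum_nonneg)
  fix q
  have "xn (\<Psi> \<mu> q) \<le> (\<Sum>j\<in>UNIV. xn (\<lambda>t. q $ j *s \<psi> \<mu> j t))"
    unfolding \<Psi>_def[abs_def] by (rule conjunct2[OF Wv_sum]) (auto intro: Wv_cmult \<psi>)
  also have "\<dots> = (\<Sum>j\<in>UNIV. norm (q $ j) * xn (\<psi> \<mu> j))"
    by (intro sum.cong refl Wv_cmult(2) \<psi>)
  also have "\<dots> \<le> (\<Sum>j\<in>UNIV. norm q * xn (\<psi> \<mu> j))"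
    by (intro sum_mono mult_right_mono Finite_Cartesian_Product.norm_nth_le) auto
  finally show "xn (\<Psi> \<mu> q) \<le> (\<Sum>j\<in>UNIV. xn (\<psi> \<mu> j)) * norm q"
    by (simp add: sum_distrib_left[symmetric] mult.commute)
qed

text \<open>A vector q in the kernel gives a solution of the homogeneous problem, which vanishes,
  and q is recovered from it as its Cauchy data. Surjectivity follows because domain and target have
  the same dimension.\<close>

lemma B_surj:
  assumes inj: "\<And>y. y \<in> X \<Longrightarrow> (AE t in M. L (Ap \<mu>) y t = 0) \<Longrightarrow> B \<mu> y = 0 \<Longrightarrow> xn y = 0"
  shows "inj (\<lambda>q. B \<mu> (\<Psi> \<mu> q))" "surj (\<lambda>q. B \<mu> (\<Psi> \<mu> q))"
proof -
  show inj: "inj (\<lambda>q. B \<mu> (\<Psi> \<mu> q))"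
    unfolding linear_injective_0[OF linear_B_\<Psi>]
  proof (intro allI impI)
    fix q assume "B \<mu> (\<Psi> \<mu> q) = 0"
    then have "xn (\<Psi> \<mu> q) = 0" using inj[OF \<Psi>(1,2)] by simp
    then have z: "\<Psi> \<mu> q t = 0" if "t \<in> {a..b}" for t using xn_0_imp[OF \<Psi>(1)] that by blast
    have "dv s (\<Psi> \<mu> q) a = dv s (\<lambda>_. 0) a" if "s < r" for s
      using dv_cong[of "\<Psi> \<mu> q" "\<lambda>_. 0" a s] z ab by simp
    then have "cd (\<Psi> \<mu> q) = cd (\<lambda>_. 0)" unfolding cd_def using ix_less by simp
    then show "q = 0" by (simp add: \<Psi>(3) cd_zero)
  qed
  show "surj (\<lambda>q. B \<mu> (\<Psi> \<mu> q))"
    by (rule linear_injective_imp_surjective[OF linear_B_\<Psi> inj refl])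
qed

text \<open>The zero-data solution takes care of f; a combination of fundamental solutions then
  corrects the boundary value without disturbing the equation.\<close>

lemma solvable:
  assumes inj: "\<And>y. y \<in> X \<Longrightarrow> (AE t in M. L (Ap \<mu>) y t = 0) \<Longrightarrow> B \<mu> y = 0 \<Longrightarrow> xn y = 0"
    and f: "f \<in> Wv n"
  shows "bvp_unique_solution a b p n r (Ap \<mu>) (B \<mu>) f c"
proof -
  note sol = bvp_solution_iff[where B = "B \<mu>" and c = c, OF Ap f]
  obtain z where z: "z \<in> X" "AE t in M. L (Ap \<mu>) z t = f t"
    using zero_data_solvable[OF Ap order_refl f] by blast
  have "surj (\<lambda>q. B \<mu> (\<Psi> \<mu> q))" by (rule B_surj(2)) (rule inj)
  then obtain q where q: "c - B \<mu> z = B \<mu> (\<Psi> \<mu> q)" by (rule surjE)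
  note \<Psi> = \<Psi>[of \<mu> q]
  have "AE t in M. L (Ap \<mu>) (\<lambda>t. z t + \<Psi> \<mu> q t) t = f t"
    using L_add[OF z(1) \<Psi>(1), of "Ap \<mu>"] z(2) \<Psi>(2) by eventually_elim simp
  then have "bvp_solution a b p n r (Ap \<mu>) (B \<mu>) f c (\<lambda>t. z t + \<Psi> \<mu> q t)"
    unfolding sol using q[symmetric] Wv_add(1)[OF z(1) \<Psi>(1)] clo_add[OF B_clo z(1) \<Psi>(1), of \<mu>] by simp
  moreover have "y t = w t" if y: "bvp_solution a b p n r (Ap \<mu>) (B \<mu>) f c y"
    and w: "bvp_solution a b p n r (Ap \<mu>) (B \<mu>) f c w" and t: "t \<in> {a..b}" for y w t
  proof -
    have yw: "y \<in> X" "w \<in> X" using y w unfolding sol by auto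
    have "AE t in M. L (Ap \<mu>) y t = f t" "AE t in M. L (Ap \<mu>) w t = f t" using y w unfolding sol by auto
    then have "AE t in M. L (Ap \<mu>) (\<lambda>t. y t - w t) t = 0"
      using L_diff[OF yw, of "Ap \<mu>"] by eventually_elim simp
    moreover have "B \<mu> (\<lambda>t. y t - w t) = 0" using y w clo_diff[OF B_clo yw] unfolding sol by simp
    ultimately show ?thesis
      using xn_0_imp[OF Wv_diff(1)[OF yw] inj[OF Wv_diff(1)[OF yw]] t] by simp
  qed
  ultimately show ?thesis unfolding bvp_unique_solution_def by blast
qed

lemma an_dA_0: "an (dA \<mu>\<^sub>0) = 0"
  by (simp add: an_def sobolev_mat_norm_def W_zero)

section \<open>The uniform a priori estimate and sufficiency\<close>

text \<open>The function y is split along the fundamental solutions of \<open>\<mu>\<^sub>0\<close>,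
  not of \<mu>, so that nothing about the behaviour of \<psi> \<mu> enters. With q = cd y the
  remainder w has zero data and is bounded by \<open>zero_data_estimate\<close>;
  \<open>L (Ap \<mu>)\<close> maps the combination P only to the small term
  \<open>Q (dA \<mu>) P\<close>. Then q is estimated through the lower bound c for B at
  \<open>\<mu>\<^sub>0\<close>.\<close>

lemma uniform_estimate:
  assumes hom: "\<And>y. y \<in> X \<Longrightarrow> (AE t in M. L (Ap \<mu>\<^sub>0) y t = 0) \<Longrightarrow> B \<mu>\<^sub>0 y = 0 \<Longrightarrow> xn y = 0"
    and limA: "((\<lambda>\<mu>. an (dA \<mu>)) \<longlongrightarrow> 0) (at \<mu>\<^sub>0)"
    and limB: "\<And>y. y \<in> X \<Longrightarrow> ((\<lambda>\<mu>. B \<mu> y) \<longlongrightarrow> B \<mu>\<^sub>0 y) (at \<mu>\<^sub>0)"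
  shows "\<exists>C\<ge>0. \<forall>\<^sub>F \<mu> in nhds \<mu>\<^sub>0. \<forall>y\<in>X. xn y \<le> C * (vn n (L (Ap \<mu>) y) + norm (B \<mu> y))"
proof -
  have A_nhds: "((\<lambda>\<mu>. an (dA \<mu>)) \<longlongrightarrow> 0) (nhds \<mu>\<^sub>0)"
    using limA tendsto_at_iff_tendsto_nhds[of "\<lambda>\<mu>. an (dA \<mu>)" \<mu>\<^sub>0] by (simp only: an_dA_0)
  have B_nhds: "((\<lambda>\<mu>. B \<mu> y) \<longlongrightarrow> B \<mu>\<^sub>0 y) (nhds \<mu>\<^sub>0)" if "y \<in> X" for y
    using limB[OF that] by (rule tendsto_at_iff_tendsto_nhds[THEN iffD1])
  \<comment> \<open>By \<open>an_le\<close> an upper bound for \<open>an (Ap \<mu>)\<close> as soon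
    as \<open>an (dA \<mu>)\<close> is below 1.\<close>
  define R where "R = an (Ap \<mu>\<^sub>0) + 1"
  define K where "K = \<bar>KL CARD('m) R\<bar>"
  have K: "K \<ge> 0" "KL CARD('m) R \<le> K" by (simp_all add: K_def)
  obtain \<beta> where \<beta>: "\<beta> \<ge> 0" "\<forall>\<^sub>F \<mu> in nhds \<mu>\<^sub>0. \<forall>y\<in>X. norm (B \<mu> y) \<le> \<beta> * xn y"
    using locally_bounded[OF B_clo limB] by blast
  obtain H where H: "H \<ge> 0" "\<And>q. xn (\<Psi> \<mu>\<^sub>0 q) \<le> H * norm q" using \<Psi>_bound by blast
  have "inj (\<lambda>q. B \<mu>\<^sub>0 (\<Psi> \<mu>\<^sub>0 q))" by (rule B_surj(1)) (rule hom)
  then obtain c where c: "c > 0" "\<And>q. c * norm q \<le> norm (B \<mu>\<^sub>0 (\<Psi> \<mu>\<^sub>0 q))"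
    using linear_inj_bounded_below_pos[OF linear_B_\<Psi>] by blast
  \<comment> \<open>Distance of B \<mu> from its limit on the span of the \<psi>. Only finitely many
    functions are involved, so pointwise convergence makes it tend to zero.\<close>
  define \<epsilon> where "\<epsilon> \<mu> = (\<Sum>j\<in>UNIV. norm (B \<mu> (\<psi> \<mu>\<^sub>0 j) - B \<mu>\<^sub>0 (\<psi> \<mu>\<^sub>0 j)))" for \<mu>
  have "(\<epsilon> \<longlongrightarrow> (\<Sum>j\<in>(UNIV::'k set). norm (B \<mu>\<^sub>0 (\<psi> \<mu>\<^sub>0 j) - B \<mu>\<^sub>0 (\<psi> \<mu>\<^sub>0 j)))) (nhds \<mu>\<^sub>0)"
    unfolding \<epsilon>_def[abs_def] by (intro tendsto_sum tendsto_norm tendsto_diff tendsto_const B_nhds \<psi>)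
  then have \<epsilon>0: "(\<epsilon> \<longlongrightarrow> 0) (nhds \<mu>\<^sub>0)" by simp
  have \<epsilon>: "norm (B \<mu> (\<Psi> \<mu>\<^sub>0 q) - B \<mu>\<^sub>0 (\<Psi> \<mu>\<^sub>0 q)) \<le> \<epsilon> \<mu> * norm q" for \<mu> q
  proof -
    have "B \<mu> (\<Psi> \<mu>\<^sub>0 q) - B \<mu>\<^sub>0 (\<Psi> \<mu>\<^sub>0 q) = (\<Sum>j\<in>UNIV. q $ j *s (B \<mu> (\<psi> \<mu>\<^sub>0 j) - B \<mu>\<^sub>0 (\<psi> \<mu>\<^sub>0 j)))"
      by (simp add: B_\<Psi> sum_subtractf vec.scale_right_diff_distrib)
    also have "norm \<dots> \<le> (\<Sum>j\<in>UNIV. norm (B \<mu> (\<psi> \<mu>\<^sub>0 j) - B \<mu>\<^sub>0 (\<psi> \<mu>\<^sub>0 j)) * norm q)"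
    proof (rule sum_norm_le)
      fix j
      have "norm (q $ j *s (B \<mu> (\<psi> \<mu>\<^sub>0 j) - B \<mu>\<^sub>0 (\<psi> \<mu>\<^sub>0 j))) \<le> norm (q $ j) * norm (B \<mu> (\<psi> \<mu>\<^sub>0 j) - B \<mu>\<^sub>0 (\<psi> \<mu>\<^sub>0 j))"
        by (rule norm_smult_le)
      also have "\<dots> \<le> norm q * norm (B \<mu> (\<psi> \<mu>\<^sub>0 j) - B \<mu>\<^sub>0 (\<psi> \<mu>\<^sub>0 j))"
        by (intro mult_right_mono Finite_Cartesian_Product.norm_nth_le) auto
      finally show "norm (q $ j *s (B \<mu> (\<psi> \<mu>\<^sub>0 j) - B \<mu>\<^sub>0 (\<psi> \<mu>\<^sub>0 j))) \<le> norm (B \<mu> (\<psi> \<mu>\<^sub>0 j) - B \<mu>\<^sub>0 (\<psi> \<mu>\<^sub>0 j)) * norm q"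
        by (simp add: mult.commute)
    qed
    finally show ?thesis by (simp add: \<epsilon>_def sum_distrib_right)
  qed
  \<comment> \<open>This is the factor of norm q on the right of the estimate for c * norm q. Below
    c / 2 it can be absorbed by the left side.\<close>
  have "((\<lambda>\<mu>. \<beta> * (K * (KM n * an (dA \<mu>) * H)) + \<epsilon> \<mu>) \<longlongrightarrow> \<beta> * (K * (KM n * 0 * H)) + 0) (nhds \<mu>\<^sub>0)"
    by (intro tendsto_intros A_nhds \<epsilon>0)
  then have \<eta>: "\<forall>\<^sub>F \<mu> in nhds \<mu>\<^sub>0. \<beta> * (K * (KM n * an (dA \<mu>) * H)) + \<epsilon> \<mu> < c / 2"
    using c(1) by (intro order_tendstoD(2)) auto
  have ev1: "\<forall>\<^sub>F \<mu> in nhds \<mu>\<^sub>0. an (dA \<mu>) < 1" by (rule order_tendstoD(2)[OF A_nhds]) simp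
  \<comment> \<open>Factor of norm q in the bound of y: the first summand comes from w, with
    \<open>an (dA \<mu>)\<close> replaced by 1, and H from the combination of fundamental
    solutions.\<close>
  define H' where "H' = K * (KM n * H) + H"
  have H': "H' \<ge> 0" using K H KM_nonneg[of n] by (simp add: H'_def)
  define C where "C = K + H' * (2 / c) * (1 + \<beta> * K)"
  have "C \<ge> 0" using K H' c \<beta> by (simp add: C_def)
  moreover have "\<forall>\<^sub>F \<mu> in nhds \<mu>\<^sub>0. \<forall>y\<in>X. xn y \<le> C * (vn n (L (Ap \<mu>) y) + norm (B \<mu> y))"
    using \<eta> ev1 \<beta>(2)
  proof eventually_elim
    case (elim \<mu>)
    show ?case
    proof
      fix y assume y: "y \<in> X"
      define q where "q = cd y"
      let ?P = "\<Psi> \<mu>\<^sub>0 q" and ?F = "vn n (L (Ap \<mu>) y)" and ?G = "norm (B \<mu> y)" and ?\<delta> = "an (dA \<mu>)"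
      let ?w = "\<lambda>t. y t - ?P t"
      note P = \<Psi>[of \<mu>\<^sub>0 q]
      have w: "?w \<in> X" by (rule Wv_diff(1)[OF y P(1)])
      have "cd ?w = 0" using cd_diff[OF y P(1)] P(3) by (simp add: q_def)
      moreover have "an (Ap \<mu>) \<le> R" using an_le[of \<mu>] elim(2) by (simp add: R_def)
      ultimately have "xn ?w \<le> KL CARD('m) R * vn n (L (Ap \<mu>) ?w)"
        by (intro zero_data_estimate[OF Ap _ w] cd_0_imp)
      also have "\<dots> \<le> K * vn n (L (Ap \<mu>) ?w)" using K by (intro mult_right_mono) auto
      also have "\<dots> \<le> K * (?F + KM n * ?\<delta> * H * norm q)"
      proof (rule mult_left_mono[OF _ K(1)])
        have "AE t in M. L (Ap \<mu>) ?w t = L (Ap \<mu>) y t - Q (dA \<mu>) ?P t"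
          using L_diff[OF y P(1), of "Ap \<mu>"] P(2)
        proof eventually_elim
          case (elim t)
          then show ?case using L_perturb[of \<mu> ?P t] by simp
        qed
        then have "vn n (L (Ap \<mu>) ?w) = vn n (\<lambda>t. L (Ap \<mu>) y t - Q (dA \<mu>) ?P t)"
          by (intro sym[OF vn_AE_cong] L_W Ap w Wv_diff Q_dA y P(1))
        also have "\<dots> \<le> ?F + vn n (Q (dA \<mu>) ?P)" by (intro Wv_diff(2) L_W Ap Q_dA y P(1))
        also have "vn n (Q (dA \<mu>) ?P) \<le> KM n * ?\<delta> * xn ?P" by (rule Q_dA(2)[OF P(1)])
        also have "\<dots> \<le> KM n * ?\<delta> * (H * norm q)"
          using KM_nonneg[of n] by (intro mult_left_mono H) auto
        finally show "vn n (L (Ap \<mu>) ?w) \<le> ?F + KM n * ?\<delta> * H * norm q" by (simp add: mult_ac)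
      qed
      finally have xw: "xn ?w \<le> K * ?F + K * (KM n * ?\<delta> * H) * norm q" by (simp add: algebra_simps)
      have "norm (B \<mu>\<^sub>0 ?P) \<le> norm (B \<mu> ?P) + \<epsilon> \<mu> * norm q"
        using \<epsilon>[of \<mu> q] norm_triangle_sub[of "B \<mu>\<^sub>0 ?P" "B \<mu> ?P"] by (simp add: norm_minus_commute)
      moreover have "B \<mu> ?P = B \<mu> y - B \<mu> ?w" using clo_diff[OF B_clo y P(1)] by simp
      then have "norm (B \<mu> ?P) \<le> ?G + norm (B \<mu> ?w)" using norm_triangle_ineq4 by simp
      moreover have "norm (B \<mu> ?w) \<le> \<beta> * (K * ?F + K * (KM n * ?\<delta> * H) * norm q)"
        using elim(3) w by (intro order_trans[OF _ mult_left_mono[OF xw \<beta>(1)]]) blast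
      ultimately have "c * norm q \<le> ?G + \<beta> * K * ?F + (\<beta> * (K * (KM n * ?\<delta> * H)) + \<epsilon> \<mu>) * norm q"
        using c(2)[of q] by (simp add: algebra_simps)
      also have "\<dots> \<le> ?G + \<beta> * K * ?F + c / 2 * norm q"
        using elim(1) by (intro add_left_mono mult_right_mono) auto
      finally have "norm q \<le> 2 / c * (?G + \<beta> * K * ?F)" using c(1) by (simp add: field_simps)
      also have "\<dots> \<le> 2 / c * ((1 + \<beta> * K) * (?F + ?G))"
        using c(1) \<beta>(1) K(1) by (intro mult_left_mono) (auto simp: algebra_simps)
      finally have "H' * norm q \<le> H' * (2 / c * ((1 + \<beta> * K) * (?F + ?G)))"
        by (rule mult_left_mono[OF _ H'])
      moreover have "xn y \<le> K * ?F + H' * norm q"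
      proof -
        have "xn y \<le> xn ?w + xn ?P" by (rule vn_triangle[OF y P(1)])
        moreover have "K * (KM n * ?\<delta> * H) * norm q \<le> K * (KM n * H) * norm q"
        proof (rule mult_right_mono[OF mult_left_mono[OF _ K(1)] norm_ge_zero])
          have "?\<delta> * H \<le> H" using elim(2) H(1) by (intro mult_left_le_one_le) auto
          then show "KM n * ?\<delta> * H \<le> KM n * H"
            unfolding mult.assoc by (rule mult_left_mono) (rule KM_nonneg)
        qed
        ultimately show ?thesis using xw H(2)[of q] by (simp add: H'_def algebra_simps)
      qed
      moreover have "K * ?F \<le> K * (?F + ?G)" using K(1) by (intro mult_left_mono) auto
      moreover have "C * (?F + ?G) = K * (?F + ?G) + H' * (2 / c * ((1 + \<beta> * K) * (?F + ?G)))"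
        by (simp only: C_def distrib_right mult.assoc)
      ultimately show "xn y \<le> C * (?F + ?G)" by linarith
    qed
  qed
  ultimately show ?thesis by blast
qed

text \<open>The uniform estimate is used twice: on solutions of the homogeneous problem it gives
  uniqueness, hence solvability by \<open>solvable\<close>, in a whole ball; on the difference y
  \<mu> - y \<open>\<mu>\<^sub>0\<close> it gives convergence.\<close>

lemma sufficiency:
  assumes hom: "\<And>y. y \<in> X \<Longrightarrow> (AE t in M. L (Ap \<mu>\<^sub>0) y t = 0) \<Longrightarrow> B \<mu>\<^sub>0 y = 0 \<Longrightarrow> xn y = 0"
    and limA: "((\<lambda>\<mu>. an (dA \<mu>)) \<longlongrightarrow> 0) (at \<mu>\<^sub>0)"
    and limB: "\<And>y. y \<in> X \<Longrightarrow> ((\<lambda>\<mu>. B \<mu> y) \<longlongrightarrow> B \<mu>\<^sub>0 y) (at \<mu>\<^sub>0)"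
  shows "solution_depends_continuously a b p n r A B \<mu>\<^sub>0"
proof -
  obtain C where C: "C \<ge> 0"
    and est: "\<forall>\<^sub>F \<mu> in nhds \<mu>\<^sub>0. \<forall>y\<in>X. xn y \<le> C * (vn n (L (Ap \<mu>) y) + norm (B \<mu> y))"
    using uniform_estimate[OF hom limA limB] by blast
  obtain \<epsilon> where \<epsilon>: "\<epsilon> > 0" "\<And>\<mu> y. dist \<mu> \<mu>\<^sub>0 < \<epsilon> \<Longrightarrow> y \<in> X \<Longrightarrow> xn y \<le> C * (vn n (L (Ap \<mu>) y) + norm (B \<mu> y))"
    using est unfolding eventually_nhds_metric by blast
  have "bvp_unique_solution a b p n r (Ap \<mu>) (B \<mu>) f c" if "\<mu> \<in> ball \<mu>\<^sub>0 \<epsilon>" "f \<in> Wv n" for \<mu> f c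
  proof (rule solvable[OF _ that(2)])
    fix y assume y: "y \<in> X" "AE t in M. L (Ap \<mu>) y t = 0" "B \<mu> y = 0"
    have "vn n (L (Ap \<mu>) y) = 0" by (rule vn_AE_0[OF L_W(1)[OF Ap y(1)] y(2)])
    then have "xn y \<le> 0" using \<epsilon>(2)[of \<mu> y] that(1) y by (simp add: dist_commute)
    then show "xn y = 0" by (intro antisym) auto
  qed
  moreover have "((\<lambda>\<mu>. xn (\<lambda>t. y \<mu> t - y \<mu>\<^sub>0 t)) \<longlongrightarrow> 0) (at \<mu>\<^sub>0)"
    if f: "\<forall>\<mu>. f \<mu> \<in> Wv n"
      and sol: "\<forall>\<^sub>F \<mu> in nhds \<mu>\<^sub>0. bvp_solution a b p n r (Ap \<mu>) (B \<mu>) (f \<mu>) (c \<mu>) (y \<mu>)"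
      and limf: "((\<lambda>\<mu>. vn n (\<lambda>t. f \<mu> t - f \<mu>\<^sub>0 t)) \<longlongrightarrow> 0) (at \<mu>\<^sub>0)"
      and limc: "(c \<longlongrightarrow> c \<mu>\<^sub>0) (at \<mu>\<^sub>0)" for f c y
  proof -
    have fW: "f \<mu> \<in> Wv n" for \<mu> using f by blast
    note iff = bvp_solution_iff[OF Ap fW]
    have y0: "y \<mu>\<^sub>0 \<in> X" "AE t in M. L (Ap \<mu>\<^sub>0) (y \<mu>\<^sub>0) t = f \<mu>\<^sub>0 t" "B \<mu>\<^sub>0 (y \<mu>\<^sub>0) = c \<mu>\<^sub>0"
      using eventually_nhds_x_imp_x[OF sol] unfolding iff by auto
    \<comment> \<open>The difference solves the problem at \<mu> with data perturbed by the
      coefficients and the operator acting on the fixed function y \<open>\<mu>\<^sub>0\<close>,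
      which is why pointwise convergence of B is enough here.\<close>
    let ?b = "\<lambda>\<mu>. C * ((vn n (\<lambda>t. f \<mu> t - f \<mu>\<^sub>0 t) + KM n * an (dA \<mu>) * xn (y \<mu>\<^sub>0))
        + (norm (c \<mu> - c \<mu>\<^sub>0) + norm (B \<mu> (y \<mu>\<^sub>0) - B \<mu>\<^sub>0 (y \<mu>\<^sub>0))))"
    have "\<forall>\<^sub>F \<mu> in nhds \<mu>\<^sub>0. norm (xn (\<lambda>t. y \<mu> t - y \<mu>\<^sub>0 t)) \<le> ?b \<mu>"
      using sol est
    proof eventually_elim
      case (elim \<mu>)
      have y: "y \<mu> \<in> X" "AE t in M. L (Ap \<mu>) (y \<mu>) t = f \<mu> t" "B \<mu> (y \<mu>) = c \<mu>"
        using elim(1) unfolding iff by auto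
      let ?w = "\<lambda>t. y \<mu> t - y \<mu>\<^sub>0 t"
      let ?g = "\<lambda>t. (f \<mu> t - f \<mu>\<^sub>0 t) - Q (dA \<mu>) (y \<mu>\<^sub>0) t"
      have w: "?w \<in> X" by (rule Wv_diff(1)[OF y(1) y0(1)])
      have g: "?g \<in> Wv n" by (intro Wv_diff(1) fW Q_dA y0(1))
      have "AE t in M. L (Ap \<mu>) ?w t = ?g t"
        using L_diff[OF y(1) y0(1), of "Ap \<mu>"] y(2) y0(2)
      proof eventually_elim
        case (elim t)
        then show ?case using L_perturb[of \<mu> "y \<mu>\<^sub>0" t] by (simp add: algebra_simps)
      qed
      then have "vn n (L (Ap \<mu>) ?w) = vn n ?g"
        by (rule sym[OF vn_AE_cong[OF L_W(1)[OF Ap w] g]])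
      also have "\<dots> \<le> vn n (\<lambda>t. f \<mu> t - f \<mu>\<^sub>0 t) + vn n (Q (dA \<mu>) (y \<mu>\<^sub>0))"
        by (intro Wv_diff(2) Wv_diff(1) fW Q_dA y0(1))
      also have "\<dots> \<le> vn n (\<lambda>t. f \<mu> t - f \<mu>\<^sub>0 t) + KM n * an (dA \<mu>) * xn (y \<mu>\<^sub>0)"
        by (intro add_left_mono Q_dA y0(1))
      finally have 1: "vn n (L (Ap \<mu>) ?w) \<le> vn n (\<lambda>t. f \<mu> t - f \<mu>\<^sub>0 t) + KM n * an (dA \<mu>) * xn (y \<mu>\<^sub>0)" .
      have "B \<mu> ?w = (c \<mu> - c \<mu>\<^sub>0) - (B \<mu> (y \<mu>\<^sub>0) - B \<mu>\<^sub>0 (y \<mu>\<^sub>0))"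
        using clo_diff[OF B_clo y(1) y0(1), of \<mu>] y(3) y0(3) by simp
      then have 2: "norm (B \<mu> ?w) \<le> norm (c \<mu> - c \<mu>\<^sub>0) + norm (B \<mu> (y \<mu>\<^sub>0) - B \<mu>\<^sub>0 (y \<mu>\<^sub>0))"
        by (simp only: norm_triangle_ineq4)
      have "xn ?w \<le> C * (vn n (L (Ap \<mu>) ?w) + norm (B \<mu> ?w))" using elim(2) w by blast
      also have "\<dots> \<le> ?b \<mu>" by (intro mult_left_mono[OF _ C] add_mono 1 2)
      finally show ?case by simp
    qed
    then have ev: "\<forall>\<^sub>F \<mu> in at \<mu>\<^sub>0. norm (xn (\<lambda>t. y \<mu> t - y \<mu>\<^sub>0 t)) \<le> ?b \<mu>"
      by (simp add: eventually_nhds_conv_at)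
    have "(?b \<longlongrightarrow> C * ((0 + KM n * 0 * xn (y \<mu>\<^sub>0)) + (norm (c \<mu>\<^sub>0 - c \<mu>\<^sub>0) + norm (B \<mu>\<^sub>0 (y \<mu>\<^sub>0) - B \<mu>\<^sub>0 (y \<mu>\<^sub>0))))) (at \<mu>\<^sub>0)"
      by (intro tendsto_add tendsto_mult tendsto_const tendsto_norm tendsto_diff limf limA limc limB y0(1))
    then have "(?b \<longlongrightarrow> 0) (at \<mu>\<^sub>0)" by simp
    with ev show ?thesis by (rule Lim_null_comparison)
  qed
  ultimately show ?thesis
    unfolding solution_depends_continuously_def using \<epsilon>(1) by blast
qed

lemma bvp_sol_iff:
  assumes "f \<in> Wv n"
  shows "bvp_solution a b p n r (Ap \<mu>) (B \<mu>) f c y \<longleftrightarrow> y \<in> X \<and> (AE t in M. L (Ap \<mu>) y t = f t) \<and> B \<mu> y = c"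
  by (rule bvp_solution_iff[OF Ap assms])

section \<open>Necessity\<close>

context
  assumes dep: "solution_depends_continuously a b p n r A B \<mu>\<^sub>0"
begin

lemma unique_solution_near:
  "\<forall>\<^sub>F \<mu> in nhds \<mu>\<^sub>0. \<forall>f\<in>Wv n. \<forall>c. bvp_unique_solution a b p n r (Ap \<mu>) (B \<mu>) f c"
  using dep unfolding solution_depends_continuously_def eventually_nhds_metric
  by (simp add: Ball_def dist_commute)

lemma homogeneous_trivial:
  assumes "y \<in> X" "AE t in M. L (Ap \<mu>\<^sub>0) y t = 0" "B \<mu>\<^sub>0 y = 0" "t \<in> {a..b}"
  shows "y t = 0"
proof -
  have "bvp_unique_solution a b p n r (Ap \<mu>\<^sub>0) (B \<mu>\<^sub>0) (\<lambda>_. 0) 0"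
    using eventually_nhds_x_imp_x[OF unique_solution_near] Wv_zero(1) by blast
  moreover have "bvp_solution a b p n r (Ap \<mu>\<^sub>0) (B \<mu>\<^sub>0) (\<lambda>_. 0) 0 y"
    unfolding bvp_sol_iff[OF Wv_zero(1)] using assms by blast
  moreover have "bvp_solution a b p n r (Ap \<mu>\<^sub>0) (B \<mu>\<^sub>0) (\<lambda>_. 0) 0 (\<lambda>_. 0)"
    unfolding bvp_sol_iff[OF Wv_zero(1)] using Wv_zero(1) L_zero clo_zero[OF B_clo] by blast
  ultimately show ?thesis using assms(4) unfolding bvp_unique_solution_def by blast
qed

text \<open>The form in which continuous dependence is exploited: right-hand sides f \<mu> and a
  fixed boundary value are prescribed, and solutions converging to the given
  \<open>y\<^sub>0\<close> are obtained.\<close>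

lemma continuous_family:
  assumes f: "\<And>\<mu>. f \<mu> \<in> Wv n" and limf: "((\<lambda>\<mu>. vn n (\<lambda>t. f \<mu> t - f \<mu>\<^sub>0 t)) \<longlongrightarrow> 0) (at \<mu>\<^sub>0)"
    and y0: "y\<^sub>0 \<in> X" "AE t in M. L (Ap \<mu>\<^sub>0) y\<^sub>0 t = f \<mu>\<^sub>0 t" "B \<mu>\<^sub>0 y\<^sub>0 = c"
  shows "\<exists>y. (\<forall>\<^sub>F \<mu> in nhds \<mu>\<^sub>0. y \<mu> \<in> X \<and> (AE t in M. L (Ap \<mu>) (y \<mu>) t = f \<mu> t) \<and> B \<mu> (y \<mu>) = c)
    \<and> ((\<lambda>\<mu>. xn (\<lambda>t. y \<mu> t - y\<^sub>0 t)) \<longlongrightarrow> 0) (at \<mu>\<^sub>0)"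
proof -
  \<comment> \<open>At \<open>\<mu>\<^sub>0\<close> the given solution is used, so that it is the
    limit itself. Where no solution exists the choice is arbitrary, which happens only away from
    \<open>\<mu>\<^sub>0\<close>.\<close>
  define y where "y \<mu> = (if \<mu> = \<mu>\<^sub>0 then y\<^sub>0 else SOME y. bvp_solution a b p n r (Ap \<mu>) (B \<mu>) (f \<mu>) c y)" for \<mu>
  have sol: "\<forall>\<^sub>F \<mu> in nhds \<mu>\<^sub>0. bvp_solution a b p n r (Ap \<mu>) (B \<mu>) (f \<mu>) c (y \<mu>)"
    using unique_solution_near
  proof eventually_elim
    case (elim \<mu>)
    then have "\<exists>y. bvp_solution a b p n r (Ap \<mu>) (B \<mu>) (f \<mu>) c y"
      using f unfolding bvp_unique_solution_def by blast
    from someI_ex[OF this] show ?case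
      by (cases "\<mu> = \<mu>\<^sub>0") (simp add: y_def bvp_sol_iff[OF f] y0, simp add: y_def)
  qed
  have "((\<lambda>\<mu>. xn (\<lambda>t. y \<mu> t - y \<mu>\<^sub>0 t)) \<longlongrightarrow> 0) (at \<mu>\<^sub>0)"
    using dep[unfolded solution_depends_continuously_def, THEN conjunct2, THEN spec[of _ f], THEN spec[of _ "\<lambda>_. c"],
        THEN spec[of _ y]] f limf sol
    by simp
  then show ?thesis using sol unfolding bvp_sol_iff[OF f] by (intro exI[of _ y]) (simp add: y_def)
qed

text \<open>The coefficients are not known to be bounded near \<open>\<mu>\<^sub>0\<close> at this point, so smallness is measured relative to
  \<open>1 + an (dA \<mu>)\<close>.\<close>

definition vanishing :: "('p \<Rightarrow> real) \<Rightarrow> bool" where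
  "vanishing h \<longleftrightarrow> ((\<lambda>\<mu>. h \<mu> / (1 + an (dA \<mu>))) \<longlongrightarrow> 0) (at \<mu>\<^sub>0)"

lemma dA_pos: "1 + an (dA \<mu>) > 0"
  using an_nonneg[of "dA \<mu>"] by linarith

lemma vanishing_bound:
  assumes "vanishing h" "\<forall>\<^sub>F \<mu> in at \<mu>\<^sub>0. g \<mu> \<le> h \<mu>" "\<And>\<mu>. g \<mu> \<ge> 0"
  shows "vanishing g"
  unfolding vanishing_def
proof (rule Lim_null_comparison)
  show "\<forall>\<^sub>F \<mu> in at \<mu>\<^sub>0. norm (g \<mu> / (1 + an (dA \<mu>))) \<le> h \<mu> / (1 + an (dA \<mu>))"
    using assms(2)
  proof eventually_elim
    case (elim \<mu>)
    then show ?case using assms(3)[of \<mu>] dA_pos[of \<mu>] by (simp add: divide_right_mono)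
  qed
  show "((\<lambda>\<mu>. h \<mu> / (1 + an (dA \<mu>))) \<longlongrightarrow> 0) (at \<mu>\<^sub>0)" using assms(1) by (simp only: vanishing_def)
qed

lemma vanishing_add: "vanishing g \<Longrightarrow> vanishing h \<Longrightarrow> vanishing (\<lambda>\<mu>. g \<mu> + h \<mu>)"
  unfolding vanishing_def add_divide_distrib by (rule tendsto_add_zero)

lemma vanishing_cmult: "vanishing g \<Longrightarrow> vanishing (\<lambda>\<mu>. K * g \<mu>)"
  unfolding vanishing_def times_divide_eq_right[symmetric] by (rule tendsto_mult_right_zero)

lemma vanishing_sum: "(\<And>i. i \<in> I \<Longrightarrow> vanishing (g i)) \<Longrightarrow> vanishing (\<lambda>\<mu>. \<Sum>i\<in>I. g i \<mu>)"
  unfolding vanishing_def sum_divide_distrib by (rule tendsto_null_sum)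

text \<open>The operator bound of L (Ap \<mu>) on y \<mu> - \<open>y\<^sub>0\<close> grows at most
  like 1 + an (dA \<mu>), which is exactly the weight in \<open>vanishing\<close>; what remains is
  the norm of the difference, which tends to zero.\<close>

lemma Q_vanishing:
  assumes y0: "y\<^sub>0 \<in> X"
  shows "vanishing (\<lambda>\<mu>. vn n (Q (dA \<mu>) y\<^sub>0))"
proof -
  have f: "L (Ap \<mu>\<^sub>0) y\<^sub>0 \<in> Wv n" by (rule L_W(1)[OF Ap y0])
  obtain y where y: "\<forall>\<^sub>F \<mu> in nhds \<mu>\<^sub>0. y \<mu> \<in> X \<and> (AE t in M. L (Ap \<mu>) (y \<mu>) t = L (Ap \<mu>\<^sub>0) y\<^sub>0 t) \<and> B \<mu> (y \<mu>) = B \<mu>\<^sub>0 y\<^sub>0"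
    and lim: "((\<lambda>\<mu>. xn (\<lambda>t. y \<mu> t - y\<^sub>0 t)) \<longlongrightarrow> 0) (at \<mu>\<^sub>0)"
    using continuous_family[of "\<lambda>_. L (Ap \<mu>\<^sub>0) y\<^sub>0", OF f _ y0] by (auto simp: Wv_zero)
  let ?a = "1 + KM n * (1 + an (Ap \<mu>\<^sub>0))"
  have "\<forall>\<^sub>F \<mu> in nhds \<mu>\<^sub>0. vn n (Q (dA \<mu>) y\<^sub>0) \<le> ?a * ((1 + an (dA \<mu>)) * xn (\<lambda>t. y \<mu> t - y\<^sub>0 t))"
    using y
  proof eventually_elim
    case (elim \<mu>)
    let ?w = "\<lambda>t. y \<mu> t - y\<^sub>0 t" and ?\<delta> = "an (dA \<mu>)"
    have y\<mu>: "y \<mu> \<in> X" using elim by blast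
    have w: "?w \<in> X" by (rule Wv_diff(1)[OF y\<mu> y0])
    have eq: "AE t in M. L (Ap \<mu>) (y \<mu>) t = L (Ap \<mu>\<^sub>0) y\<^sub>0 t" using elim by blast
    have "AE t in M. - L (Ap \<mu>) ?w t = Q (dA \<mu>) y\<^sub>0 t"
      using L_diff[OF y\<mu> y0, of "Ap \<mu>"] eq
    proof eventually_elim
      case (elim t)
      then show ?case using L_perturb[of \<mu> "y\<^sub>0" t] by simp
    qed
    then have "vn n (Q (dA \<mu>) y\<^sub>0) = vn n (\<lambda>t. - L (Ap \<mu>) ?w t)"
      by (rule vn_AE_cong[OF Wv_minus(1)[OF L_W(1)[OF Ap w]] Q_dA(1)[OF y0]])
    also have "\<dots> = vn n (L (Ap \<mu>) ?w)" by (rule Wv_minus(2)[OF L_W(1)[OF Ap w]])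
    also have "\<dots> \<le> (1 + KM n * an (Ap \<mu>)) * xn ?w" by (rule L_W(2)[OF Ap w])
    also have "\<dots> \<le> (?a * (1 + ?\<delta>)) * xn ?w"
    proof (rule mult_right_mono)
      have "1 + KM n * an (Ap \<mu>) \<le> 1 + KM n * (?\<delta> + an (Ap \<mu>\<^sub>0))"
        by (intro add_left_mono mult_left_mono an_le KM_nonneg)
      also have "\<dots> \<le> ?a * (1 + ?\<delta>)"
        using KM_nonneg[of n] an_nonneg[of "Ap \<mu>\<^sub>0"] an_nonneg[of "dA \<mu>"]
        by (simp add: algebra_simps)
      finally show "1 + KM n * an (Ap \<mu>) \<le> ?a * (1 + ?\<delta>)" .
    qed simp
    finally show ?case by (simp add: mult.assoc)
  qed
  then have ev: "\<forall>\<^sub>F \<mu> in at \<mu>\<^sub>0. vn n (Q (dA \<mu>) y\<^sub>0) \<le> ?a * ((1 + an (dA \<mu>)) * xn (\<lambda>t. y \<mu> t - y\<^sub>0 t))"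
    by (simp add: eventually_nhds_conv_at)
  have "vanishing (\<lambda>\<mu>. (1 + an (dA \<mu>)) * xn (\<lambda>t. y \<mu> t - y\<^sub>0 t))"
    using lim dA_pos less_imp_neq[OF dA_pos] by (simp add: vanishing_def)
  from vanishing_bound[OF vanishing_cmult[OF this] ev] show ?thesis by simp
qed

lemma mn_columns: "mn l Y = (\<Sum>i\<in>UNIV. vn l (\<lambda>t. Y t *v axis i 1))"
proof -
  have "(Y t *v axis i 1) $ k = Y t $ k $ i" for t i k
    by (simp add: matrix_vector_mult_def axis_def if_distrib[of "\<lambda>x. _ * x"] cong: if_cong)
  then show ?thesis unfolding sobolev_mat_norm_def vn_eq by (subst sum.swap) simp
qed

lemma Q_pv:
  assumes "s < r" "t \<in> {a..b}"
  shows "Q A' (pv s i) t = A' s t *v axis i 1 + (\<Sum>j<s. A' j t *v pv (s - j) i t)"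
proof -
  have "Q A' (pv s i) t = (\<Sum>l=1..r. A' (r - l) t *v dv (r - l) (pv s i) t)" by (simp only: Q_def)
  also have "\<dots> = (\<Sum>j<r. A' j t *v dv j (pv s i) t)"
    by (rule sum.reindex_bij_witness[of _ "\<lambda>j. r - j" "\<lambda>l. r - l"]) auto
  also have "\<dots> = (\<Sum>j<r. if j \<le> s then A' j t *v pv (s - j) i t else 0)"
    by (intro sum.cong refl) (simp only: dv_pv[OF assms(2)], simp)
  also have "\<dots> = (\<Sum>j\<in>{..<Suc s}. A' j t *v pv (s - j) i t)"
    using assms(1) by (intro sum.mono_neutral_cong_right) auto
  also have "\<dots> = A' s t *v pv 0 i t + (\<Sum>j<s. A' j t *v pv (s - j) i t)"
    by (simp add: add.commute)
  also have "pv 0 i t = axis i 1" by (simp add: pv_def pw_def)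
  finally show ?thesis .
qed

text \<open>Testing with the polynomials \<open>(t - a)\<^sup>s / s! e\<^sub>i\<close> isolates the \<open>i\<close>-th column of the \<open>s\<close>-th
  coefficient, up to the coefficients of lower index.\<close>

lemma coefficient_vanishing: "s < r \<Longrightarrow> vanishing (\<lambda>\<mu>. mn n (dA \<mu> s))"
proof (induction s rule: less_induct)
  case (less s)
  have W: "dA \<mu> j \<in> Wm n" if "j < r" for j \<mu>
    using dA[of \<mu>, rule_format, of "r - j"] that r_ge_1 by (simp add: Suc_le_eq)
  let ?h = "\<lambda>\<mu>. \<Sum>i\<in>UNIV. vn n (Q (dA \<mu>) (pv s i)) + (\<Sum>j<s. KM n * vn (Suc n) (pv (s - j) i :: real \<Rightarrow> complex ^ 'm) * mn n (dA \<mu> j))"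
  have h: "vanishing ?h"
    using less by (intro vanishing_sum vanishing_add Q_vanishing pv_W vanishing_cmult) auto
  have le: "mn n (dA \<mu> s) \<le> ?h \<mu>" for \<mu>
    unfolding mn_columns[of n "dA \<mu> s"]
  proof (rule sum_mono)
    fix i
    let ?q = "Q (dA \<mu>) (pv s i)" and ?g = "\<lambda>j t. dA \<mu> j t *v pv (s - j) i t"
    have g: "?g j \<in> Wv n" "vn n (?g j) \<le> KM n * mn n (dA \<mu> j) * vn (Suc n) (pv (s - j) i :: real \<Rightarrow> complex ^ 'm)" if "j < s" for j
      using matvec_W[OF W pv_W, of j \<mu> "s - j" i] that less.prems by auto
    have q: "?q \<in> Wv n" by (rule Q_dA(1)[OF pv_W])
    have S: "(\<lambda>t. \<Sum>j<s. ?g j t) \<in> Wv n \<and> vn n (\<lambda>t. \<Sum>j<s. ?g j t) \<le> (\<Sum>j<s. vn n (?g j))"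
      using g by (intro Wv_sum) auto
    have "vn n (\<lambda>t. dA \<mu> s t *v axis i 1) = vn n (\<lambda>t. ?q t - (\<Sum>j<s. ?g j t))"
    proof (rule Wv_cong(2)[OF Wv_diff(1)[OF q conjunct1[OF S]] eqvI])
      fix k t assume "t \<in> {a..b}"
      from Q_pv[OF less.prems this, of "dA \<mu>" i]
      show "(?q t - (\<Sum>j<s. ?g j t)) $ k = (dA \<mu> s t *v axis i 1) $ k" by simp
    qed
    also have "\<dots> \<le> vn n ?q + vn n (\<lambda>t. \<Sum>j<s. ?g j t)" using S q by (intro Wv_diff(2)) auto
    also have "\<dots> \<le> vn n ?q + (\<Sum>j<s. KM n * mn n (dA \<mu> j) * vn (Suc n) (pv (s - j) i :: real \<Rightarrow> complex ^ 'm))"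
      using g by (intro add_left_mono order_trans[OF conjunct2[OF S]] sum_mono) auto
    finally show "vn n (\<lambda>t. dA \<mu> s t *v axis i 1) \<le> vn n ?q + (\<Sum>j<s. KM n * vn (Suc n) (pv (s - j) i :: real \<Rightarrow> complex ^ 'm) * mn n (dA \<mu> j))"
      by (simp add: mult_ac)
  qed
  show ?case by (rule vanishing_bound[OF h always_eventually mn_nonneg]) (intro allI le)
qed

text \<open>Removes the weight: with \<xi> = x / (1 + x) one has x = \<xi> / (1 - \<xi>), so \<xi>
  \<rightarrow> 0 forces x \<rightarrow> 0. In particular the coefficients turn out to be bounded
  near \<open>\<mu>\<^sub>0\<close>.\<close>

lemma coefficients_converge: "((\<lambda>\<mu>. an (dA \<mu>)) \<longlongrightarrow> 0) (at \<mu>\<^sub>0)"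
proof -
  let ?x = "\<lambda>\<mu>. an (dA \<mu>) / (1 + an (dA \<mu>))"
  have "vanishing (\<lambda>\<mu>. \<Sum>l=1..r. mn n (dA \<mu> (r - l)))"
    using r_ge_1 by (intro vanishing_sum coefficient_vanishing) auto
  then have "(?x \<longlongrightarrow> 0) (at \<mu>\<^sub>0)" unfolding vanishing_def an_def .
  then have "((\<lambda>\<mu>. ?x \<mu> / (1 - ?x \<mu>)) \<longlongrightarrow> 0 / (1 - 0)) (at \<mu>\<^sub>0)" by (intro tendsto_intros) auto
  moreover have "?x \<mu> / (1 - ?x \<mu>) = an (dA \<mu>)" for \<mu>
    using dA_pos[of \<mu>] by (simp add: field_simps)
  ultimately show ?thesis by simp
qed

text \<open>No bound on B \<mu> near \<open>\<mu>\<^sub>0\<close> is available, so only B at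
  \<open>\<mu>\<^sub>0\<close>, with its constant K, is ever estimated. The Y j \<mu> solve the
  homogeneous equation with unit boundary values and converge to v j. The difference d = B \<mu> y -
  B \<open>\<mu>\<^sub>0\<close> y is the boundary value of z = y - u \<mu>, so unique solvability
  expands z in the Y j \<mu> with coefficients d j.\<close>

lemma operators_converge:
  assumes y: "y \<in> X"
  shows "((\<lambda>\<mu>. B \<mu> y) \<longlongrightarrow> B \<mu>\<^sub>0 y) (at \<mu>\<^sub>0)"
proof -
  obtain K where K: "K \<ge> 0" "\<And>z. z \<in> X \<Longrightarrow> norm (B \<mu>\<^sub>0 z) \<le> K * xn z" using clo_bounded[OF B_clo] by blast
  have inj0: "xn z = 0" if z: "z \<in> X" "AE t in M. L (Ap \<mu>\<^sub>0) z t = 0" "B \<mu>\<^sub>0 z = 0" for z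
  proof -
    have "z t = 0" if "t \<in> {a..b}" for t using homogeneous_trivial[OF z that] .
    then have "xn z = xn (\<lambda>_. 0)" by (intro Wv_cong(2)[OF Wv_zero(1)] eqvI) simp
    then show ?thesis by (simp add: Wv_zero)
  qed
  have "\<exists>v\<in>X. \<exists>Y. B \<mu>\<^sub>0 v = axis j 1 \<and> ((\<lambda>\<mu>. xn (\<lambda>t. Y \<mu> t - v t)) \<longlongrightarrow> 0) (at \<mu>\<^sub>0) \<and>
      (\<forall>\<^sub>F \<mu> in nhds \<mu>\<^sub>0. Y \<mu> \<in> X \<and> (AE t in M. L (Ap \<mu>) (Y \<mu>) t = 0) \<and> B \<mu> (Y \<mu>) = axis j 1)" for j
  proof -
    have "surj (\<lambda>q. B \<mu>\<^sub>0 (\<Psi> \<mu>\<^sub>0 q))" by (rule B_surj(2)) (rule inj0)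
    then obtain q where "axis j 1 = B \<mu>\<^sub>0 (\<Psi> \<mu>\<^sub>0 q)" by (rule surjE)
    with continuous_family[of "\<lambda>_ _. 0" "\<Psi> \<mu>\<^sub>0 q" "axis j 1"] \<Psi>[of \<mu>\<^sub>0 q] show ?thesis
      by (auto simp: Wv_zero)
  qed
  then have "\<forall>j. \<exists>v Y. v \<in> X \<and> B \<mu>\<^sub>0 v = axis j 1 \<and> ((\<lambda>\<mu>. xn (\<lambda>t. Y \<mu> t - v t)) \<longlongrightarrow> 0) (at \<mu>\<^sub>0) \<and>
      (\<forall>\<^sub>F \<mu> in nhds \<mu>\<^sub>0. Y \<mu> \<in> X \<and> (AE t in M. L (Ap \<mu>) (Y \<mu>) t = 0) \<and> B \<mu> (Y \<mu>) = axis j 1)"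
    by blast
  from choice[OF this] obtain v where "\<forall>j. \<exists>Y. v j \<in> X \<and> B \<mu>\<^sub>0 (v j) = axis j 1 \<and> ((\<lambda>\<mu>. xn (\<lambda>t. Y \<mu> t - v j t)) \<longlongrightarrow> 0) (at \<mu>\<^sub>0) \<and>
      (\<forall>\<^sub>F \<mu> in nhds \<mu>\<^sub>0. Y \<mu> \<in> X \<and> (AE t in M. L (Ap \<mu>) (Y \<mu>) t = 0) \<and> B \<mu> (Y \<mu>) = axis j 1)"
    by blast
  from choice[OF this] obtain Y where v: "\<And>j. v j \<in> X" "\<And>j. B \<mu>\<^sub>0 (v j) = axis j 1"
    and Ylim: "\<And>j. ((\<lambda>\<mu>. xn (\<lambda>t. Y j \<mu> t - v j t)) \<longlongrightarrow> 0) (at \<mu>\<^sub>0)"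
    and Y: "\<And>j. \<forall>\<^sub>F \<mu> in nhds \<mu>\<^sub>0. Y j \<mu> \<in> X \<and> (AE t in M. L (Ap \<mu>) (Y j \<mu>) t = 0) \<and> B \<mu> (Y j \<mu>) = axis j 1"
    by blast
  \<comment> \<open>Here the convergence of the coefficients, already established, enters: it makes
    L (Ap \<mu>) y an admissible family of right-hand sides.\<close>
  have limf: "((\<lambda>\<mu>. vn n (\<lambda>t. L (Ap \<mu>) y t - L (Ap \<mu>\<^sub>0) y t)) \<longlongrightarrow> 0) (at \<mu>\<^sub>0)"
    unfolding L_perturb
  proof (rule Lim_null_comparison)
    show "\<forall>\<^sub>F \<mu> in at \<mu>\<^sub>0. norm (vn n (\<lambda>t. Q (dA \<mu>) y t)) \<le> KM n * an (dA \<mu>) * xn y"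
      using Q_dA(2)[OF y] by (intro always_eventually) simp
    show "((\<lambda>\<mu>. KM n * an (dA \<mu>) * xn y) \<longlongrightarrow> 0) (at \<mu>\<^sub>0)"
      by (intro tendsto_mult_left_zero tendsto_mult_right_zero coefficients_converge)
  qed
  obtain u where u: "\<forall>\<^sub>F \<mu> in nhds \<mu>\<^sub>0. u \<mu> \<in> X \<and> (AE t in M. L (Ap \<mu>) (u \<mu>) t = L (Ap \<mu>) y t) \<and> B \<mu> (u \<mu>) = B \<mu>\<^sub>0 y"
    and ulim: "((\<lambda>\<mu>. xn (\<lambda>t. u \<mu> t - y t)) \<longlongrightarrow> 0) (at \<mu>\<^sub>0)"
    using continuous_family[of "\<lambda>\<mu>. L (Ap \<mu>) y", OF L_W(1)[OF Ap y] limf y] by auto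
  define \<eta> where "\<eta> \<mu> = (\<Sum>j\<in>UNIV. K * xn (\<lambda>t. Y j \<mu> t - v j t))" for \<mu>
  have "(\<eta> \<longlongrightarrow> 0) (at \<mu>\<^sub>0)"
    unfolding \<eta>_def[abs_def] by (intro tendsto_null_sum tendsto_mult_right_zero Ylim)
  then have \<eta>: "\<forall>\<^sub>F \<mu> in at \<mu>\<^sub>0. \<eta> \<mu> < 1 / 2" by (rule order_tendstoD(2)) simp
  have "\<forall>\<^sub>F \<mu> in nhds \<mu>\<^sub>0. \<forall>j\<in>UNIV. Y j \<mu> \<in> X \<and> (AE t in M. L (Ap \<mu>) (Y j \<mu>) t = 0) \<and> B \<mu> (Y j \<mu>) = axis j 1"
    using Y by (intro eventually_ball_finite) auto
  with u unique_solution_near have "\<forall>\<^sub>F \<mu> in nhds \<mu>\<^sub>0.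
      norm (B \<mu> y - B \<mu>\<^sub>0 y) \<le> K * xn (\<lambda>t. u \<mu> t - y t) + norm (B \<mu> y - B \<mu>\<^sub>0 y) * \<eta> \<mu>"
  proof eventually_elim
    case (elim \<mu>)
    have u\<mu>: "u \<mu> \<in> X" "AE t in M. L (Ap \<mu>) (u \<mu>) t = L (Ap \<mu>) y t" "B \<mu> (u \<mu>) = B \<mu>\<^sub>0 y"
      using elim(1) by auto
    have Y\<mu>: "Y j \<mu> \<in> X" "AE t in M. L (Ap \<mu>) (Y j \<mu>) t = 0" "B \<mu> (Y j \<mu>) = axis j 1" for j
      using elim(3) by auto
    define d where "d = B \<mu> y - B \<mu>\<^sub>0 y"
    let ?z = "\<lambda>t. y t - u \<mu> t" and ?s = "\<lambda>t. \<Sum>j\<in>UNIV. d $ j *s Y j \<mu> t"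
    have sum_axis: "(\<Sum>j\<in>UNIV. d $ j *s axis j 1) = d"
      by (simp add: vec_eq_iff axis_def if_distrib[of "\<lambda>x. _ * x"] cong: if_cong)
    have z: "?z \<in> X" by (rule Wv_diff(1)[OF y u\<mu>(1)])
    have s: "?s \<in> X" "AE t in M. L (Ap \<mu>) ?s t = 0"
      using combination[where f = "\<lambda>j. Y j \<mu>" and q = d and I = UNIV, OF Y\<mu>(1,2) finite] by auto
    have "AE t in M. L (Ap \<mu>) ?z t = 0"
      using L_diff[OF y u\<mu>(1), of "Ap \<mu>"] u\<mu>(2) by eventually_elim simp
    then have "bvp_solution a b p n r (Ap \<mu>) (B \<mu>) (\<lambda>_. 0) d ?z"
      unfolding bvp_sol_iff[OF Wv_zero(1)] using z clo_diff[OF B_clo y u\<mu>(1), of \<mu>] u\<mu>(3) by (simp add: d_def)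
    moreover have "B \<mu> ?s = d"
      using clo_sum[where T = "B \<mu>" and I = UNIV and q = "($) d", OF B_clo finite Y\<mu>(1)] Y\<mu>(3) sum_axis by simp
    then have "bvp_solution a b p n r (Ap \<mu>) (B \<mu>) (\<lambda>_. 0) d ?s"
      unfolding bvp_sol_iff[OF Wv_zero(1)] using s by simp
    ultimately have "?z t = ?s t" if "t \<in> {a..b}" for t
      using elim(2) Wv_zero(1)[of n] that unfolding bvp_unique_solution_def by blast
    \<comment> \<open>Applying the fixed operator recovers d up to an error: B at
      \<open>\<mu>\<^sub>0\<close> sends v j to the j-th unit vector, so Y j \<mu> contributes that
      vector plus the image of Y j \<mu> - v j.\<close>
    then have "B \<mu>\<^sub>0 ?z = B \<mu>\<^sub>0 ?s" by (rule clo_cong[OF B_clo z s(1)])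
    also have "\<dots> = (\<Sum>j\<in>UNIV. d $ j *s B \<mu>\<^sub>0 (Y j \<mu>))"
      using clo_sum[where T = "B \<mu>\<^sub>0" and I = UNIV and q = "($) d", OF B_clo finite Y\<mu>(1)] by simp
    also have "\<dots> = (\<Sum>j\<in>UNIV. d $ j *s axis j 1 + d $ j *s B \<mu>\<^sub>0 (\<lambda>t. Y j \<mu> t - v j t))"
      by (intro sum.cong refl) (simp add: clo_diff[OF B_clo Y\<mu>(1) v(1)] v(2) vec.scale_right_diff_distrib)
    also have "\<dots> = d + (\<Sum>j\<in>UNIV. d $ j *s B \<mu>\<^sub>0 (\<lambda>t. Y j \<mu> t - v j t))"
      by (simp only: sum.distrib sum_axis)
    finally have "d = B \<mu>\<^sub>0 ?z - (\<Sum>j\<in>UNIV. d $ j *s B \<mu>\<^sub>0 (\<lambda>t. Y j \<mu> t - v j t))" by simp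
    then have "norm d = norm (B \<mu>\<^sub>0 ?z - (\<Sum>j\<in>UNIV. d $ j *s B \<mu>\<^sub>0 (\<lambda>t. Y j \<mu> t - v j t)))"
      by (rule arg_cong)
    also have "\<dots> \<le> norm (B \<mu>\<^sub>0 ?z) + norm (\<Sum>j\<in>UNIV. d $ j *s B \<mu>\<^sub>0 (\<lambda>t. Y j \<mu> t - v j t))"
      by (rule norm_triangle_ineq4)
    also have "norm (B \<mu>\<^sub>0 ?z) \<le> K * xn (\<lambda>t. u \<mu> t - y t)"
      using K(2)[OF z] Wv_minus(2)[OF Wv_diff(1)[OF u\<mu>(1) y]] by simp
    also have "norm (\<Sum>j\<in>UNIV. d $ j *s B \<mu>\<^sub>0 (\<lambda>t. Y j \<mu> t - v j t)) \<le> (\<Sum>j\<in>UNIV. norm d * (K * xn (\<lambda>t. Y j \<mu> t - v j t)))"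
    proof (rule sum_norm_le)
      fix j
      have "norm (d $ j *s B \<mu>\<^sub>0 (\<lambda>t. Y j \<mu> t - v j t)) \<le> norm (d $ j) * norm (B \<mu>\<^sub>0 (\<lambda>t. Y j \<mu> t - v j t))"
        by (rule norm_smult_le)
      also have "\<dots> \<le> norm d * (K * xn (\<lambda>t. Y j \<mu> t - v j t))"
        by (intro mult_mono Finite_Cartesian_Product.norm_nth_le K(2) Wv_diff Y\<mu> v) auto
      finally show "norm (d $ j *s B \<mu>\<^sub>0 (\<lambda>t. Y j \<mu> t - v j t)) \<le> norm d * (K * xn (\<lambda>t. Y j \<mu> t - v j t))" .
    qed
    finally show ?case by (simp add: d_def \<eta>_def sum_distrib_left)
  qed
  then have "\<forall>\<^sub>F \<mu> in at \<mu>\<^sub>0.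
      norm (B \<mu> y - B \<mu>\<^sub>0 y) \<le> K * xn (\<lambda>t. u \<mu> t - y t) + norm (B \<mu> y - B \<mu>\<^sub>0 y) * \<eta> \<mu>"
    by (simp add: eventually_nhds_conv_at)
  \<comment> \<open>As \<eta> \<mu> < 1 / 2, the term containing the unknown difference is absorbed
    at the cost of a factor 2.\<close>
  with \<eta> have "\<forall>\<^sub>F \<mu> in at \<mu>\<^sub>0. norm (B \<mu> y - B \<mu>\<^sub>0 y) \<le> 2 * (K * xn (\<lambda>t. u \<mu> t - y t))"
  proof eventually_elim
    case (elim \<mu>)
    have "norm (B \<mu> y - B \<mu>\<^sub>0 y) * \<eta> \<mu> \<le> norm (B \<mu> y - B \<mu>\<^sub>0 y) * (1 / 2)"
      using elim(1) by (intro mult_left_mono) auto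
    with elim(2) show ?case by simp
  qed
  moreover have "((\<lambda>\<mu>. 2 * (K * xn (\<lambda>t. u \<mu> t - y t))) \<longlongrightarrow> 0) (at \<mu>\<^sub>0)"
    by (intro tendsto_mult_right_zero ulim)
  ultimately have "((\<lambda>\<mu>. B \<mu> y - B \<mu>\<^sub>0 y) \<longlongrightarrow> 0) (at \<mu>\<^sub>0)" by (rule Lim_null_comparison)
  then show ?thesis by (rule LIM_zero_cancel)
qed

end

end

theorem theorem4:
  fixes a b :: real
    and p :: ennreal
    and n r :: nat
    and \<mu>\<^sub>0 :: "'p::metric_space"
    and A :: "nat \<Rightarrow> 'p \<Rightarrow> real \<Rightarrow> complex ^ 'm ^ 'm"
    and B :: "'p \<Rightarrow> (real \<Rightarrow> complex ^ 'm) \<Rightarrow> complex ^ 'k"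
  assumes "a < b"
    and "1 \<le> p"
    and "1 \<le> r"
    and "CARD('k) = r * CARD('m)"
    and "\<mu>\<^sub>0 islimpt UNIV"
    and "\<And>\<mu> l. l \<in> {1..r} \<Longrightarrow> A (r - l) \<mu> \<in> sobolev_mat a b p n"
    and "\<And>\<mu>. continuous_linear_operator a b p (n + r) (B \<mu>)"
  shows "solution_depends_continuously a b p n r A B \<mu>\<^sub>0 \<longleftrightarrow>
    (\<forall>y. bvp_solution a b p n r (\<lambda>j. A j \<mu>\<^sub>0) (B \<mu>\<^sub>0) (\<lambda>_. 0) 0 y \<longrightarrow> (\<forall>t\<in>{a..b}. y t = 0)) \<and>
    (\<forall>l\<in>{1..r}. ((\<lambda>\<mu>. sobolev_mat_norm a b p n (\<lambda>t. A (r - l) \<mu> t - A (r - l) \<mu>\<^sub>0 t)) \<longlongrightarrow> 0) (at \<mu>\<^sub>0)) \<and>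
    (\<forall>y\<in>sobolev_vec a b p (n + r). ((\<lambda>\<mu>. B \<mu> y) \<longlongrightarrow> B \<mu>\<^sub>0 y) (at \<mu>\<^sub>0))"
proof -
  interpret bvp_family a b p n r A B \<mu>\<^sub>0
    using assms(1-4,6,7) by unfold_locales auto
  have hom: "(\<forall>y. bvp_solution a b p n r (\<lambda>j. A j \<mu>\<^sub>0) (B \<mu>\<^sub>0) (\<lambda>_. 0) 0 y \<longrightarrow> (\<forall>t\<in>{a..b}. y t = 0)) \<longleftrightarrow>
      (\<forall>y\<in>X. (AE t in M. L (Ap \<mu>\<^sub>0) y t = 0) \<longrightarrow> B \<mu>\<^sub>0 y = 0 \<longrightarrow> (\<forall>t\<in>{a..b}. y t = 0))"
    unfolding bvp_sol_iff[OF Wv_zero(1)] by blast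
  \<comment> \<open>The estimates see the coefficients only through the sum of their norms, so the r
    limits of (I) are merged into one.\<close>
  have lim: "(\<forall>l\<in>{1..r}. ((\<lambda>\<mu>. mn n (dA \<mu> (r - l))) \<longlongrightarrow> 0) (at \<mu>\<^sub>0)) \<longleftrightarrow> ((\<lambda>\<mu>. an (dA \<mu>)) \<longlongrightarrow> 0) (at \<mu>\<^sub>0)"
  proof
    assume "\<forall>l\<in>{1..r}. ((\<lambda>\<mu>. mn n (dA \<mu> (r - l))) \<longlongrightarrow> 0) (at \<mu>\<^sub>0)"
    then show "((\<lambda>\<mu>. an (dA \<mu>)) \<longlongrightarrow> 0) (at \<mu>\<^sub>0)" unfolding an_def by (intro tendsto_null_sum) blast
  next
    assume *: "((\<lambda>\<mu>. an (dA \<mu>)) \<longlongrightarrow> 0) (at \<mu>\<^sub>0)"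
    have "norm (mn n (dA \<mu> (r - l))) \<le> an (dA \<mu>)" if "l \<in> {1..r}" for l \<mu>
      unfolding an_def using member_le_sum[OF that, of "\<lambda>l. mn n (dA \<mu> (r - l))"] by simp
    then show "\<forall>l\<in>{1..r}. ((\<lambda>\<mu>. mn n (dA \<mu> (r - l))) \<longlongrightarrow> 0) (at \<mu>\<^sub>0)"
      by (intro ballI Lim_null_comparison[OF always_eventually *] allI)
  qed
  show ?thesis
    unfolding hom lim
  proof (intro iffI conjI ballI impI; (elim conjE)?)
    assume dep: "solution_depends_continuously a b p n r A B \<mu>\<^sub>0"
    show "((\<lambda>\<mu>. an (dA \<mu>)) \<longlongrightarrow> 0) (at \<mu>\<^sub>0)" by (rule coefficients_converge[OF dep])
    show "((\<lambda>\<mu>. B \<mu> y) \<longlongrightarrow> B \<mu>\<^sub>0 y) (at \<mu>\<^sub>0)" if "y \<in> X" for y by (rule operators_converge[OF dep that])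
    show "y t = 0" if "y \<in> X" "AE t in M. L (Ap \<mu>\<^sub>0) y t = 0" "B \<mu>\<^sub>0 y = 0" "t \<in> {a..b}" for y t
      by (rule homogeneous_trivial[OF dep that])
  next
    assume h: "\<forall>y\<in>X. (AE t in M. L (Ap \<mu>\<^sub>0) y t = 0) \<longrightarrow> B \<mu>\<^sub>0 y = 0 \<longrightarrow> (\<forall>t\<in>{a..b}. y t = 0)"
      and A: "((\<lambda>\<mu>. an (dA \<mu>)) \<longlongrightarrow> 0) (at \<mu>\<^sub>0)"
      and B: "\<forall>y\<in>X. ((\<lambda>\<mu>. B \<mu> y) \<longlongrightarrow> B \<mu>\<^sub>0 y) (at \<mu>\<^sub>0)"
    show "solution_depends_continuously a b p n r A B \<mu>\<^sub>0"
    proof (rule sufficiency[OF _ A])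
      show "((\<lambda>\<mu>. B \<mu> y) \<longlongrightarrow> B \<mu>\<^sub>0 y) (at \<mu>\<^sub>0)" if "y \<in> X" for y using B that by blast
      fix y assume y: "y \<in> X" "AE t in M. L (Ap \<mu>\<^sub>0) y t = 0" "B \<mu>\<^sub>0 y = 0"
      then have "y t = 0" if "t \<in> {a..b}" for t using h that by blast
      then have "xn y = xn (\<lambda>_. 0)" by (intro Wv_cong(2)[OF Wv_zero(1)] eqvI) simp
      then show "xn y = 0" by (simp add: Wv_zero)
    qed
  qed
qed

end
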